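(* For every real $x\geq 2$, $$\sum_{n\leq x} d(n)^2 = D_1 x\log^3 x + D_2 x\log^2 x + D_3 x\log x + D_4 x + \vartheta\!\left(9.73\, x^{3/4}\log x + 0.73\, x^{1/2}\right),$$ where, with $H(s)=1/\zeta(2s)$ and $$C_1=\tfrac{1}{6},\quad C_2=2\gamma-\tfrac12,\quad C_3=6\gamma^2-4\gamma-4\gamma_1+1,\quad C_4=4\gamma^3-6\gamma^2+4\gamma-12\gamma\gamma_1+4\gamma_1+2\gamma_2-1,$$ the constants are $$D_1=C_1H(1)=\frac{1}{\pi^2},\quad D_2=C_2H(1)+3C_1H'(1),\quad D_3=C_3H(1)+2C_2H'(1)+3C_1H''(1),$$ $$D_4=C_4H(1)+C_3H'(1)+C_2H''(1)+C_1H'''(1)$$ (numerically $D_2=0.745\ldots$, $D_3=0.824\ldots$, $D_4=0.461\ldots$). Furthermore, $\sum_{n\leq x} d(n)^2\leq \tfrac14\, x\log^3 x$ for all real $x\geq 433$, and $\sum_{n\leq x} d(n)^2\leq x\log^3 x$ for all real $x\geq 7$.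
   Context: $d(n)$ denotes the number of positive divisors of $n$. $\log$ is the natural logarithm. $\gamma$ is Euler's constant, and $\gamma_1,\gamma_2$ are the Stieltjes constants, defined by $\zeta(s)=\frac{1}{s-1}+\sum_{k\geq0}\frac{(-1)^k}{k!}\gamma_k(s-1)^k$. $H'(1),H''(1),H'''(1)$ are the derivatives of $H(s)=1/\zeta(2s)$ at $s=1$. The notation $\vartheta(y)$ denotes a quantity whose absolute value is at most $y$.
   Formalization: The printed values D_2=0.745…, D_3=0.824…, D_4=0.461… are false as decimal expansions (the formulas give 0.7443…, 0.823…, 0.460…); they are read as rounded up: 0.744<D_2≤0.745, 0.823<D_3≤0.824, 0.460<D_4≤0.461. *)

theory Defs
  imports "HOL-Analysis.Analysis"
begin

definition divisor_count :: "nat \<Rightarrow> nat" where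
  "divisor_count n = card {k. k dvd n}"

definition divisor_square_sum :: "real \<Rightarrow> real" where
  "divisor_square_sum x = (\<Sum>n | 1 \<le> n \<and> real n \<le> x. real (divisor_count n) ^ 2)"

text \<open>
  The Riemann zeta function as its Dirichlet series. It is meaningful only for Re s > 1, and
  it is used only there.
\<close>

definition zeta :: "complex \<Rightarrow> complex" where
  "zeta s = (\<Sum>n. of_nat (Suc n) powr (- s))"

text \<open>
  The Laurent expansion of zeta at 1 is required only on the part of a neighbourhood of 1 where the
  Dirichlet series converges. That part is open and accumulates at 1, so the identity theorem makes
  the coefficients unique, and they are those of the analytic continuation of zeta.
\<close>

definition stieltjes :: "nat \<Rightarrow> real" where
  "stieltjes = (THE g. \<forall>\<^sub>F s in at 1 within {s. Re s > 1}.
     (\<lambda>k. (- 1) ^ k / fact k * complex_of_real (g k) * (s - 1) ^ k) sums (zeta s - 1 / (s - 1)))"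

definition H :: "complex \<Rightarrow> complex" where
  "H s = 1 / zeta (2 * s)"

text \<open>
  The k-th complex derivative of H at 1. Its value is real because H is real on the real
  half-line s > 1/2; Re only changes the type.
\<close>

definition H_deriv1 :: "nat \<Rightarrow> real" where
  "H_deriv1 k = Re ((deriv ^^ k) H 1)"

definition C1 :: real where
  "C1 = 1 / 6"

definition C2 :: real where
  "C2 = 2 * euler_mascheroni - 1 / 2"

definition C3 :: real where
  "C3 = 6 * euler_mascheroni ^ 2 - 4 * euler_mascheroni - 4 * stieltjes 1 + 1"

definition C4 :: real where
  "C4 = 4 * euler_mascheroni ^ 3 - 6 * euler_mascheroni ^ 2 + 4 * euler_mascheroni
      - 12 * euler_mascheroni * stieltjes 1 + 4 * stieltjes 1 + 2 * stieltjes 2 - 1"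

definition D1 :: real where
  "D1 = C1 * H_deriv1 0"

definition D2 :: real where
  "D2 = C2 * H_deriv1 0 + 3 * C1 * H_deriv1 1"

definition D3 :: real where
  "D3 = C3 * H_deriv1 0 + 2 * C2 * H_deriv1 1 + 3 * C1 * H_deriv1 2"

definition D4 :: real where
  "D4 = C4 * H_deriv1 0 + C3 * H_deriv1 1 + C2 * H_deriv1 2 + C1 * H_deriv1 3"

end

theory Submission
  imports Defs "HOL-Complex_Analysis.Complex_Analysis" "HOL-Computational_Algebra.Squarefree"
    "HOL-Real_Asymp.Real_Asymp"
begin

text \<open>
  The fourfold divisor function \<open>d * d\<close> satisfies \<open>(d * d)(n) = \<Sum> d(n / t\<^sup>2)\<^sup>2\<close>, summed over \<open>t\<^sup>2 | n\<close>,
  which is the identity \<open>\<zeta>(s)\<^sup>4 = \<zeta>(2 s) \<Sum> d(n)\<^sup>2 n\<^sup>-\<^sup>s\<close>. Moebius inversion therefore reduces the sum of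
  \<open>d(n)\<^sup>2\<close> to the summatory function \<open>T\<close> of \<open>d * d\<close>, evaluated at \<open>x / m\<^sup>2\<close>. The hyperbola method with cutoff
  \<open>\<surd>x\<close>, Dirichlet's bound \<open>\<surd>x + 1 / 3\<close> for the error in the divisor problem, and expansions of
  \<open>\<Sum> ln\<^sup>k (x / n) / n\<close> with error \<open>O(1 / x\<^sup>2)\<close> (for \<open>k = 0\<close> after removing a sawtooth) give \<open>T(x) = x P(ln x)\<close> up to \<open>2 x\<^sup>3\<^sup>/\<^sup>4 ln x + 18 \<surd>x\<close>, and
  summation over \<open>m\<close> an error \<open>5.28 x\<^sup>3\<^sup>/\<^sup>4 ln x + O(\<surd>x ln x)\<close>. This is below the claimed error from
  \<open>x = 361\<close> on, and small enough for the bound \<open>x ln\<^sup>3 x / 4\<close> from \<open>x = 1296\<close> on; smaller \<open>x\<close> are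
  covered by computing the sum. The constants are identified through the Laurent expansion of \<open>\<zeta>\<close> at 1 and
  termwise differentiation of \<open>\<Sum> \<mu>(m) m\<^sup>-\<^sup>2\<^sup>s\<close>; their values come from Euler-Maclaurin summation.
\<close>

section \<open>Sums over the lattice points below a hyperbola\<close>

text \<open>The exponent 3/4 comes from bounding Dirichlet's error by absolute values: with
  \<open>z = sqrt x\<close>, the sum of \<open>d(n) * sqrt (x / n)\<close> over
  \<open>n \<le> z\<close> has size \<open>x powr (3 / 4) * ln x\<close>. Every other contribution
  should then stay at \<open>O(sqrt x * ln x)\<close>, which is not automatic. The sum of
  \<open>d(n) / n\<close> up to \<open>z\<close> is known by its smooth main term only up to
  \<open>O(1 / sqrt z)\<close>, and the factor \<open>x * ln x\<close> in front of it would create a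
  second term of the critical size. The way out is to leave the error \<open>Dl z\<close> of the
  divisor problem unestimated: it enters the sum of \<open>d(n) / n\<close> as
  \<open>Dl z / z\<close>, and the square of the sum of \<open>d(n)\<close> as a cross term, and the
  two cancel exactly in the hyperbola formula. The resulting coefficient 5.28 leaves nearly half of
  9.73 as room for the terms of order \<open>sqrt x\<close>, and this room decides where the finite
  computation may stop.\<close>

definition nle :: "real \<Rightarrow> nat set" where
  "nle x = {n. 1 \<le> n \<and> real n \<le> x}"

lemma mem_nle: "n \<in> nle x \<longleftrightarrow> 1 \<le> n \<and> real n \<le> x"
  by (simp add: nle_def)

lemma nle_eq: "nle x = {1..nat \<lfloor>x\<rfloor>}"
  by (auto simp: nle_def nat_le_iff le_nat_iff le_floor_iff) linarith+

lemma finite_nle [simp, intro]: "finite (nle x)"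
  by (simp add: nle_eq)

lemma nle_of_nat: "nle (real n) = {1..n}"
  by (simp add: nle_eq)

text \<open>Both sides run over the lattice points \<open>(a, b)\<close> with
  \<open>a * b \<le> x\<close>, grouped once by the product and once by the first
  coordinate.\<close>

lemma sum_divisors_lattice:
  fixes f :: "nat \<Rightarrow> nat \<Rightarrow> 'a :: comm_monoid_add"
  shows "(\<Sum>n\<in>nle x. \<Sum>a | a dvd n. f a (n div a)) = (\<Sum>a\<in>nle x. \<Sum>b\<in>nle (x / real a). f a b)"
proof -
  have fin: "finite {a. a dvd n}" if "n \<in> nle x" for n
    using that by (intro finite_divisors_nat) (auto simp: mem_nle)
  have "(\<Sum>n\<in>nle x. \<Sum>a | a dvd n. f a (n div a))
      = (\<Sum>(n, a)\<in>Sigma (nle x) (\<lambda>n. {a. a dvd n}). f a (n div a))"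
    using fin by (subst sum.Sigma) auto
  also have "\<dots> = (\<Sum>(a, b)\<in>Sigma (nle x) (\<lambda>a. nle (x / real a)). f a b)"
  proof (rule sum.reindex_bij_witness[of _ "\<lambda>(a, b). (a * b, a)" "\<lambda>(n, a). (a, n div a)"])
    fix p assume "p \<in> Sigma (nle x) (\<lambda>n. {a. a dvd n})"
    then obtain n a where p: "p = (n, a)" "1 \<le> n" "real n \<le> x" "a dvd n"
      by (auto simp: mem_nle)
    then obtain b where b: "n = a * b" by auto
    with p have "a \<ge> 1" "b \<ge> 1" by (auto intro: Suc_leI)
    moreover have "a \<le> n" using b \<open>b \<ge> 1\<close> by simp
    then have "real a \<le> x" using p(3) by linarith
    moreover have "real b \<le> x / real a" using p b \<open>a \<ge> 1\<close> by (simp add: field_simps)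
    ultimately show "(case p of (n, a) \<Rightarrow> (a, n div a)) \<in> Sigma (nle x) (\<lambda>a. nle (x / real a))"
      using p b by (auto simp: mem_nle)
  next
    fix p assume "p \<in> Sigma (nle x) (\<lambda>a. nle (x / real a))"
    then show "(case p of (a, b) \<Rightarrow> (a * b, a)) \<in> Sigma (nle x) (\<lambda>n. {a. a dvd n})"
      by (auto simp: mem_nle field_simps)
  qed (auto simp: mem_nle)
  also have "\<dots> = (\<Sum>a\<in>nle x. \<Sum>b\<in>nle (x / real a). f a b)"
    by (subst sum.Sigma) auto
  finally show ?thesis .
qed

text \<open>Of two factors with product at most \<open>x\<close> one is at most
  \<open>sqrt x\<close>, so \<open>P\<close> and its mirror image \<open>Q\<close> cover the region.
  Their overlap is the full square, where the condition on the product holds by itself, and symmetry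
  of \<open>f\<close> gives \<open>P\<close> and \<open>Q\<close> equal sums.\<close>

lemma hyperbola:
  fixes f :: "nat \<Rightarrow> nat \<Rightarrow> real"
  assumes "x \<ge> 0" and sym: "\<And>a b. f a b = f b a"
  shows "(\<Sum>a\<in>nle x. \<Sum>b\<in>nle (x / real a). f a b)
      = 2 * (\<Sum>a\<in>nle (sqrt x). \<Sum>b\<in>nle (x / real a). f a b)
        - (\<Sum>a\<in>nle (sqrt x). \<Sum>b\<in>nle (sqrt x). f a b)"
proof -
  define S where "S = Sigma (nle x) (\<lambda>a. nle (x / real a))"
  define P where "P = Sigma (nle (sqrt x)) (\<lambda>a. nle (x / real a))"
  define Q where "Q = (\<lambda>(a, b). (b, a)) ` P"
  define F where "F = (\<lambda>(a, b). f a b)"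
  have fin: "finite P" "finite Q" by (auto simp: P_def Q_def)
  have memS: "(a, b) \<in> S \<longleftrightarrow> 1 \<le> a \<and> 1 \<le> b \<and> real a * real b \<le> x" for a b
  proof -
    have "real a \<le> x" if "1 \<le> a" "1 \<le> b" "real a * real b \<le> x"
    proof -
      have "real a * 1 \<le> real a * real b" using that by (intro mult_left_mono) auto
      then show ?thesis using that by linarith
    qed
    then show ?thesis by (auto simp: S_def mem_nle field_simps)
  qed
  have memP: "(a, b) \<in> P \<longleftrightarrow> 1 \<le> a \<and> 1 \<le> b \<and> real a * real b \<le> x \<and> real a \<le> sqrt x" for a b
    by (auto simp: P_def mem_nle field_simps)
  have memQ: "(a, b) \<in> Q \<longleftrightarrow> 1 \<le> a \<and> 1 \<le> b \<and> real a * real b \<le> x \<and> real b \<le> sqrt x" for a b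
    using memP[of b a] by (force simp: Q_def image_iff mult.commute)
  have "S = P \<union> Q"
  proof -
    have "real a \<le> sqrt x \<or> real b \<le> sqrt x" if "real a * real b \<le> x" for a b :: nat
    proof (rule ccontr)
      assume "\<not> ?thesis"
      then have "sqrt x * sqrt x < real a * real b"
        using assms by (intro mult_strict_mono') auto
      then show False using that assms by simp
    qed
    then have "p \<in> S \<longleftrightarrow> p \<in> P \<union> Q" for p
      using memS memP memQ by (cases p) blast
    then show ?thesis by blast
  qed
  moreover have "P \<inter> Q = nle (sqrt x) \<times> nle (sqrt x)"
  proof -
    have "real a * real b \<le> x" if "real a \<le> sqrt x" "real b \<le> sqrt x" for a b :: nat
    proof -
      have "real a * real b \<le> sqrt x * sqrt x" using that assms by (intro mult_mono) auto
      then show ?thesis using assms by simp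
    qed
    then show ?thesis using memP memQ by (auto simp: mem_nle)
  qed
  moreover have "sum F (P \<union> Q) + sum F (P \<inter> Q) = sum F P + sum F Q"
    by (rule sum.union_inter) (use fin in auto)
  moreover have "sum F Q = sum F P"
    unfolding Q_def by (subst sum.reindex) (auto simp: inj_on_def F_def sym intro!: sum.cong)
  moreover have "sum F S = (\<Sum>a\<in>nle x. \<Sum>b\<in>nle (x / real a). f a b)"
    unfolding S_def F_def by (subst sum.Sigma) auto
  moreover have "sum F P = (\<Sum>a\<in>nle (sqrt x). \<Sum>b\<in>nle (x / real a). f a b)"
    unfolding P_def F_def by (subst sum.Sigma) auto
  moreover have "sum F (nle (sqrt x) \<times> nle (sqrt x)) = (\<Sum>a\<in>nle (sqrt x). \<Sum>b\<in>nle (sqrt x). f a b)"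
    unfolding F_def by (subst sum.Sigma) auto
  ultimately show ?thesis by simp
qed

section \<open>The square of the divisor function\<close>

definition divisor_pairs :: "nat \<Rightarrow> nat" where
  "divisor_pairs n = (\<Sum>a | a dvd n. divisor_count a * divisor_count (n div a))"

text \<open>An ordered factorisation of \<open>n\<close> into four factors is fixed by the first
  three, which may be any triple whose product divides \<open>n\<close>. Here
  \<open>(p, a, c)\<close> stands for the factors \<open>a\<close>, \<open>p div a\<close> and
  \<open>c\<close>.\<close>

lemma divisor_pairs_eq_card:
  assumes "n > 0"
  shows "divisor_pairs n = card {(a, b, c). a * b * c dvd n}"
proof -
  have fin: "finite {k. k dvd m}" if "m dvd n" for m
    using that assms by (intro finite_divisors_nat) (auto intro: gr0I)
  have "divisor_pairs n = (\<Sum>p | p dvd n. card ({k. k dvd p} \<times> {k. k dvd n div p}))"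
    by (simp add: divisor_pairs_def divisor_count_def card_cartesian_product)
  also have "\<dots> = card (SIGMA p : {p. p dvd n}. {k. k dvd p} \<times> {k. k dvd n div p})"
    using fin by (subst card_SigmaI) (auto simp: div_dvd_iff_mult)
  also have "\<dots> = card {(a, b, c). a * b * c dvd n}"
  proof (rule bij_betw_same_card)
    show "bij_betw (\<lambda>(p, a, c). (a, p div a, c))
        (SIGMA p : {p. p dvd n}. {k. k dvd p} \<times> {k. k dvd n div p}) {(a, b, c). a * b * c dvd n}"
    proof (rule bij_betw_byWitness[where f' = "\<lambda>(a, b, c). (a * b, a, c)"])
      show "\<forall>a\<in>(SIGMA p : {p. p dvd n}. {k. k dvd p} \<times> {k. k dvd n div p}).
          (\<lambda>(a, b, c). (a * b, a, c)) ((\<lambda>(p, a, c). (a, p div a, c)) a) = a" by auto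
      show "\<forall>a'\<in>{(a, b, c). a * b * c dvd n}.
          (\<lambda>(p, a, c). (a, p div a, c)) ((\<lambda>(a, b, c). (a * b, a, c)) a') = a'"
        using assms by (auto intro: gr0I)
      show "(\<lambda>(p, a, c). (a, p div a, c)) ` (SIGMA p : {p. p dvd n}. {k. k dvd p} \<times> {k. k dvd n div p})
          \<subseteq> {(a, b, c). a * b * c dvd n}"
        using assms by (auto simp: dvd_div_iff_mult mult.commute dest!: dvd_div_iff_mult[THEN iffD1, rotated 2])
      show "(\<lambda>(a, b, c). (a * b, a, c)) ` {(a, b, c). a * b * c dvd n}
          \<subseteq> (SIGMA p : {p. p dvd n}. {k. k dvd p} \<times> {k. k dvd n div p})"
        using assms by (auto simp: dvd_div_iff_mult mult.commute dest: dvd_mult_left)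
    qed
  qed
  finally show ?thesis .
qed

text \<open>
  A triple \<open>(a, b, c)\<close> with \<open>a b c | n\<close> corresponds to \<open>t = gcd(b, c)\<close> and the divisors
  \<open>u = a b / t\<close>, \<open>v = a c / t\<close> of \<open>n / t\<^sup>2\<close>; conversely \<open>a = gcd(u, v)\<close>, \<open>b = t u / a\<close>, \<open>c = t v / a\<close>,
  so that \<open>a b c = t\<^sup>2 lcm(u, v)\<close>.
\<close>
lemma divisor_pairs_eq_sum_squares:
  assumes "n > 0"
  shows "divisor_pairs n = (\<Sum>t | t\<^sup>2 dvd n. (divisor_count (n div t\<^sup>2))\<^sup>2)"
proof -
  have fin: "finite {k. k dvd m}" if "m dvd n" for m
    using that assms by (intro finite_divisors_nat) (auto intro: gr0I)
  have fin2: "finite {t. t\<^sup>2 dvd n}"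
    by (rule finite_subset[OF _ fin[of n]]) (auto simp: power2_eq_square dest: dvd_mult_left)
  define A where "A = {(a, b, c). a * b * c dvd n}"
  define B where "B = (SIGMA t : {t. t\<^sup>2 dvd n}. {k. k dvd n div t\<^sup>2} \<times> {k. k dvd n div t\<^sup>2})"
  have "(\<Sum>t | t\<^sup>2 dvd n. (divisor_count (n div t\<^sup>2))\<^sup>2) = card B"
    unfolding B_def using fin fin2
    by (subst card_SigmaI)
       (auto simp: divisor_count_def card_cartesian_product power2_eq_square div_dvd_iff_mult)
  moreover have "card A = card B"
  proof (rule bij_betw_same_card)
    define F where "F = (\<lambda>(a, b, c). (gcd b c, a * b div gcd b c, a * c div gcd b (c::nat)))"
    define G where "G = (\<lambda>(t, u, v). (gcd u v, t * u div gcd u v, t * v div gcd u (v::nat)))"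
    have 1: "F p \<in> B \<and> G (F p) = p" if "p \<in> A" for p
    proof -
      from that obtain a b c where p: "p = (a, b, c)" "a * b * c dvd n" by (auto simp: A_def)
      with assms have pos: "a > 0" "b > 0" "c > 0" by (auto intro: gr0I)
      define t where "t = gcd b c"
      have "t > 0" using pos by (simp add: t_def)
      obtain b' where b: "b = t * b'" by (metis dvd_def gcd_dvd1 t_def)
      obtain c' where c: "c = t * c'" by (metis dvd_def gcd_dvd2 t_def)
      have cop: "gcd b' c' = 1"
      proof -
        have "t * gcd b' c' = gcd b c" unfolding gcd_mult_distrib_nat b[symmetric] c[symmetric] ..
        then have "t * gcd b' c' = t * 1" by (simp add: t_def)
        then show ?thesis using \<open>t > 0\<close> by (simp del: mult_1_right)
      qed
      have F: "F p = (t, a * b', a * c')"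
      proof -
        have "a * b div t = a * b'" "a * c div t = a * c'" using \<open>t > 0\<close> b c by simp_all
        then show ?thesis by (simp add: F_def p t_def)
      qed
      have gcd: "gcd (a * b') (a * c') = a" using cop by (simp add: gcd_mult_distrib_nat[symmetric])
      have "G (F p) = p"
        unfolding F G_def prod.case gcd using pos p by (simp add: b c)
      moreover have "t\<^sup>2 * (a * b' * c') dvd n"
        using p(2) by (simp add: b c power2_eq_square ac_simps)
      then have t2: "t\<^sup>2 dvd n" and "a * b' * c' dvd n div t\<^sup>2"
        using \<open>t > 0\<close> by (auto simp: dvd_div_iff_mult mult.commute dest: dvd_mult_left)
      then have "a * b' dvd n div t\<^sup>2" "a * c' dvd n div t\<^sup>2"
        by (metis dvd_mult_left, metis dvd_mult_left mult.assoc mult.commute)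
      ultimately show ?thesis using t2 by (auto simp: F B_def)
    qed
    have 2: "G q \<in> A \<and> F (G q) = q" if "q \<in> B" for q
    proof -
      from that obtain t u v where q: "q = (t, u, v)" "t\<^sup>2 dvd n" "u dvd n div t\<^sup>2" "v dvd n div t\<^sup>2"
        by (auto simp: B_def)
      have "t > 0" using q assms by (auto intro: gr0I)
      have "n div t\<^sup>2 > 0" using q assms by (metis div_greater_zero_iff dvd_imp_le neq0_conv zero_less_power \<open>t > 0\<close>)
      then have pos: "u > 0" "v > 0" using q by (auto intro: gr0I)
      define g where "g = gcd u v"
      have "g > 0" using pos by (simp add: g_def)
      obtain u' where u: "u = g * u'" by (metis dvd_def gcd_dvd1 g_def)
      obtain v' where v: "v = g * v'" by (metis dvd_def gcd_dvd2 g_def)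
      have cop: "gcd u' v' = 1"
      proof -
        have "g * gcd u' v' = gcd u v" unfolding gcd_mult_distrib_nat u[symmetric] v[symmetric] ..
        then have "g * gcd u' v' = g * 1" by (simp add: g_def)
        then show ?thesis using \<open>g > 0\<close> by (simp del: mult_1_right)
      qed
      have G: "G q = (g, t * u', t * v')"
      proof -
        have "t * u div g = t * u'" "t * v div g = t * v'" using \<open>g > 0\<close> u v by simp_all
        then show ?thesis by (simp add: G_def q g_def)
      qed
      have gcd: "gcd (t * u') (t * v') = t" using cop by (simp add: gcd_mult_distrib_nat[symmetric])
      have "F (G q) = q"
        unfolding G F_def prod.case gcd using \<open>t > 0\<close> q by (simp add: u v)
      moreover have "lcm u v = g * u' * v'"
        using \<open>g > 0\<close> cop by (simp add: u v lcm_nat_def gcd_mult_distrib_nat[symmetric])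
      then have "g * u' * v' dvd n div t\<^sup>2" using q by (metis lcm_least)
      then have "(g * u' * v') * t\<^sup>2 dvd n" using q \<open>t > 0\<close> by (simp add: dvd_div_iff_mult)
      then have "g * (t * u') * (t * v') dvd n" by (simp add: power2_eq_square ac_simps)
      ultimately show ?thesis by (auto simp: G A_def)
    qed
    show "bij_betw F A B"
      by (rule bij_betw_byWitness[where f' = G]) (use 1 2 in blast)+
  qed
  ultimately show ?thesis using divisor_pairs_eq_card[OF assms] by (simp add: A_def)
qed

definition divisor_pairs_sum :: "real \<Rightarrow> real" where
  "divisor_pairs_sum x = (\<Sum>n\<in>nle x. real (divisor_pairs n))"

lemma divisor_square_sum_altdef:
  "divisor_square_sum x = (\<Sum>n\<in>nle x. (real (divisor_count n))\<^sup>2)"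
  by (simp add: divisor_square_sum_def nle_def)

text \<open>The pair \<open>(n, t)\<close> becomes \<open>(t, m)\<close> with
  \<open>n = t\<^sup>2 * m\<close>, and \<open>t \<le> sqrt x\<close> is automatic because
  \<open>m \<ge> 1\<close>. In this form the sum is a convolution in \<open>t\<close> that
  \<open>mu\<close> can invert.\<close>

lemma divisor_pairs_sum_eq:
  assumes "x \<ge> 0"
  shows "divisor_pairs_sum x = (\<Sum>t\<in>nle (sqrt x). divisor_square_sum (x / (real t)\<^sup>2))"
proof -
  have fin: "finite {t. t\<^sup>2 dvd n}" if "n \<in> nle x" for n :: nat
    by (rule finite_subset[of _ "{k. k dvd n}"])
       (use that in \<open>auto simp: mem_nle power2_eq_square intro!: finite_divisors_nat dest: dvd_mult_left\<close>)
  have "divisor_pairs_sum x = (\<Sum>n\<in>nle x. \<Sum>t | t\<^sup>2 dvd n. (real (divisor_count (n div t\<^sup>2)))\<^sup>2)"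
    unfolding divisor_pairs_sum_def
    by (intro sum.cong refl) (auto simp: mem_nle divisor_pairs_eq_sum_squares)
  also have "\<dots> = (\<Sum>(n, t)\<in>Sigma (nle x) (\<lambda>n. {t. t\<^sup>2 dvd n}). (real (divisor_count (n div t\<^sup>2)))\<^sup>2)"
    using fin by (subst sum.Sigma) auto
  also have "\<dots> = (\<Sum>(t, m)\<in>Sigma (nle (sqrt x)) (\<lambda>t. nle (x / (real t)\<^sup>2)). (real (divisor_count m))\<^sup>2)"
  proof (rule sum.reindex_bij_witness[of _ "\<lambda>(t, m). (t\<^sup>2 * m, t)" "\<lambda>(n, t). (t, n div t\<^sup>2)"])
    fix p assume "p \<in> Sigma (nle x) (\<lambda>n. {t. t\<^sup>2 dvd n})"
    then obtain n t where p: "p = (n, t)" "1 \<le> n" "real n \<le> x" "t\<^sup>2 dvd n"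
      by (auto simp: mem_nle)
    then obtain m where m: "n = t\<^sup>2 * m" by auto
    with p have "t \<ge> 1" "m \<ge> 1" by (auto intro: Suc_leI gr0I simp: Suc_le_eq)
    moreover have "(real t)\<^sup>2 * real m \<le> x" using p m by simp
    moreover have "(real t)\<^sup>2 * 1 \<le> (real t)\<^sup>2 * real m" using \<open>m \<ge> 1\<close> by (intro mult_left_mono) auto
    moreover have "real t \<le> sqrt x" using calculation by (intro real_le_rsqrt) linarith
    ultimately show "(case p of (n, t) \<Rightarrow> (t, n div t\<^sup>2)) \<in> Sigma (nle (sqrt x)) (\<lambda>t. nle (x / (real t)\<^sup>2))"
      using p m by (auto simp: mem_nle field_simps)
  next
    fix p assume "p \<in> Sigma (nle (sqrt x)) (\<lambda>t. nle (x / (real t)\<^sup>2))"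
    then show "(case p of (t, m) \<Rightarrow> (t\<^sup>2 * m, t)) \<in> Sigma (nle x) (\<lambda>n. {t. t\<^sup>2 dvd n})"
      by (auto simp: mem_nle field_simps Suc_le_eq)
  qed (auto simp: mem_nle)
  also have "\<dots> = (\<Sum>t\<in>nle (sqrt x). divisor_square_sum (x / (real t)\<^sup>2))"
    by (subst sum.Sigma[symmetric]) (auto simp: divisor_square_sum_altdef)
  finally show ?thesis .
qed

section \<open>Partial sums defining the Stieltjes constants\<close>

text \<open>With \<open>m = n + 1\<close> this is \<open>ln m ^ k / m\<close> minus the integral of
  \<open>ln u ^ k / u\<close> from \<open>m\<close> to \<open>m + 1\<close>. Hence
  \<open>stj k\<close> is the k-th Stieltjes constant in its form as a limit, a usable stand-in for
  \<open>stieltjes\<close> until \<open>stieltjes_eq_stj\<close> shows that both agree.\<close>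

definition stj_term :: "nat \<Rightarrow> nat \<Rightarrow> real" where
  "stj_term k n = ln (real n + 1) ^ k / (real n + 1)
     - (ln (real n + 2) ^ Suc k - ln (real n + 1) ^ Suc k) / (real k + 1)"

definition stj :: "nat \<Rightarrow> real" where
  "stj k = (\<Sum>n. stj_term k n)"

text \<open>The mean value theorem twice: the integral equals \<open>f z\<close> for some
  \<open>z\<close> in the interval, and \<open>f z - f a\<close> is \<open>(z - a) * f' y\<close>.
  The logarithms stay explicit because \<open>zeta_laurent_sums\<close> sums this bound over
  \<open>k\<close> as an exponential series.\<close>

lemma abs_stj_term_le:
  "\<bar>stj_term k n\<bar> \<le> (real k * ln (real n + 2) ^ (k - 1) + ln (real n + 2) ^ k) / (real n + 1)\<^sup>2"
proof -
  define a where "a = real n + 1"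
  have a: "a \<ge> 1" by (simp add: a_def)
  define f :: "real \<Rightarrow> real" where "f = (\<lambda>u. ln u ^ k / u)"
  define f' :: "real \<Rightarrow> real" where "f' = (\<lambda>u. (real k * ln u ^ (k - 1) - ln u ^ k) / u\<^sup>2)"
  have df: "(f has_real_derivative f' u) (at u)" if "u \<ge> a" for u
    unfolding f_def f'_def using that a
    by (auto intro!: derivative_eq_intros simp: field_simps power2_eq_square)
  have dF: "((\<lambda>u. ln u ^ Suc k / (real k + 1)) has_real_derivative f u) (at u)" if "u \<ge> a" for u
  proof -
    have "((\<lambda>u. ln u ^ Suc k) has_real_derivative real (Suc k) * ln u ^ k * (1 / u)) (at u)"
      using that a by (auto intro!: derivative_eq_intros simp del: power_Suc)
    moreover have "real (Suc k) = real k + 1" by simp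
    ultimately have "((\<lambda>u. ln u ^ Suc k) has_real_derivative (real k + 1) * ln u ^ k * (1 / u)) (at u)"
      by (simp only:)
    from DERIV_cdivide[OF this, of "real k + 1"] show ?thesis
      by (rule DERIV_cong) (simp add: f_def mult.assoc)
  qed
  obtain z where z: "a < z" "z < a + 1"
    "ln (a + 1) ^ Suc k / (real k + 1) - ln a ^ Suc k / (real k + 1) = (a + 1 - a) * f z"
    using MVT2[of a "a + 1" "\<lambda>u. ln u ^ Suc k / (real k + 1)" f] dF by auto
  obtain y where y: "a < y" "y < z" "f z - f a = (z - a) * f' y"
    using MVT2[of a z f f'] df z by auto
  have "stj_term k n = f a - f z"
    using z(3) by (simp add: stj_term_def f_def a_def diff_divide_distrib algebra_simps)
  also have "\<bar>\<dots>\<bar> = (z - a) * \<bar>f' y\<bar>"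
    using y(1,2) by (subst abs_minus_commute) (simp add: y(3) abs_mult)
  also have "\<dots> \<le> 1 * \<bar>f' y\<bar>" using z by (intro mult_right_mono) auto
  also have "\<bar>f' y\<bar> = \<bar>real k * ln y ^ (k - 1) - ln y ^ k\<bar> / y\<^sup>2" by (simp add: f'_def)
  also have "\<dots> \<le> (real k * ln (a + 1) ^ (k - 1) + ln (a + 1) ^ k) / a\<^sup>2"
  proof (intro frac_le power_mono)
    have ly: "0 \<le> ln y" "ln y \<le> ln (a + 1)" using a y z by auto
    then have "ln y ^ k \<le> ln (a + 1) ^ k" "real k * ln y ^ (k - 1) \<le> real k * ln (a + 1) ^ (k - 1)"
      by (auto intro!: power_mono mult_left_mono)
    moreover have "0 \<le> ln y ^ k" "0 \<le> real k * ln y ^ (k - 1)" using ly by auto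
    ultimately show "\<bar>real k * ln y ^ (k - 1) - ln y ^ k\<bar> \<le> real k * ln (a + 1) ^ (k - 1) + ln (a + 1) ^ k"
      by linarith
    show "0 \<le> real k * ln (a + 1) ^ (k - 1) + ln (a + 1) ^ k" using a by auto
  qed (use a y in auto)
  finally show ?thesis by (simp add: a_def add.commute)
qed

text \<open>One term of the exponential series of \<open>r * L\<close> is at most the whole sum.
  With \<open>L = ln n\<close> this trades a power of the logarithm for \<open>n\<close> to the
  small power \<open>r\<close>.\<close>

lemma power_le_fact_exp:
  assumes "(r::real) > 0" "L \<ge> 0"
  shows "L ^ k \<le> fact k / r ^ k * exp (r * L)"
proof -
  have "(r * L) ^ k / fact k \<le> exp (r * L)"
    using sum_le_suminf[OF summable_exp[of "r * L"], of "{k}"] assms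
    by (simp add: exp_def divide_inverse mult.commute del: power_mult_distrib)
  then show ?thesis using assms by (simp add: field_simps power_mult_distrib)
qed

lemma abs_stj_term_le_sqrt:
  "\<bar>stj_term k n\<bar> \<le> fact k * 2 ^ (k + 2) * (real n + 1) powr (- 3 / 2)"
proof -
  define L where "L = ln (real n + 2)"
  have L: "L \<ge> 0" by (simp add: L_def)
  have e: "exp (1 / 2 * L) \<le> 2 * (real n + 1) powr (1 / 2)"
  proof -
    have "exp (1 / 2 * L) = (real n + 2) powr (1 / 2)" by (simp add: L_def powr_def)
    also have "\<dots> \<le> (4 * (real n + 1)) powr (1 / 2)" by (intro powr_mono2) auto
    \<comment> \<open>The generous factor 4 is chosen for its square root.\<close>
    also have "\<dots> = 2 * (real n + 1) powr (1 / 2)" by (subst powr_mult) (auto simp: powr_half_sqrt)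
    finally show ?thesis .
  qed
  have 1: "L ^ k \<le> fact k * 2 ^ k * exp (1 / 2 * L)"
    using power_le_fact_exp[of "1 / 2" L k] L by (simp add: field_simps)
  have 2: "real k * L ^ (k - 1) \<le> fact k * 2 ^ k * exp (1 / 2 * L)"
  proof (cases k)
    case (Suc j)
    have "L ^ j \<le> fact j * 2 ^ j * exp (1 / 2 * L)"
      using power_le_fact_exp[of "1 / 2" L j] L by (simp add: field_simps)
    then have "real k * L ^ j \<le> real k * (fact j * 2 ^ j * exp (1 / 2 * L))"
      by (intro mult_left_mono) auto
    also have "\<dots> \<le> 2 * (real k * (fact j * 2 ^ j * exp (1 / 2 * L)))" by simp
    finally show ?thesis by (simp add: Suc)
  qed auto
  have "\<bar>stj_term k n\<bar> \<le> (real k * L ^ (k - 1) + L ^ k) / (real n + 1)\<^sup>2"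
    using abs_stj_term_le[of k n] by (simp add: L_def)
  also have "\<dots> \<le> (2 * (fact k * 2 ^ k * (2 * (real n + 1) powr (1 / 2)))) / (real n + 1)\<^sup>2"
  proof (intro divide_right_mono)
    have "fact k * 2 ^ k * exp (1 / 2 * L) \<le> fact k * 2 ^ k * (2 * (real n + 1) powr (1 / 2))"
      by (intro mult_left_mono e) auto
    then show "real k * L ^ (k - 1) + L ^ k \<le> 2 * (fact k * 2 ^ k * (2 * (real n + 1) powr (1 / 2)))"
      using 1 2 by linarith
  qed auto
  also have "\<dots> = fact k * 2 ^ (k + 2) * ((real n + 1) powr (1 / 2) / (real n + 1) powr 2)"
    by (simp add: powr_numeral)
  also have "(real n + 1) powr (1 / 2) / (real n + 1) powr 2 = (real n + 1) powr (- 3 / 2)"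
    by (subst powr_diff[symmetric]) auto
  finally show ?thesis .
qed

lemma summable_stj_term: "summable (stj_term k)"
proof (rule summable_comparison_test'[where N = 0])
  show "norm (stj_term k n) \<le> fact k * 2 ^ (k + 2) * (real (Suc n) powr (- 3 / 2))" for n
    using abs_stj_term_le_sqrt[of k n] by (simp add: add.commute)
  have "summable (\<lambda>n. real n powr (- 3 / 2))" by (subst summable_real_powr_iff) auto
  then show "summable (\<lambda>n. fact k * 2 ^ (k + 2) * (real (Suc n) powr (- 3 / 2)) :: real)"
    by (intro summable_mult) (subst summable_Suc_iff)
qed

lemma stj_sums: "stj_term k sums stj k"
  unfolding stj_def by (rule summable_sums[OF summable_stj_term])

lemma sum_stj_term:
  "(\<Sum>n<N. stj_term k n) = (\<Sum>n=1..N. ln (real n) ^ k / real n) - ln (real N + 1) ^ Suc k / (real k + 1)"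
proof (induction N)
  case (Suc N)
  then show ?case by (simp add: stj_term_def diff_divide_distrib add.commute add.left_commute)
qed auto

text \<open>The sequences \<open>g - f\<close> and \<open>g + f\<close> decrease from
  \<open>N\<close> on and tend to 0, so they are nonnegative there. No series has to be summed,
  since \<open>g\<close> acts as an antiderivative of the step sizes.\<close>

lemma telescope_tail_bound:
  fixes f g :: "nat \<Rightarrow> real"
  assumes "\<And>n. n \<ge> N \<Longrightarrow> \<bar>f (Suc n) - f n\<bar> \<le> g n - g (Suc n)" "f \<longlonglongrightarrow> 0" "g \<longlonglongrightarrow> 0" "n \<ge> N"
  shows "\<bar>f n\<bar> \<le> g n"
proof -
  have "g n - s * f n \<ge> 0" if s: "s = 1 \<or> s = -1" for s
  proof -
    have dec: "decseq (\<lambda>k. g (n + k) - s * f (n + k))"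
    proof (rule decseq_SucI)
      fix k show "g (n + Suc k) - s * f (n + Suc k) \<le> g (n + k) - s * f (n + k)"
        using assms(1)[of "n + k"] assms(4) s by auto
    qed
    have "(\<lambda>m. g m - s * f m) \<longlonglongrightarrow> 0 - s * 0" by (intro tendsto_intros assms)
    then have "(\<lambda>k. g (k + n) - s * f (k + n)) \<longlonglongrightarrow> 0"
      by (intro LIMSEQ_ignore_initial_segment) simp
    from decseq_ge[OF dec, of 0 0] this show ?thesis by (simp add: add.commute)
  qed
  from this[of 1] this[of "-1"] show ?thesis by auto
qed

text \<open>A rate is needed besides convergence, since \<open>k_LIMSEQ\<close> multiplies these
  errors by powers of the logarithm. It comes from comparing the terms with differences of
  \<open>2 / sqrt n\<close>.\<close>

lemma abs_sum_stj_term_minus_le: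
  assumes "N \<ge> 1"
  shows "\<bar>(\<Sum>n<N. stj_term k n) - stj k\<bar> \<le> fact k * 2 ^ (k + 2) * (2 / sqrt (real N))"
proof (rule telescope_tail_bound[where N = 1])
  fix n :: nat assume n: "n \<ge> 1"
  have "\<bar>(\<Sum>n<Suc n. stj_term k n) - stj k - ((\<Sum>n<n. stj_term k n) - stj k)\<bar> = \<bar>stj_term k n\<bar>" by simp
  also have "\<dots> \<le> fact k * 2 ^ (k + 2) * (real n + 1) powr (- 3 / 2)" by (rule abs_stj_term_le_sqrt)
  also have "(real n + 1) powr (- 3 / 2) \<le> 2 / sqrt (real n) - 2 / sqrt (real n + 1)"
  proof -
    define a b where "a = sqrt (real n)" and "b = sqrt (real n + 1)"
    have ab: "0 < a" "a \<le> b" "b\<^sup>2 - a\<^sup>2 = 1" using n by (auto simp: a_def b_def)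
    have "(real n + 1) powr (- 3 / 2) = 1 / b ^ 3"
    proof -
      have "(real n + 1) powr (- 3 / 2) = 1 / ((real n + 1) powr (1 / 2)) ^ 3"
        by (simp add: powr_power powr_minus field_simps)
      then show ?thesis by (simp add: b_def powr_half_sqrt)
    qed
    moreover have "2 / a - 2 / b = 2 / (a * b * (a + b))"
    proof -
      have "2 / a - 2 / b = 2 * (b - a) / (a * b)" using ab by (simp add: field_simps)
      also have "\<dots> = 2 * ((b - a) * (a + b)) / (a * b * (a + b))" using ab by simp
      also have "(b - a) * (a + b) = 1" using ab(3) by (simp add: power2_eq_square algebra_simps)
      finally show ?thesis by simp
    qed
    moreover have "a * b * (a + b) \<le> b * b * (b + b)" using ab by (intro mult_mono) auto
    then have "2 / (b * b * (b + b)) \<le> 2 / (a * b * (a + b))"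
      using ab by (intro divide_left_mono) auto
    moreover have "2 / (b * b * (b + b)) = 1 / b ^ 3"
      using ab by (simp add: field_simps power3_eq_cube)
    ultimately show ?thesis by (simp add: a_def b_def)
  qed
  finally show "\<bar>(\<Sum>n<Suc n. stj_term k n) - stj k - ((\<Sum>n<n. stj_term k n) - stj k)\<bar>
     \<le> fact k * 2 ^ (k + 2) * (2 / sqrt (real n)) - fact k * 2 ^ (k + 2) * (2 / sqrt (real (Suc n)))"
    by (simp add: right_diff_distrib add.commute mult_left_mono)
next
  show "(\<lambda>N. (\<Sum>n<N. stj_term k n) - stj k) \<longlonglongrightarrow> 0"
    using stj_sums[of k] by (simp add: sums_def LIM_zero)
  show "(\<lambda>N. fact k * 2 ^ (k + 2) * (2 / sqrt (real N))) \<longlonglongrightarrow> (0::real)"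
    by real_asymp
qed fact

lemma stj_0: "stj 0 = euler_mascheroni"
proof -
  have "(\<lambda>N. (\<Sum>n<N. stj_term 0 n)) \<longlonglongrightarrow> stj 0" using stj_sums[of 0] by (simp add: sums_def)
  moreover have "(\<Sum>n<N. stj_term 0 n) = harm N - ln (real N + 1)" for N
    by (simp add: sum_stj_term harm_def divide_inverse)
  moreover have "(\<lambda>N. harm N - ln (real N) + (ln (real N) - ln (real N + 1))) \<longlonglongrightarrow> euler_mascheroni + 0"
    by (intro tendsto_add euler_mascheroni_LIMSEQ) real_asymp
  ultimately show ?thesis by (auto intro: LIMSEQ_unique)
qed

section \<open>Riesz means of the harmonic series\<close>

definition L0 :: "real \<Rightarrow> real" where "L0 t = (\<Sum>n\<in>nle t. 1 / real n)"
definition K1 :: "real \<Rightarrow> real" where "K1 t = (\<Sum>n\<in>nle t. ln (t / real n) / real n)"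
definition K2 :: "real \<Rightarrow> real" where "K2 t = (\<Sum>n\<in>nle t. ln (t / real n) ^ 2 / real n)"

definition psi :: "real \<Rightarrow> real" where "psi t = frac t - 1 / 2"

abbreviation g0 :: real where "g0 \<equiv> euler_mascheroni"

text \<open>
  The weights of \<open>K1\<close> and \<open>K2\<close> vanish at \<open>n = t\<close>, so these functions are continuous, and so is \<open>e0\<close>, where
  the jumps of \<open>d0\<close> are cancelled. Hence bounds for the derivatives between integers bound \<open>e0\<close>, \<open>k1\<close>, \<open>k2\<close>.
\<close>

definition d0 :: "real \<Rightarrow> real" where "d0 t = L0 t - (ln t + g0)"
definition e0 :: "real \<Rightarrow> real" where "e0 t = d0 t + psi t / t"
definition k1 :: "real \<Rightarrow> real" where "k1 t = K1 t - (ln t ^ 2 / 2 + g0 * ln t - stj 1)"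
definition k2 :: "real \<Rightarrow> real" where
  "k2 t = K2 t - (ln t ^ 3 / 3 + g0 * ln t ^ 2 - 2 * stj 1 * ln t + stj 2)"

lemma abs_psi_le: "\<bar>psi t\<bar> \<le> 1 / 2"
  using frac_ge_0[of t] frac_lt_1[of t] unfolding psi_def by linarith

lemma psi_of_nat [simp]: "psi (real n) = - 1 / 2"
  by (simp add: psi_def frac_def)

lemma abs_divide_right_mono:
  fixes a c d :: real
  assumes "\<bar>a\<bar> \<le> c" "d > 0"
  shows "\<bar>a / d\<bar> \<le> c / d"
  using divide_right_mono[OF assms(1), of d] assms(2) by (simp add: abs_divide)

lemma abs_le_add_bounds:
  fixes a b A B :: real
  assumes "\<bar>a + b\<bar> \<le> A" "\<bar>b\<bar> \<le> B"
  shows "\<bar>a\<bar> \<le> A + B"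
  using assms by linarith

text \<open>\<open>C / (2 * t\<^sup>2)\<close> has derivative \<open>- C / t ^ 3\<close>, so adding
  or subtracting \<open>f\<close> gives a function that does not increase between integers. The
  formula \<open>F N\<close> is required at both ends of its interval, so the pieces join without
  jumps, and the limit 0 along the integers makes the function nonnegative.\<close>

lemma decay_from_derivative:
  fixes f :: "real \<Rightarrow> real" and F F' :: "nat \<Rightarrow> real \<Rightarrow> real"
  assumes lim: "(\<lambda>N. f (real N)) \<longlonglongrightarrow> 0"
    and eq: "\<And>N t. N \<ge> 1 \<Longrightarrow> real N \<le> t \<Longrightarrow> t \<le> real N + 1 \<Longrightarrow> f t = F N t"
    and der: "\<And>N t. N \<ge> 1 \<Longrightarrow> real N \<le> t \<Longrightarrow> t \<le> real N + 1 \<Longrightarrow> (F N has_real_derivative F' N t) (at t)"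
    and bd: "\<And>N t. N \<ge> 1 \<Longrightarrow> real N \<le> t \<Longrightarrow> t \<le> real N + 1 \<Longrightarrow> \<bar>F' N t\<bar> \<le> C / t ^ 3"
    and t: "t \<ge> 1"
  shows "\<bar>f t\<bar> \<le> C / (2 * t\<^sup>2)"
proof -
  have "0 \<le> C / (2 * t\<^sup>2) - s * f t" if s: "s = 1 \<or> s = -1" for s
  proof -
    define G where "G = (\<lambda>t. C / (2 * t\<^sup>2) - s * f t)"
    have mono: "G b \<le> G a" if N: "N \<ge> 1" "real N \<le> a" "a \<le> b" "b \<le> real N + 1" for a b N
    proof -
      have "C / (2 * b\<^sup>2) - s * F N b \<le> C / (2 * a\<^sup>2) - s * F N a"
      proof (rule DERIV_nonpos_imp_nonincreasing[OF N(3)])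
        fix x assume x: "a \<le> x" "x \<le> b"
        have "((\<lambda>t. C / (2 * t\<^sup>2) - s * F N t) has_real_derivative - (C / x ^ 3) - s * F' N x) (at x)"
          using x N by (auto intro!: derivative_eq_intros der simp: field_simps eval_nat_numeral)
        moreover have "- (C / x ^ 3) - s * F' N x \<le> 0"
          using bd[of N x] x N s by (auto simp: abs_le_iff)
        ultimately show "\<exists>y. ((\<lambda>t. C / (2 * t\<^sup>2) - s * F N t) has_real_derivative y) (at x) \<and> y \<le> 0"
          by blast
      qed
      then show ?thesis using eq[of N a] eq[of N b] N by (simp add: G_def)
    qed
    define N where "N = nat \<lfloor>t\<rfloor>"
    have N: "N \<ge> 1" "real N \<le> t" "t \<le> real N + 1"
      using t by (auto simp: N_def le_nat_iff)
    have dec: "decseq (\<lambda>k. G (real (Suc N + k)))"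
    proof (rule decseq_SucI)
      fix k show "G (real (Suc N + Suc k)) \<le> G (real (Suc N + k))"
        by (rule mono[of "Suc N + k"]) auto
    qed
    have "(\<lambda>M. C / (2 * (real M)\<^sup>2) - s * f (real M)) \<longlonglongrightarrow> 0 - s * 0"
      by (intro tendsto_intros lim) real_asymp
    then have "(\<lambda>M. G (real M)) \<longlonglongrightarrow> 0" by (simp add: G_def)
    then have "(\<lambda>k. G (real (k + Suc N))) \<longlonglongrightarrow> 0" by (rule LIMSEQ_ignore_initial_segment)
    with decseq_ge[OF dec, of 0 0] have "0 \<le> G (real (Suc N))" by (simp add: add.commute)
    also have "\<dots> \<le> G t" using N by (intro mono[of N]) auto
    finally show ?thesis by (simp add: G_def)
  qed
  from this[of 1] this[of "-1"] show ?thesis by auto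
qed

lemma nle_between:
  assumes "real N \<le> t" "t < real N + 1"
  shows "nle t = {1..N}" "frac t = t - real N"
proof -
  have "\<lfloor>t\<rfloor> = int N" using assms by (simp add: floor_eq_iff)
  then show "nle t = {1..N}" "frac t = t - real N" by (auto simp: nle_eq frac_def)
qed

text \<open>At \<open>t = N + 1\<close> the sum \<open>L0\<close> gains \<open>1 / t\<close> while
  \<open>psi\<close> drops from \<open>1 / 2\<close> to \<open>- 1 / 2\<close>. The jumps cancel, so
  the formula of the half-open interval extends to its right end.\<close>

lemma e0_between:
  assumes "N \<ge> 1" "real N \<le> t" "t \<le> real N + 1"
  shows "e0 t = (\<Sum>n=1..N. 1 / real n) - ln t - g0 + (t - real N - 1 / 2) / t"
proof (cases "t = real N + 1")
  case True
  then have t: "t = real (Suc N)" by simp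
  have "L0 t = (\<Sum>n=1..N. 1 / real n) + 1 / t" "psi t = - 1 / 2"
    unfolding t L0_def nle_of_nat psi_of_nat by auto
  moreover have "t - real N - 1 / 2 = 1 / 2" using True by simp
  moreover have "(- 1 / 2) / t + 1 / t = 1 / 2 / t" using True by (simp add: field_simps)
  ultimately show ?thesis unfolding e0_def d0_def by (simp only:)
next
  case False
  then show ?thesis using nle_between[of N t] assms
    by (simp add: e0_def d0_def psi_def L0_def)
qed

text \<open>The two one-sided values of \<open>psi\<close> at an integer differ only in
  sign.\<close>

lemma psi_square_between:
  assumes "real N \<le> t" "t \<le> real N + 1"
  shows "(psi t)\<^sup>2 = (t - real N - 1 / 2)\<^sup>2"
proof (cases "t = real N + 1")
  case True
  then have "psi t = - 1 / 2" using psi_of_nat[of "Suc N"] by (simp add: add.commute)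
  then show ?thesis by (simp add: True power2_eq_square)
next
  case False
  then show ?thesis using nle_between[of N t] assms by (simp add: psi_def)
qed

lemma e0_LIMSEQ: "(\<lambda>N. e0 (real N)) \<longlonglongrightarrow> 0"
proof -
  have "(\<lambda>N. (harm N - ln (real N)) - g0 - 1 / (2 * real N)) \<longlonglongrightarrow> g0 - g0 - 0"
    by (intro tendsto_diff euler_mascheroni_LIMSEQ tendsto_const) real_asymp
  moreover have "e0 (real N) = (harm N - ln (real N)) - g0 - 1 / (2 * real N)" for N
  proof -
    have "L0 (real N) = harm N" by (simp add: L0_def nle_of_nat harm_def divide_inverse)
    then show ?thesis by (simp add: e0_def d0_def)
  qed
  ultimately show ?thesis by simp
qed

text \<open>Between integers \<open>e0\<close> has derivative \<open>- psi t / t\<^sup>2\<close>.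
  The second periodic Bernoulli function \<open>(psi t)\<^sup>2 - 1 / 12\<close> has derivative
  \<open>2 * psi t\<close> and lies between \<open>- 1 / 12\<close> and \<open>1 / 6\<close>; adding
  it over \<open>2 * t\<^sup>2\<close> cancels the derivative of \<open>e0\<close> and leaves one of
  size at most \<open>1 / 6 / t ^ 3\<close>. The refined first bound is what yields the constant
  \<open>1 / 3\<close> in \<open>abs_Dl_le\<close>.\<close>

lemma abs_e0_le:
  assumes "t \<ge> 1"
  shows "\<bar>e0 t + ((psi t)\<^sup>2 - 1 / 12) / (2 * t\<^sup>2)\<bar> \<le> 1 / 12 / t\<^sup>2" "\<bar>e0 t\<bar> \<le> 1 / 6 / t\<^sup>2"
proof -
  have "\<bar>e0 t + ((psi t)\<^sup>2 - 1 / 12) / (2 * t\<^sup>2)\<bar> \<le> 1 / 6 / (2 * t\<^sup>2)"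
  proof (rule decay_from_derivative[where
      F = "\<lambda>N t. (\<Sum>n=1..N. 1 / real n) - ln t - g0 + (t - real N - 1 / 2) / t
             + ((t - real N - 1 / 2)\<^sup>2 - 1 / 12) / (2 * t\<^sup>2)"
      and F' = "\<lambda>N t. (1 / 12 - (t - real N - 1 / 2)\<^sup>2) / t ^ 3"])
    have "(\<lambda>N. e0 (real N) + ((1 / 2)\<^sup>2 - 1 / 12) / (2 * (real N)\<^sup>2)) \<longlonglongrightarrow> 0 + 0"
      by (intro tendsto_add e0_LIMSEQ) real_asymp
    then show "(\<lambda>N. e0 (real N) + ((psi (real N))\<^sup>2 - 1 / 12) / (2 * (real N)\<^sup>2)) \<longlonglongrightarrow> 0"
      by (simp add: power2_eq_square)
  next
    fix N t assume N: "(N::nat) \<ge> 1" "real N \<le> t" "t \<le> real N + 1"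
    show "e0 t + ((psi t)\<^sup>2 - 1 / 12) / (2 * t\<^sup>2) = (\<Sum>n=1..N. 1 / real n) - ln t - g0 + (t - real N - 1 / 2) / t
             + ((t - real N - 1 / 2)\<^sup>2 - 1 / 12) / (2 * t\<^sup>2)"
      using e0_between[OF N] psi_square_between[OF N(2,3)] by simp
    have t: "t > 0" using N by linarith
    show "((\<lambda>t. (\<Sum>n=1..N. 1 / real n) - ln t - g0 + (t - real N - 1 / 2) / t
             + ((t - real N - 1 / 2)\<^sup>2 - 1 / 12) / (2 * t\<^sup>2)) has_real_derivative
          (1 / 12 - (t - real N - 1 / 2)\<^sup>2) / t ^ 3) (at t)"
      using t by (auto intro!: derivative_eq_intros) (simp add: field_simps eval_nat_numeral)
    have "\<bar>t - real N - 1 / 2\<bar> \<le> 1 / 2" using N by linarith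
    then have "\<bar>t - real N - 1 / 2\<bar>\<^sup>2 \<le> (1 / 2)\<^sup>2" by (intro power_mono) auto
    then have "(t - real N - 1 / 2)\<^sup>2 \<le> 1 / 4" unfolding power2_abs by (simp add: power_divide)
    then have "\<bar>1 / 12 - (t - real N - 1 / 2)\<^sup>2\<bar> \<le> 1 / 6"
      using zero_le_power2[of "t - real N - 1 / 2"] by linarith
    then show "\<bar>(1 / 12 - (t - real N - 1 / 2)\<^sup>2) / t ^ 3\<bar> \<le> 1 / 6 / t ^ 3"
      using t by (intro abs_divide_right_mono) auto
  qed fact
  then show 1: "\<bar>e0 t + ((psi t)\<^sup>2 - 1 / 12) / (2 * t\<^sup>2)\<bar> \<le> 1 / 12 / t\<^sup>2" by simp
  have "\<bar>psi t\<bar>\<^sup>2 \<le> (1 / 2)\<^sup>2" using abs_psi_le[of t] by (intro power_mono) auto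
  then have "(psi t)\<^sup>2 \<le> 1 / 4" unfolding power2_abs by (simp add: power_divide)
  then have "\<bar>(psi t)\<^sup>2 - 1 / 12\<bar> \<le> 1 / 6"
    using zero_le_power2[of "psi t"] by linarith
  then have "\<bar>((psi t)\<^sup>2 - 1 / 12) / (2 * t\<^sup>2)\<bar> \<le> 1 / 6 / (2 * t\<^sup>2)"
    using assms by (intro abs_divide_right_mono) auto
  with 1 have "\<bar>e0 t\<bar> \<le> 1 / 12 / t\<^sup>2 + 1 / 6 / (2 * t\<^sup>2)" by (rule abs_le_add_bounds)
  then show "\<bar>e0 t\<bar> \<le> 1 / 6 / t\<^sup>2" by simp
qed

lemma abs_d0_le:
  assumes "t \<ge> 1"
  shows "\<bar>d0 t\<bar> \<le> 2 / 3 / t"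
proof -
  have "\<bar>psi t / t\<bar> \<le> 1 / 2 / t" using abs_psi_le[of t] assms by (intro abs_divide_right_mono) auto
  then have "\<bar>d0 t\<bar> \<le> 1 / 6 / t\<^sup>2 + 1 / 2 / t"
    using abs_e0_le(2)[OF assms] unfolding e0_def by (intro abs_le_add_bounds)
  moreover have "1 / 6 / t\<^sup>2 \<le> 1 / 6 / t" using assms by (simp add: field_simps power2_eq_square)
  moreover have "1 / 6 / t + 1 / 2 / t = 2 / 3 / t" by simp
  ultimately show ?thesis by linarith
qed

lemma K1_between:
  assumes "N \<ge> 1" "real N \<le> t" "t \<le> real N + 1"
  shows "K1 t = ln t * (\<Sum>n=1..N. 1 / real n) - (\<Sum>n=1..N. ln (real n) / real n)"
    "K2 t = ln t ^ 2 * (\<Sum>n=1..N. 1 / real n) - 2 * ln t * (\<Sum>n=1..N. ln (real n) / real n)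
       + (\<Sum>n=1..N. ln (real n) ^ 2 / real n)"
proof -
  have eq: "(\<Sum>n\<in>nle t. F n) = (\<Sum>n=1..N. F n)" if "t = real N + 1 \<longrightarrow> F (Suc N) = 0" for F :: "nat \<Rightarrow> real"
  proof (cases "t = real N + 1")
    case True
    then have "nle t = {1..Suc N}" using nle_of_nat[of "Suc N"] by (simp add: add.commute)
    then show ?thesis using that True by simp
  next
    case False
    then show ?thesis using nle_between[of N t] assms by simp
  qed
  have t: "t > 0" using assms by linarith
  have "K1 t = (\<Sum>n=1..N. ln (t / real n) / real n)"
    unfolding K1_def by (rule eq) (auto simp: add.commute)
  also have "\<dots> = (\<Sum>n=1..N. ln t * (1 / real n) - ln (real n) / real n)"
    using t by (intro sum.cong refl) (auto simp: ln_div diff_divide_distrib)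
  finally show "K1 t = ln t * (\<Sum>n=1..N. 1 / real n) - (\<Sum>n=1..N. ln (real n) / real n)"
    by (simp add: sum_subtractf sum_distrib_left)
  have "K2 t = (\<Sum>n=1..N. ln (t / real n) ^ 2 / real n)"
    unfolding K2_def by (rule eq) (auto simp: add.commute)
  also have "\<dots> = (\<Sum>n=1..N. ln t ^ 2 * (1 / real n) - 2 * ln t * (ln (real n) / real n) + ln (real n) ^ 2 / real n)"
    using t by (intro sum.cong refl) (auto simp: ln_div power2_eq_square field_simps)
  finally show "K2 t = ln t ^ 2 * (\<Sum>n=1..N. 1 / real n) - 2 * ln t * (\<Sum>n=1..N. ln (real n) / real n)
       + (\<Sum>n=1..N. ln (real n) ^ 2 / real n)"
    by (simp only: sum_subtractf sum.distrib sum_distrib_left)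
qed

lemma LIMSEQ_stj_error:
  "(\<lambda>N. ln (real N + 1) ^ j * ((\<Sum>n<N. stj_term k n) - stj k)) \<longlonglongrightarrow> 0"
proof (rule Lim_null_comparison)
  show "\<forall>\<^sub>F N in sequentially. norm (ln (real N + 1) ^ j * ((\<Sum>n<N. stj_term k n) - stj k))
      \<le> ln (real N + 1) ^ j * (fact k * 2 ^ (k + 2) * (2 / sqrt (real N)))"
    using eventually_ge_at_top[of 1]
  proof eventually_elim
    case (elim N)
    have "norm (ln (real N + 1) ^ j * ((\<Sum>n<N. stj_term k n) - stj k))
        = ln (real N + 1) ^ j * \<bar>(\<Sum>n<N. stj_term k n) - stj k\<bar>"
      by (simp add: abs_mult)
    also have "\<dots> \<le> ln (real N + 1) ^ j * (fact k * 2 ^ (k + 2) * (2 / sqrt (real N)))"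
      by (intro mult_left_mono abs_sum_stj_term_minus_le elim) auto
    finally show ?case .
  qed
  define C :: real where "C = fact k * 2 ^ (k + 2)"
  have "(\<lambda>N. ln (real N + 1) ^ j * (C * (2 / sqrt (real N)))) \<longlonglongrightarrow> 0" by real_asymp
  then show "(\<lambda>N. ln (real N + 1) ^ j * (fact k * 2 ^ (k + 2) * (2 / sqrt (real N)))) \<longlonglongrightarrow> 0"
    by (simp add: C_def)
qed

text \<open>The formulas for the interval from \<open>N\<close> to \<open>N + 1\<close> are used at
  its right end because \<open>sum_stj_term\<close> contains \<open>ln (N + 1)\<close>. There all
  polynomial terms cancel, and only powers of \<open>T N\<close> times the errors
  \<open>r k N\<close> remain.\<close>

lemma k_LIMSEQ: "(\<lambda>N. k1 (real N)) \<longlonglongrightarrow> 0" "(\<lambda>N. k2 (real N)) \<longlonglongrightarrow> 0"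
proof -
  define r where "r = (\<lambda>k N. (\<Sum>n<N. stj_term k n) - stj k)"
  define T where "T = (\<lambda>N. ln (real N + 1))"
  have S: "(\<Sum>n=1..N. ln (real n) ^ k / real n) = T N ^ Suc k / (real k + 1) + stj k + r k N" for k N
    by (simp add: r_def sum_stj_term T_def)
  have S0: "(\<Sum>n=1..N. 1 / real n) = T N + g0 + r 0 N" for N using S[of 0 N] by (simp add: stj_0)
  have S1: "(\<Sum>n=1..N. ln (real n) / real n) = T N ^ 2 / 2 + stj 1 + r 1 N" for N
    using S[of 1 N] by (simp add: eval_nat_numeral)
  have S2: "(\<Sum>n=1..N. ln (real n) ^ 2 / real n) = T N ^ 3 / 3 + stj 2 + r 2 N" for N
    using S[of 2 N] by (simp add: eval_nat_numeral)
  have lim: "(\<lambda>N. T N ^ j * r k N) \<longlonglongrightarrow> 0" for j k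
    using LIMSEQ_stj_error by (simp add: T_def r_def)
  have e1: "\<forall>\<^sub>F N in sequentially. T N ^ 1 * r 0 N - T N ^ 0 * r 1 N = k1 (real (Suc N))"
    using eventually_ge_at_top[of 1]
  proof eventually_elim
    case (elim N)
    have T: "ln (real (Suc N)) = T N" by (simp add: T_def add.commute)
    have "K1 (real (Suc N)) = T N * (T N + g0 + r 0 N) - (T N ^ 2 / 2 + stj 1 + r 1 N)"
      using K1_between(1)[of N "real (Suc N)"] elim unfolding S0 S1 T by simp
    then show ?case unfolding k1_def T by (simp add: algebra_simps power2_eq_square)
  qed
  have e2: "\<forall>\<^sub>F N in sequentially. T N ^ 2 * r 0 N - 2 * (T N ^ 1 * r 1 N) + T N ^ 0 * r 2 N = k2 (real (Suc N))"
    using eventually_ge_at_top[of 1]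
  proof eventually_elim
    case (elim N)
    have T: "ln (real (Suc N)) = T N" by (simp add: T_def add.commute)
    have "K2 (real (Suc N)) = T N ^ 2 * (T N + g0 + r 0 N) - 2 * T N * (T N ^ 2 / 2 + stj 1 + r 1 N)
        + (T N ^ 3 / 3 + stj 2 + r 2 N)"
      using K1_between(2)[of N "real (Suc N)"] elim unfolding S0 S1 S2 T by simp
    then show ?case unfolding k2_def T by (simp add: algebra_simps power2_eq_square power3_eq_cube)
  qed
  have "(\<lambda>N. T N ^ 1 * r 0 N - T N ^ 0 * r 1 N) \<longlonglongrightarrow> 0 - 0" by (intro tendsto_diff lim)
  then have "(\<lambda>N. k1 (real (Suc N))) \<longlonglongrightarrow> 0" using Lim_transform_eventually[OF _ e1] by simp
  then show "(\<lambda>N. k1 (real N)) \<longlonglongrightarrow> 0" by (rule LIMSEQ_imp_Suc)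
  have "(\<lambda>N. T N ^ 2 * r 0 N - 2 * (T N ^ 1 * r 1 N) + T N ^ 0 * r 2 N) \<longlonglongrightarrow> 0 - 2 * 0 + 0"
    by (intro tendsto_diff tendsto_add tendsto_mult lim tendsto_const)
  then have "(\<lambda>N. k2 (real (Suc N))) \<longlonglongrightarrow> 0" using Lim_transform_eventually[OF _ e2] by simp
  then show "(\<lambda>N. k2 (real N)) \<longlonglongrightarrow> 0" by (rule LIMSEQ_imp_Suc)
qed

text \<open>The derivative \<open>d0 t / t\<close> of \<open>k1\<close> is only
  \<open>O(1 / t\<^sup>2)\<close>, which would give a bound \<open>O(1 / t)\<close>. Subtracting
  \<open>e0\<close>, with derivative \<open>- psi t / t\<^sup>2\<close>, turns it into
  \<open>e0 t / t\<close> and gains one power; the constant is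
  \<open>1 / 12 + 1 / 6\<close>.\<close>

lemma abs_k1_le:
  assumes "t \<ge> 1"
  shows "\<bar>k1 t\<bar> \<le> 1 / 4 / t\<^sup>2"
proof -
  have "\<bar>k1 t - e0 t\<bar> \<le> 1 / 6 / (2 * t\<^sup>2)"
  proof (rule decay_from_derivative[where
      F = "\<lambda>N t. ln t * (\<Sum>n=1..N. 1 / real n) - (\<Sum>n=1..N. ln (real n) / real n)
             - (ln t ^ 2 / 2 + g0 * ln t - stj 1)
             - ((\<Sum>n=1..N. 1 / real n) - ln t - g0 + (t - real N - 1 / 2) / t)"
      and F' = "\<lambda>N t. ((\<Sum>n=1..N. 1 / real n) - ln t - g0 + (t - real N - 1 / 2) / t) / t"])
    have "(\<lambda>N. k1 (real N) - e0 (real N)) \<longlonglongrightarrow> 0 - 0"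
      by (intro tendsto_diff e0_LIMSEQ k_LIMSEQ)
    then show "(\<lambda>N. k1 (real N) - e0 (real N)) \<longlonglongrightarrow> 0" by simp
  next
    fix N t assume N: "(N::nat) \<ge> 1" "real N \<le> t" "t \<le> real N + 1"
    show "k1 t - e0 t = ln t * (\<Sum>n=1..N. 1 / real n) - (\<Sum>n=1..N. ln (real n) / real n)
             - (ln t ^ 2 / 2 + g0 * ln t - stj 1)
             - ((\<Sum>n=1..N. 1 / real n) - ln t - g0 + (t - real N - 1 / 2) / t)"
      unfolding k1_def K1_between(1)[OF N] e0_between[OF N] ..
    have t: "t > 0" "t \<ge> 1" using N by linarith+
    show "((\<lambda>t. ln t * (\<Sum>n=1..N. 1 / real n) - (\<Sum>n=1..N. ln (real n) / real n)
             - (ln t ^ 2 / 2 + g0 * ln t - stj 1)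
             - ((\<Sum>n=1..N. 1 / real n) - ln t - g0 + (t - real N - 1 / 2) / t)) has_real_derivative
          ((\<Sum>n=1..N. 1 / real n) - ln t - g0 + (t - real N - 1 / 2) / t) / t) (at t)"
      using t by (auto intro!: derivative_eq_intros) (simp add: field_simps power2_eq_square)
    show "\<bar>((\<Sum>n=1..N. 1 / real n) - ln t - g0 + (t - real N - 1 / 2) / t) / t\<bar> \<le> 1 / 6 / t ^ 3"
      using abs_e0_le(2)[OF t(2)] t unfolding e0_between[OF N]
      by (simp add: field_simps eval_nat_numeral)
  qed fact
  then show ?thesis using abs_e0_le(2)[OF assms] by (simp add: field_simps)
qed

lemma abs_k2_le:
  assumes "t \<ge> 1"
  shows "\<bar>k2 t\<bar> \<le> 1 / 4 / t\<^sup>2"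
proof -
  have "\<bar>k2 t\<bar> \<le> 1 / 2 / (2 * t\<^sup>2)"
  proof (rule decay_from_derivative[where
      F = "\<lambda>N t. ln t ^ 2 * (\<Sum>n=1..N. 1 / real n) - 2 * ln t * (\<Sum>n=1..N. ln (real n) / real n)
             + (\<Sum>n=1..N. ln (real n) ^ 2 / real n)
             - (ln t ^ 3 / 3 + g0 * ln t ^ 2 - 2 * stj 1 * ln t + stj 2)"
      and F' = "\<lambda>N t. 2 * k1 t / t"])
    fix N t assume N: "(N::nat) \<ge> 1" "real N \<le> t" "t \<le> real N + 1"
    show "k2 t = ln t ^ 2 * (\<Sum>n=1..N. 1 / real n) - 2 * ln t * (\<Sum>n=1..N. ln (real n) / real n)
             + (\<Sum>n=1..N. ln (real n) ^ 2 / real n)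
             - (ln t ^ 3 / 3 + g0 * ln t ^ 2 - 2 * stj 1 * ln t + stj 2)"
      unfolding k2_def K1_between(2)[OF N] ..
    have t: "t > 0" "t \<ge> 1" using N by linarith+
    show "((\<lambda>t. ln t ^ 2 * (\<Sum>n=1..N. 1 / real n) - 2 * ln t * (\<Sum>n=1..N. ln (real n) / real n)
             + (\<Sum>n=1..N. ln (real n) ^ 2 / real n)
             - (ln t ^ 3 / 3 + g0 * ln t ^ 2 - 2 * stj 1 * ln t + stj 2)) has_real_derivative
          2 * k1 t / t) (at t)"
      using t unfolding k1_def K1_between(1)[OF N]
      by (auto intro!: derivative_eq_intros) (simp add: field_simps power2_eq_square)
    show "\<bar>2 * k1 t / t\<bar> \<le> 1 / 2 / t ^ 3"
      using abs_k1_le[OF t(2)] t by (simp add: field_simps eval_nat_numeral abs_mult)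
  qed (use k_LIMSEQ assms in auto)
  then show ?thesis by simp
qed

section \<open>Divisor sums up to the square root of the cutoff\<close>

lemma divisor_sum_lattice:
  fixes F :: "nat \<Rightarrow> real"
  shows "(\<Sum>n\<in>nle x. real (divisor_count n) * F n) = (\<Sum>a\<in>nle x. \<Sum>b\<in>nle (x / real a). F (a * b))"
proof -
  have "(\<Sum>n\<in>nle x. real (divisor_count n) * F n) = (\<Sum>n\<in>nle x. \<Sum>a | a dvd n. F (a * (n div a)))"
    by (intro sum.cong refl) (simp add: divisor_count_def)
  then show ?thesis by (simp only: sum_divisors_lattice[of "\<lambda>a b. F (a * b)" x])
qed

lemma card_nle: "t \<ge> 0 \<Longrightarrow> real (card (nle t)) = t - 1 / 2 - psi t"
  by (simp add: nle_eq psi_def frac_def)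

definition D :: "real \<Rightarrow> real" where "D x = (\<Sum>n\<in>nle x. real (divisor_count n))"
text \<open>The error term of the Dirichlet divisor problem, usually written Delta.\<close>

definition Dl :: "real \<Rightarrow> real" where "Dl x = D x - x * (ln x + 2 * g0 - 1)"
text \<open>\<open>A\<close> and \<open>K\<close> arise from the main term of
  \<open>D (x / n)\<close> weighted by \<open>d(n)\<close>, once \<open>ln (x / n)\<close> is
  written as \<open>ln z + ln (z / n)\<close> with \<open>z = sqrt x\<close>.\<close>

definition A :: "real \<Rightarrow> real" where "A x = (\<Sum>n\<in>nle x. real (divisor_count n) / real n)"
definition K :: "real \<Rightarrow> real" where "K x = (\<Sum>n\<in>nle x. real (divisor_count n) / real n * ln (x / real n))"

context
  fixes z s \<sigma> \<Psi> :: real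
  assumes z: "z \<ge> 1"
  defines "s \<equiv> sqrt z" and "\<sigma> \<equiv> ln (sqrt z)" and "\<Psi> \<equiv> (\<Sum>a\<in>nle (sqrt z). psi (z / real a))"
begin

private lemma s: "s \<ge> 1" "s * s = z" "s > 0" "s\<^sup>2 = z" "ln z = 2 * \<sigma>" "\<sigma> \<ge> 0"
proof -
  show s1: "s \<ge> 1" using z by (simp add: s_def)
  show ss: "s * s = z" "s\<^sup>2 = z" using z by (simp_all add: s_def power2_eq_square)
  show "s > 0" "\<sigma> \<ge> 0" using s1 by (auto simp: \<sigma>_def s_def)
  have "ln z = ln (s * s)" using ss by simp
  also have "\<dots> = ln s + ln s" using s1 by (subst ln_mult) auto
  finally show "ln z = 2 * \<sigma>" by (simp add: \<sigma>_def s_def)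
qed

private lemma a: "a \<in> nle s \<Longrightarrow> real a > 0 \<and> z / real a \<ge> 1 \<and> ln (z / real a) = \<sigma> + ln (s / real a)"
proof -
  assume "a \<in> nle s"
  then have a: "real a \<ge> 1" "real a \<le> s" by (auto simp: mem_nle)
  have "s * 1 \<le> s * s" using s by (intro mult_left_mono) auto
  then have "real a \<le> z" using a s by linarith
  moreover have "ln (z / real a) = ln z - ln (real a)" "ln (s / real a) = ln s - ln (real a)"
    using a z s by (auto simp: ln_div)
  ultimately show ?thesis using a s by (simp add: \<sigma>_def s_def)
qed

private lemma sum_over_a_le: "(\<Sum>a\<in>nle s. real a) \<le> z"
proof -
  have "(\<Sum>a\<in>nle s. real a) \<le> (\<Sum>a\<in>nle s. s)" by (intro sum_mono) (auto simp: mem_nle)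
  also have "\<dots> = real (card (nle s)) * s" by simp
  also have "\<dots> \<le> s * s"
    using s abs_psi_le[of s] by (intro mult_right_mono) (auto simp: card_nle)
  finally show ?thesis using s by simp
qed

text \<open>The term for \<open>a\<close> is at most \<open>c * a / z\<^sup>2\<close>, and the sum
  of all \<open>a \<le> sqrt z\<close> is at most \<open>z\<close>.\<close>

private lemma sum_decay_le:
  assumes "\<And>t. t \<ge> 1 \<Longrightarrow> \<bar>f t\<bar> \<le> c / t\<^sup>2" "c \<ge> 0"
  shows "\<bar>\<Sum>a\<in>nle s. f (z / real a) / real a\<bar> \<le> c / z"
proof -
  have "\<bar>\<Sum>a\<in>nle s. f (z / real a) / real a\<bar> \<le> (\<Sum>a\<in>nle s. \<bar>f (z / real a) / real a\<bar>)" by (rule sum_abs)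
  also have "\<dots> \<le> (\<Sum>a\<in>nle s. c / z\<^sup>2 * real a)"
  proof (rule sum_mono)
    fix b assume b: "b \<in> nle s"
    have "\<bar>f (z / real b) / real b\<bar> \<le> c / (z / real b)\<^sup>2 / real b"
      using assms(1)[of "z / real b"] a[OF b] by (intro abs_divide_right_mono) auto
    also have "\<dots> = c / z\<^sup>2 * real b" using a[OF b] z by (simp add: field_simps power2_eq_square)
    finally show "\<bar>f (z / real b) / real b\<bar> \<le> c / z\<^sup>2 * real b" .
  qed
  also have "\<dots> = c / z\<^sup>2 * (\<Sum>a\<in>nle s. real a)" by (simp add: sum_distrib_left)
  also have "\<dots> \<le> c / z\<^sup>2 * z" using assms(2) by (intro mult_left_mono sum_over_a_le) auto
  also have "\<dots> = c / z" using z by (simp add: power2_eq_square)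
  finally show ?thesis .
qed

private lemma L0_s: "L0 s = \<sigma> + g0 + d0 s"
  by (simp add: d0_def \<sigma>_def s_def)

text \<open>Kept as an identity because the sawtooth sum \<open>\<Psi>\<close> also occurs in
  \<open>A z\<close>, where it is to cancel. The terms \<open>s * psi s\<close> from the count of
  lattice points and from \<open>L0 s\<close> cancel already here.\<close>

lemma Dl_eq: "Dl z = - 2 * \<Psi> + (1 / 4 - (psi (sqrt z))\<^sup>2 + 2 * z * e0 (sqrt z))"
proof -
  have "D z = (\<Sum>a\<in>nle z. \<Sum>b\<in>nle (z / real a). 1)"
    using divisor_sum_lattice[of "\<lambda>_. 1" z] by (simp add: D_def)
  also have "\<dots> = 2 * (\<Sum>a\<in>nle s. \<Sum>b\<in>nle (z / real a). 1) - (\<Sum>a\<in>nle s. \<Sum>b\<in>nle s. 1)"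
    unfolding s_def by (rule hyperbola) (use z in auto)
  also have "\<dots> = 2 * (\<Sum>a\<in>nle s. z / real a - 1 / 2 - psi (z / real a)) - (real (card (nle s)))\<^sup>2"
    using z by (simp add: card_nle power2_eq_square)
  also have "(\<Sum>a\<in>nle s. z / real a - 1 / 2 - psi (z / real a)) = z * L0 s - real (card (nle s)) / 2 - \<Psi>"
    by (simp add: sum_subtractf L0_def \<Psi>_def s_def sum_distrib_left)
  finally have D: "D z = 2 * z * L0 s - 2 * \<Psi> - (real (card (nle s)) + (real (card (nle s)))\<^sup>2)"
    by (simp add: algebra_simps)
  have c: "real (card (nle s)) + (real (card (nle s)))\<^sup>2 = (s - psi s)\<^sup>2 - 1 / 4"
    using s by (simp add: card_nle power2_eq_square algebra_simps)
  have L: "z * L0 s = z * \<sigma> + z * g0 + z * e0 s - s * psi s"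
    using s by (simp add: L0_s e0_def field_simps)
  have "Dl z = 2 * (z * L0 s) - 2 * \<Psi> - ((s - psi s)\<^sup>2 - 1 / 4) - z * (2 * \<sigma> + 2 * g0 - 1)"
    unfolding Dl_def D c s(5) by simp
  also have "\<dots> = - 2 * \<Psi> + (1 / 4 - (psi s)\<^sup>2 + 2 * z * e0 s)"
    unfolding L using s(4) by (simp add: power2_eq_square algebra_simps)
  finally show ?thesis by (simp add: s_def)
qed

text \<open>Each sawtooth value is at most \<open>1 / 2\<close>, and there are
  \<open>s - 1 / 2 - psi s\<close> of them. With the refined bound for \<open>e0 s\<close> the rest
  is a quadratic in \<open>psi s\<close>: \<open>Dl z\<close> is at most \<open>s + 1 / 8\<close>
  and at least \<open>- s - 1 / 3\<close>, where the extreme case is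
  \<open>psi s = - 1 / 2\<close>.\<close>

lemma abs_Dl_le: "\<bar>Dl z\<bar> \<le> sqrt z + 1 / 3"
proof -
  have "\<bar>2 * \<Psi>\<bar> \<le> s - 1 / 2 - psi s"
  proof -
    have "\<bar>\<Psi>\<bar> \<le> (\<Sum>a\<in>nle s. \<bar>psi (z / real a)\<bar>)" unfolding \<Psi>_def s_def by (rule sum_abs)
    also have "\<dots> \<le> (\<Sum>a\<in>nle s. 1 / 2)" by (intro sum_mono abs_psi_le)
    finally show ?thesis using s by (simp add: card_nle)
  qed
  moreover have "\<bar>2 * z * e0 s + ((psi s)\<^sup>2 - 1 / 12)\<bar> \<le> 1 / 6"
  proof -
    have "\<bar>e0 s + ((psi s)\<^sup>2 - 1 / 12) / (2 * z)\<bar> * (2 * z) \<le> 1 / 12 / z * (2 * z)"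
      using abs_e0_le(1)[OF s(1)] z unfolding s(4) by (intro mult_right_mono) auto
    also have "1 / 12 / z * (2 * z) = 1 / 6" using z by simp
    also have "\<bar>e0 s + ((psi s)\<^sup>2 - 1 / 12) / (2 * z)\<bar> * (2 * z)
        = \<bar>(e0 s + ((psi s)\<^sup>2 - 1 / 12) / (2 * z)) * (2 * z)\<bar>" using z by (simp add: abs_mult)
    also have "(e0 s + ((psi s)\<^sup>2 - 1 / 12) / (2 * z)) * (2 * z) = 2 * z * e0 s + ((psi s)\<^sup>2 - 1 / 12)"
      using z by (simp add: field_simps)
    finally show ?thesis .
  qed
  moreover have "- psi s - 2 * (psi s)\<^sup>2 \<le> 1 / 8"
    using zero_le_power2[of "psi s + 1 / 4"] by (simp add: power2_eq_square algebra_simps)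
  moreover have "psi s - 2 * (psi s)\<^sup>2 \<ge> -1"
  proof -
    have "0 \<le> (1 - psi s) * (1 + 2 * psi s)" using abs_psi_le[of s] by (intro mult_nonneg_nonneg) linarith+
    then show ?thesis by (simp add: power2_eq_square algebra_simps)
  qed
  ultimately show ?thesis unfolding Dl_eq s_def[symmetric] by linarith
qed

text \<open>The only contribution of order \<open>1 / sqrt z\<close> is the sawtooth sum. It is the
  one of \<open>Dl_eq\<close>, so subtracting \<open>Dl z / z\<close> removes it and leaves
  \<open>O(1 / z)\<close>.\<close>

lemma abs_A_minus_le:
  "\<bar>A z - (ln z ^ 2 / 2 + 2 * g0 * ln z + g0\<^sup>2 - 2 * stj 1) - Dl z / z\<bar> \<le> 29 / 18 / z"
proof -
  define E where "E = (\<Sum>a\<in>nle s. e0 (z / real a) / real a)"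
  have "A z = (\<Sum>a\<in>nle z. \<Sum>b\<in>nle (z / real a). 1 / (real a * real b))"
    using divisor_sum_lattice[of "\<lambda>n. 1 / real n" z] by (simp add: A_def)
  also have "\<dots> = 2 * (\<Sum>a\<in>nle s. \<Sum>b\<in>nle (z / real a). 1 / (real a * real b))
      - (\<Sum>a\<in>nle s. \<Sum>b\<in>nle s. 1 / (real a * real b))"
    unfolding s_def by (rule hyperbola) (use z in \<open>auto simp: mult.commute\<close>)
  also have "(\<Sum>a\<in>nle s. \<Sum>b\<in>nle (z / real a). 1 / (real a * real b)) = (\<Sum>a\<in>nle s. L0 (z / real a) / real a)"
    by (simp add: L0_def sum_divide_distrib mult.commute)
  also have "(\<Sum>a\<in>nle s. \<Sum>b\<in>nle s. 1 / (real a * real b)) = (L0 s)\<^sup>2"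
    by (simp add: L0_def power2_eq_square sum_product)
  also have "(\<Sum>a\<in>nle s. L0 (z / real a) / real a)
      = (\<Sum>a\<in>nle s. (\<sigma> + g0) * (1 / real a) + ln (s / real a) / real a + (e0 (z / real a) / real a - psi (z / real a) / z))"
  proof (rule sum.cong[OF refl])
    fix b assume b: "b \<in> nle s"
    have L: "L0 (z / real b) = ln (z / real b) + g0 + (e0 (z / real b) - psi (z / real b) / (z / real b))"
      by (simp add: e0_def d0_def)
    show "L0 (z / real b) / real b = (\<sigma> + g0) * (1 / real b) + ln (s / real b) / real b
        + (e0 (z / real b) / real b - psi (z / real b) / z)"
      unfolding L using a[OF b] z by (simp add: field_simps)
  qed
  also have "\<dots> = (\<sigma> + g0) * L0 s + K1 s + (E - \<Psi> / z)"
    by (simp only: sum.distrib sum_subtractf sum_distrib_left[symmetric] sum_divide_distrib[symmetric]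
        L0_def K1_def E_def \<Psi>_def s_def)
  finally have A: "A z = 2 * ((\<sigma> + g0) * L0 s + K1 s + (E - \<Psi> / z)) - (L0 s)\<^sup>2" .
  have K1: "K1 s = k1 s + \<sigma>\<^sup>2 / 2 + g0 * \<sigma> - stj 1" by (simp add: k1_def \<sigma>_def s_def)
  have e: "\<bar>e0 s\<bar> \<le> 1 / 6 / z" using abs_e0_le(2)[OF s(1)] s(4) by simp
  have "\<bar>E\<bar> \<le> 1 / 6 / z" unfolding E_def by (rule sum_decay_le[OF abs_e0_le(2)]) auto
  moreover have "\<bar>k1 s\<bar> \<le> 1 / 4 / z" using abs_k1_le[OF s(1)] s(4) by simp
  \<comment> \<open>The terms \<open>(psi s)\<^sup>2 / z\<close> from the square of
    \<open>d0 s\<close> and from \<open>Dl_eq\<close> cancel. What stays is at most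
    \<open>1 / 4 + 1 / 6 + 1 / 36 + 1 / 3 = 7 / 9\<close> over \<open>z\<close>.\<close>
  moreover have "\<bar>(d0 s)\<^sup>2 + (1 / 4 - (psi s)\<^sup>2 + 2 * z * e0 s) / z\<bar> \<le> 7 / 9 / z"
  proof -
    have ze: "\<bar>z * e0 s\<bar> \<le> 1 / 6" using e z by (simp add: abs_mult field_simps)
    have zs: "\<bar>s * e0 s\<bar> \<le> 1 / 6"
    proof -
      have "s * \<bar>e0 s\<bar> \<le> (s * s) * \<bar>e0 s\<bar>" using s by (intro mult_right_mono) auto
      then show ?thesis using ze s z by (simp add: abs_mult)
    qed
    have "\<bar>psi s * (s * e0 s)\<bar> \<le> 1 / 2 * (1 / 6)"
      unfolding abs_mult[of "psi s"] using abs_psi_le[of s] zs by (intro mult_mono) auto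
    moreover have "\<bar>z * e0 s * e0 s\<bar> \<le> 1 / 6 * (1 / 6)"
    proof -
      have "1 / 6 / z \<le> 1 / 6" using z by (simp add: field_simps)
      then have "\<bar>e0 s\<bar> \<le> 1 / 6" using e by linarith
      then show ?thesis unfolding abs_mult[of "z * e0 s"] using ze by (intro mult_mono) auto
    qed
    moreover have "(d0 s)\<^sup>2 + (1 / 4 - (psi s)\<^sup>2 + 2 * z * e0 s) / z
       = (1 / 4 - 2 * (psi s * (s * e0 s)) + z * e0 s * e0 s + 2 * (z * e0 s)) / z"
    proof -
      have d: "d0 s = e0 s - psi s / s" by (simp add: e0_def)
      have "(d0 s)\<^sup>2 = (e0 s)\<^sup>2 - 2 * (psi s * (s * e0 s)) / z + (psi s)\<^sup>2 / z"
        using s(3) unfolding d s(2)[symmetric] by (simp add: power2_eq_square field_simps)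
      then show ?thesis using z by (simp add: field_simps power2_eq_square)
    qed
    ultimately show ?thesis using ze z by (simp only:) (intro abs_divide_right_mono, linarith+)
  qed
  moreover have "A z - (ln z ^ 2 / 2 + 2 * g0 * ln z + g0\<^sup>2 - 2 * stj 1) - Dl z / z
      = 2 * k1 s + 2 * E - ((d0 s)\<^sup>2 + (1 / 4 - (psi s)\<^sup>2 + 2 * z * e0 s) / z)"
    unfolding A K1 L0_s Dl_eq s(5) s_def[symmetric] add_divide_distrib
    by (simp add: power2_eq_square algebra_simps)
  moreover have "2 * (1 / 4 / z) + 2 * (1 / 6 / z) + 7 / 9 / z = 29 / 18 / z" by simp
  ultimately show ?thesis by linarith
qed

text \<open>The weight \<open>ln (z / n)\<close> vanishes at the cutoff, so no sawtooth sum appears: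
  the error \<open>d0 s\<close>, of size \<open>1 / s\<close>, survives only in its product with
  \<open>k1 s\<close>.\<close>

lemma abs_K_minus_le:
  "\<bar>K z - (ln z ^ 3 / 6 + g0 * ln z ^ 2 + (g0\<^sup>2 - 2 * stj 1) * ln z + stj 2 - 2 * g0 * stj 1)\<bar> \<le> 13 / 12 / z"
proof -
  define E where "E = (\<Sum>a\<in>nle s. k1 (z / real a) / real a)"
  have "K z = (\<Sum>n\<in>nle z. real (divisor_count n) * (1 / real n * ln (z / real n)))" by (simp add: K_def)
  also have "\<dots> = (\<Sum>a\<in>nle z. \<Sum>b\<in>nle (z / real a). 1 / (real a * real b) * ln (z / (real a * real b)))"
    by (subst divisor_sum_lattice) simp
  also have "\<dots> = 2 * (\<Sum>a\<in>nle s. \<Sum>b\<in>nle (z / real a). 1 / (real a * real b) * ln (z / (real a * real b)))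
      - (\<Sum>a\<in>nle s. \<Sum>b\<in>nle s. 1 / (real a * real b) * ln (z / (real a * real b)))"
    unfolding s_def by (rule hyperbola) (use z in \<open>auto simp: mult.commute\<close>)
  also have "(\<Sum>a\<in>nle s. \<Sum>b\<in>nle (z / real a). 1 / (real a * real b) * ln (z / (real a * real b)))
      = (\<Sum>a\<in>nle s. K1 (z / real a) / real a)"
    by (simp add: K1_def sum_divide_distrib mult.commute)
  also have "(\<Sum>a\<in>nle s. \<Sum>b\<in>nle s. 1 / (real a * real b) * ln (z / (real a * real b)))
      = (\<Sum>a\<in>nle s. \<Sum>b\<in>nle s. ln (s / real a) / real a * (1 / real b) + (1 / real a) * (ln (s / real b) / real b))"
  proof (intro sum.cong refl)
    fix b c assume b: "b \<in> nle s" "c \<in> nle s"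
    have "z / (real b * real c) = s / real b * (s / real c)" using s by simp
    then have "ln (z / (real b * real c)) = ln (s / real b) + ln (s / real c)"
      using a[OF b(1)] a[OF b(2)] s by (simp only:) (subst ln_mult, auto)
    then show "1 / (real b * real c) * ln (z / (real b * real c))
        = ln (s / real b) / real b * (1 / real c) + (1 / real b) * (ln (s / real c) / real c)"
      by (simp add: add_divide_distrib)
  qed
  also have "\<dots> = 2 * (L0 s * K1 s)"
    by (simp only: sum.distrib sum_product[symmetric] L0_def K1_def) simp
  also have "(\<Sum>a\<in>nle s. K1 (z / real a) / real a)
      = (\<Sum>a\<in>nle s. (\<sigma>\<^sup>2 / 2 + g0 * \<sigma> - stj 1) * (1 / real a) + (\<sigma> + g0) * (ln (s / real a) / real a)
          + 1 / 2 * (ln (s / real a) ^ 2 / real a) + k1 (z / real a) / real a)"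
  proof (rule sum.cong[OF refl])
    fix b assume b: "b \<in> nle s"
    have K: "K1 (z / real b) = k1 (z / real b) + (\<sigma> + ln (s / real b)) ^ 2 / 2 + g0 * (\<sigma> + ln (s / real b)) - stj 1"
      using a[OF b] by (simp add: k1_def)
    show "K1 (z / real b) / real b = (\<sigma>\<^sup>2 / 2 + g0 * \<sigma> - stj 1) * (1 / real b) + (\<sigma> + g0) * (ln (s / real b) / real b)
          + 1 / 2 * (ln (s / real b) ^ 2 / real b) + k1 (z / real b) / real b"
      unfolding K using a[OF b] by (simp add: field_simps power2_eq_square)
  qed
  also have "\<dots> = (\<sigma>\<^sup>2 / 2 + g0 * \<sigma> - stj 1) * L0 s + (\<sigma> + g0) * K1 s + 1 / 2 * K2 s + E"
    by (simp only: sum.distrib sum_distrib_left[symmetric] L0_def K1_def K2_def E_def)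
  finally have K: "K z = 2 * ((\<sigma>\<^sup>2 / 2 + g0 * \<sigma> - stj 1) * L0 s + (\<sigma> + g0) * K1 s + 1 / 2 * K2 s + E)
      - 2 * (L0 s * K1 s)" .
  have K1: "K1 s = k1 s + \<sigma>\<^sup>2 / 2 + g0 * \<sigma> - stj 1" by (simp add: k1_def \<sigma>_def s_def)
  have K2: "K2 s = k2 s + \<sigma> ^ 3 / 3 + g0 * \<sigma>\<^sup>2 - 2 * stj 1 * \<sigma> + stj 2" by (simp add: k2_def \<sigma>_def s_def)
  have k1: "\<bar>k1 s\<bar> \<le> 1 / 4 / z" using abs_k1_le[OF s(1)] s(4) by simp
  have "\<bar>E\<bar> \<le> 1 / 4 / z" unfolding E_def by (rule sum_decay_le[OF abs_k1_le]) auto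
  moreover have "\<bar>k2 s\<bar> \<le> 1 / 4 / z" using abs_k2_le[OF s(1)] s(4) by simp
  moreover have "\<bar>d0 s * k1 s\<bar> \<le> 2 / 3 * (1 / 4 / z)"
  proof -
    have "2 / 3 / s \<le> 2 / 3" using s(1) by (simp add: field_simps)
    then have "\<bar>d0 s\<bar> \<le> 2 / 3" using abs_d0_le[OF s(1)] by linarith
    then show ?thesis unfolding abs_mult using k1 by (intro mult_mono) auto
  qed
  moreover have "K z - (ln z ^ 3 / 6 + g0 * ln z ^ 2 + (g0\<^sup>2 - 2 * stj 1) * ln z + stj 2 - 2 * g0 * stj 1)
     = k2 s - 2 * (d0 s * k1 s) + 2 * E"
    unfolding K K1 K2 L0_s s(5) by (simp add: power2_eq_square power3_eq_cube field_simps)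
  moreover have "1 / 4 / z + 2 * (2 / 3 * (1 / 4 / z)) + 2 * (1 / 4 / z) = 13 / 12 / z" by simp
  ultimately show ?thesis by linarith
qed

end

section \<open>Sums with inverse square roots\<close>

lemma sum_inverse_sqrt_le:
  assumes "t \<ge> 1"
  shows "(\<Sum>n\<in>nle t. 1 / sqrt (real n)) \<le> 2 * sqrt t - 1" "2 * sqrt t - 2 \<le> (\<Sum>n\<in>nle t. 1 / sqrt (real n))"
proof -
  define N where "N = nat \<lfloor>t\<rfloor>"
  have N: "N \<ge> 1" "real N \<le> t" "t \<le> real N + 1" "nle t = {1..N}"
    using assms by (auto simp: N_def le_nat_iff nle_eq)
  have step: "1 / sqrt (real (Suc n)) \<le> 2 * sqrt (real (Suc n)) - 2 * sqrt (real n)"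
    "2 * sqrt (real (Suc n)) - 2 * sqrt (real n) \<le> 1 / sqrt (real n)" if "n \<ge> 1" for n
  proof -
    define a b where "a = sqrt (real n)" and "b = sqrt (real (Suc n))"
    have ab: "0 < a" "a \<le> b" "b * b = a * a + 1" using that by (auto simp: a_def b_def)
    have "1 \<le> (2 * b - 2 * a) * b" using ab zero_le_square[of "b - a"] by (simp add: algebra_simps)
    moreover have "(2 * b - 2 * a) * a \<le> 1" using ab zero_le_square[of "b - a"] by (simp add: algebra_simps)
    ultimately show "1 / sqrt (real (Suc n)) \<le> 2 * sqrt (real (Suc n)) - 2 * sqrt (real n)"
      "2 * sqrt (real (Suc n)) - 2 * sqrt (real n) \<le> 1 / sqrt (real n)"
      using ab by (simp_all only: a_def[symmetric] b_def[symmetric] pos_divide_le_eq pos_le_divide_eq)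
  qed
  have "(\<Sum>n=1..N. 1 / sqrt (real n)) \<le> 2 * sqrt (real N) - 1" using N(1)
  proof (induction N rule: dec_induct)
    case (step n)
    then show ?case using \<open>\<And>n. 1 \<le> n \<Longrightarrow> 1 / sqrt (real (Suc n)) \<le> 2 * sqrt (real (Suc n)) - 2 * sqrt (real n)\<close>[of n]
      by simp
  qed auto
  also have "\<dots> \<le> 2 * sqrt t - 1" using N by simp
  finally show "(\<Sum>n\<in>nle t. 1 / sqrt (real n)) \<le> 2 * sqrt t - 1" using N by simp
  have "2 * sqrt t - 2 \<le> 2 * sqrt (real (Suc N)) - 2" using N by simp
  also have "\<dots> \<le> (\<Sum>n=1..N. 1 / sqrt (real n))" using N(1)
  proof (induction N rule: dec_induct)
    case base
    have "sqrt 2 \<le> 3 / 2" by (rule real_le_lsqrt) (auto simp: power2_eq_square)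
    then show ?case by simp
  next
    case (step n)
    then show ?case using \<open>\<And>n. 1 \<le> n \<Longrightarrow> 2 * sqrt (real (Suc n)) - 2 * sqrt (real n) \<le> 1 / sqrt (real n)\<close>[of "Suc n"]
      by simp
  qed
  finally show "2 * sqrt t - 2 \<le> (\<Sum>n\<in>nle t. 1 / sqrt (real n))" using N by simp
qed

text \<open>The \<open>- 1\<close> in the bound for the inner sum becomes a saving of
  \<open>2 * sqrt z\<close> after the outer summation. In \<open>divisor_pairs_sum_estimate\<close>
  this saving pays for the terms of order \<open>z * ln z\<close>.\<close>

lemma sum_divisor_count_div_sqrt_le:
  assumes "z \<ge> 1"
  shows "(\<Sum>n\<in>nle z. real (divisor_count n) / sqrt (real n))
    \<le> 2 * sqrt z * (ln z + g0 + 2 / 3 / z) - 2 * sqrt z + 2"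
proof -
  have "(\<Sum>n\<in>nle z. real (divisor_count n) / sqrt (real n))
      = (\<Sum>a\<in>nle z. \<Sum>b\<in>nle (z / real a). 1 / sqrt (real a) * (1 / sqrt (real b)))"
    using divisor_sum_lattice[of "\<lambda>n. 1 / sqrt (real n)" z] by (simp add: real_sqrt_mult)
  also have "\<dots> = (\<Sum>a\<in>nle z. 1 / sqrt (real a) * (\<Sum>b\<in>nle (z / real a). 1 / sqrt (real b)))"
    by (simp only: sum_distrib_left)
  also have "\<dots> \<le> (\<Sum>a\<in>nle z. 1 / sqrt (real a) * (2 * sqrt (z / real a) - 1))"
    by (intro sum_mono mult_left_mono sum_inverse_sqrt_le) (auto simp: mem_nle)
  also have "\<dots> = (\<Sum>a\<in>nle z. 2 * sqrt z * (1 / real a) - 1 / sqrt (real a))"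
    by (intro sum.cong refl) (auto simp: real_sqrt_divide field_simps mem_nle)
  also have "\<dots> = 2 * sqrt z * L0 z - (\<Sum>a\<in>nle z. 1 / sqrt (real a))"
    by (simp add: sum_subtractf sum_distrib_left L0_def)
  also have "\<dots> \<le> 2 * sqrt z * L0 z - (2 * sqrt z - 2)"
    using sum_inverse_sqrt_le(2)[OF assms] by linarith
  also have "L0 z \<le> ln z + g0 + 2 / 3 / z" using abs_d0_le[OF assms] unfolding d0_def by linarith
  then have "2 * sqrt z * L0 z \<le> 2 * sqrt z * (ln z + g0 + 2 / 3 / z)"
    using assms by (intro mult_left_mono) auto
  finally show ?thesis by simp
qed

section \<open>The fourfold divisor problem\<close>

text \<open>\<open>c2\<close>, \<open>c3\<close>, \<open>c4\<close> are \<open>C2\<close>,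
  \<open>C3\<close>, \<open>C4\<close> with \<open>stj\<close> in place of \<open>stieltjes\<close>.
  The estimates can thus precede the Laurent expansion, and \<open>C_eq\<close> makes the
  connection.\<close>

definition c2 :: real where "c2 = 2 * g0 - 1 / 2"
definition c3 :: real where "c3 = 6 * g0\<^sup>2 - 4 * g0 - 4 * stj 1 + 1"
definition c4 :: real where
  "c4 = 4 * g0 ^ 3 - 6 * g0\<^sup>2 + 4 * g0 - 12 * g0 * stj 1 + 4 * stj 1 + 2 * stj 2 - 1"
text \<open>\<open>x * P4 (ln x)\<close> is the residue of \<open>\<zeta>(s)\<^sup>4 x\<^sup>s / s\<close> at \<open>s = 1\<close>.\<close>

definition P4 :: "real \<Rightarrow> real" where "P4 l = l ^ 3 / 6 + c2 * l ^ 2 + c3 * l + c4"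

lemma divisor_pairs_sum_hyperbola:
  assumes "x \<ge> 1"
  shows "divisor_pairs_sum x
    = 2 * (\<Sum>n\<in>nle (sqrt x). real (divisor_count n) * D (x / real n)) - (D (sqrt x))\<^sup>2"
proof -
  have "divisor_pairs_sum x = (\<Sum>n\<in>nle x. \<Sum>a | a dvd n. real (divisor_count a) * real (divisor_count (n div a)))"
    by (simp add: divisor_pairs_sum_def divisor_pairs_def)
  also have "\<dots> = (\<Sum>a\<in>nle x. \<Sum>b\<in>nle (x / real a). real (divisor_count a) * real (divisor_count b))"
    by (rule sum_divisors_lattice)
  also have "\<dots> = 2 * (\<Sum>a\<in>nle (sqrt x). \<Sum>b\<in>nle (x / real a). real (divisor_count a) * real (divisor_count b))
      - (\<Sum>a\<in>nle (sqrt x). \<Sum>b\<in>nle (sqrt x). real (divisor_count a) * real (divisor_count b))"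
    by (rule hyperbola) (use assms in \<open>auto simp: mult.commute\<close>)
  also have "(\<Sum>a\<in>nle (sqrt x). \<Sum>b\<in>nle (sqrt x). real (divisor_count a) * real (divisor_count b)) = (D (sqrt x))\<^sup>2"
    by (simp only: D_def sum_product power2_eq_square)
  finally show ?thesis by (simp add: D_def sum_distrib_left)
qed

text \<open>The leading term is \<open>2 * S\<close>: by \<open>abs_Dl_le\<close> it is at most
  \<open>2 * z\<close> times the sum of \<open>d(n) / sqrt n\<close>, which is about
  \<open>2 * s * ln z\<close>, up to lower order. This makes \<open>4 * z * s * l\<close>, the same
  as \<open>2 * x powr (3 / 4) * ln x\<close>; all the rest is collected into a multiple of
  \<open>z\<close>.\<close>

lemma divisor_pairs_sum_estimate:
  assumes "x \<ge> 1"
  shows "\<bar>divisor_pairs_sum x - x * P4 (ln x)\<bar> \<le> 2 * x powr (3 / 4) * ln x + 18 * sqrt x"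
proof -
  define z s l g where "z = sqrt x" and "s = sqrt z" and "l = ln z" and "g = 2 * g0 - 1"
  have zs: "z \<ge> 1" "s \<ge> 1" "s * s = z" "z * z = x" "z > 0" "s > 0"
    using assms by (auto simp: z_def s_def)
  have l: "l \<ge> 0" using zs by (simp add: l_def)
  have lx: "ln x = 2 * l" using zs unfolding zs(4)[symmetric] by (simp add: l_def ln_mult)
  have ls: "l = 2 * ln s" using zs(2) unfolding l_def zs(3)[symmetric] by (simp add: ln_mult)
  have g: "0 \<le> g" "g \<le> 2 / 11" "g0 \<le> 13 / 22"
    using euler_mascheroni_gt_19_over_33 euler_mascheroni_less_13_over_22 by (simp_all add: g_def)
  define mA mK where "mA = l ^ 2 / 2 + 2 * g0 * l + g0\<^sup>2 - 2 * stj 1"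
    and "mK = l ^ 3 / 6 + g0 * l ^ 2 + (g0\<^sup>2 - 2 * stj 1) * l + stj 2 - 2 * g0 * stj 1"
  define rA rK where "rA = A z - mA - Dl z / z" and "rK = K z - mK"
  define S where "S = (\<Sum>n\<in>nle z. real (divisor_count n) * Dl (x / real n))"
  have rA: "\<bar>rA\<bar> \<le> 29 / 18 / z" using abs_A_minus_le[OF zs(1)] by (simp add: rA_def mA_def l_def)
  have rK: "\<bar>rK\<bar> \<le> 13 / 12 / z" using abs_K_minus_le[OF zs(1)] by (simp add: rK_def mK_def l_def)
  have Dz: "D z = z * (l + g) + Dl z" by (simp add: Dl_def g_def l_def)
  have Dlz: "\<bar>Dl z\<bar> \<le> s + 1 / 3" using abs_Dl_le[OF zs(1)] by (simp add: s_def)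
  have n: "real n > 0 \<and> x / real n \<ge> 1 \<and> ln (x / real n) = l + ln (z / real n)" if "n \<in> nle z" for n
  proof -
    have n: "real n \<ge> 1" "real n \<le> z" using that by (auto simp: mem_nle)
    have "z * 1 \<le> z * z" using zs by (intro mult_left_mono) auto
    then have "real n \<le> x" using n zs by linarith
    moreover have "ln (x / real n) = l + ln (z / real n)"
    proof -
      have "ln (x / real n) = ln x - ln (real n)" "ln (z / real n) = ln z - ln (real n)"
        using n zs assms by (auto simp: ln_div)
      then show ?thesis by (simp add: lx l_def)
    qed
    ultimately show ?thesis using n by simp
  qed
  have "(\<Sum>n\<in>nle z. real (divisor_count n) * D (x / real n))
     = (\<Sum>n\<in>nle z. x * (l + g) * (real (divisor_count n) / real n) + x * (real (divisor_count n) / real n * ln (z / real n))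
           + real (divisor_count n) * Dl (x / real n))"
  proof (rule sum.cong[OF refl])
    fix k assume k: "k \<in> nle z"
    have Dk: "D (x / real k) = x / real k * (l + ln (z / real k) + g) + Dl (x / real k)"
      using n[OF k] by (simp add: Dl_def g_def)
    show "real (divisor_count k) * D (x / real k) = x * (l + g) * (real (divisor_count k) / real k)
           + x * (real (divisor_count k) / real k * ln (z / real k))
           + real (divisor_count k) * Dl (x / real k)"
      unfolding Dk using n[OF k] by (simp add: field_simps)
  qed
  also have "\<dots> = x * (l + g) * A z + x * K z + S"
    by (simp only: sum.distrib sum_distrib_left[symmetric] A_def K_def S_def)
  finally have T: "divisor_pairs_sum x = 2 * (x * (l + g) * A z + x * K z + S) - (D z)\<^sup>2"
    using divisor_pairs_sum_hyperbola[OF assms] by (simp add: z_def)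
  \<comment> \<open>The terms with a single factor \<open>Dl z\<close> disappear:
    \<open>2 * x * (l + g) * (Dl z / z)\<close> from \<open>A z\<close> meets the cross term of
    \<open>(D z)\<^sup>2\<close>, and \<open>x = z * z\<close>.\<close>
  have "divisor_pairs_sum x
      = z * z * (2 * (l + g) * mA + 2 * mK - (l + g)\<^sup>2)
        + 2 * (z * z) * (l + g) * rA + 2 * (z * z) * rK - (Dl z)\<^sup>2 + 2 * S"
  proof -
    have AK: "A z = mA + rA + Dl z / z" "K z = mK + rK" by (simp_all add: rA_def rK_def)
    show ?thesis unfolding T Dz AK unfolding zs(4)[symmetric] using zs(5) by (simp add: field_simps power2_eq_square)
  qed
  moreover have "2 * (l + g) * mA + 2 * mK - (l + g)\<^sup>2 = P4 (2 * l)"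
    unfolding P4_def c2_def c3_def c4_def mA_def mK_def g_def
    by (simp add: power2_eq_square power3_eq_cube field_simps)
  ultimately have eq: "divisor_pairs_sum x - x * P4 (ln x)
      = 2 * (z * z) * (l + g) * rA + 2 * (z * z) * rK - (Dl z)\<^sup>2 + 2 * S"
    by (simp add: lx zs(4))
  have b1: "\<bar>2 * (z * z) * (l + g) * rA\<bar> \<le> 29 / 9 * (z * l) + 58 / 99 * z"
  proof -
    have "\<bar>2 * (z * z) * (l + g) * rA\<bar> = 2 * (z * z) * (l + g) * \<bar>rA\<bar>"
      using zs(5) l g by (simp add: abs_mult)
    also have "\<dots> \<le> 2 * (z * z) * (l + 2 / 11) * (29 / 18 / z)"
      using rA zs l g by (intro mult_mono) auto
    also have "\<dots> = 29 / 9 * (z * l) + 58 / 99 * z" using zs(5) by (simp add: field_simps)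
    finally show ?thesis .
  qed
  have b2: "\<bar>2 * (z * z) * rK\<bar> \<le> 13 / 6 * z"
  proof -
    have "\<bar>2 * (z * z) * rK\<bar> = 2 * (z * z) * \<bar>rK\<bar>" using zs(5) by (simp add: abs_mult)
    also have "\<dots> \<le> 2 * (z * z) * (13 / 12 / z)" using rK zs by (intro mult_left_mono) auto
    also have "\<dots> = 13 / 6 * z" using zs(5) by simp
    finally show ?thesis .
  qed
  have s3: "s + 1 / 3 \<le> 4 / 3 * s" "s \<le> z"
    using zs mult_left_mono[of 1 s s] by auto
  have b3: "\<bar>(Dl z)\<^sup>2\<bar> \<le> 16 / 9 * z"
  proof -
    have "\<bar>Dl z\<bar>\<^sup>2 \<le> (4 / 3 * s)\<^sup>2" using Dlz s3 by (intro power_mono) auto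
    then show ?thesis using zs by (simp add: power2_eq_square)
  qed
  have "\<bar>S\<bar> \<le> (\<Sum>n\<in>nle z. \<bar>real (divisor_count n) * Dl (x / real n)\<bar>)" unfolding S_def by (rule sum_abs)
  also have "\<dots> \<le> (\<Sum>n\<in>nle z. z * (real (divisor_count n) / sqrt (real n)) + 1 / 3 * real (divisor_count n))"
  proof (rule sum_mono)
    fix k assume k: "k \<in> nle z"
    have "\<bar>real (divisor_count k) * Dl (x / real k)\<bar> \<le> real (divisor_count k) * (sqrt (x / real k) + 1 / 3)"
      unfolding abs_mult using abs_Dl_le[of "x / real k"] n[OF k] by (intro mult_mono) auto
    then show "\<bar>real (divisor_count k) * Dl (x / real k)\<bar>
        \<le> z * (real (divisor_count k) / sqrt (real k)) + 1 / 3 * real (divisor_count k)"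
      by (simp add: real_sqrt_divide z_def algebra_simps)
  qed
  also have "\<dots> = z * (\<Sum>n\<in>nle z. real (divisor_count n) / sqrt (real n)) + 1 / 3 * D z"
    by (simp only: sum.distrib sum_distrib_left[symmetric] D_def)
  also have "\<dots> \<le> z * (2 * s * (l + 13 / 22 + 2 / 3 / z) - 2 * s + 2) + 1 / 3 * (z * (l + 2))"
  proof (intro add_mono mult_left_mono)
    have "2 * s * (l + g0 + 2 / 3 / z) \<le> 2 * s * (l + 13 / 22 + 2 / 3 / z)"
      using zs g by (intro mult_left_mono) auto
    then show "(\<Sum>n\<in>nle z. real (divisor_count n) / sqrt (real n)) \<le> 2 * s * (l + 13 / 22 + 2 / 3 / z) - 2 * s + 2"
      using sum_divisor_count_div_sqrt_le[OF zs(1)] by (simp add: l_def s_def)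
    have "z * g \<le> z * (2 / 11)" using zs g by (intro mult_left_mono) auto
    moreover have "Dl z \<le> z * (4 / 3)" using Dlz s3 by linarith
    ultimately show "D z \<le> z * (l + 2)" unfolding Dz distrib_left using zs(5) by linarith
  qed (use zs in auto)
  also have "\<dots> = 2 * (z * s) * l - 9 / 11 * (z * s) + 4 / 3 * s + 2 * z + 1 / 3 * (z * l) + 2 / 3 * z"
    using zs by (simp add: field_simps)
  finally have b4: "\<bar>2 * S\<bar> \<le> 4 * (z * s) * l - 18 / 11 * (z * s) + 8 / 3 * s + 16 / 3 * z + 2 / 3 * (z * l)"
    by simp
  \<comment> \<open>The tangent of \<open>ln\<close> at 5, with \<open>ln 5\<close> rounded up. Its
    slope is small enough: the terms \<open>z * l\<close> add up to \<open>35 / 9 * (z * l)\<close>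
    and cost \<open>14 / 9 * (z * s)\<close>, which the available \<open>- 18 / 11 * (z * s)\<close>
    covers.\<close>
  have "ln s \<le> s / 5 + 13 / 20"
  proof -
    have "ln s = ln (s / 5) + ln 5" using zs by (subst ln_mult_pos[symmetric]) auto
    moreover have "ln (s / 5) \<le> s / 5 - 1" using zs by (intro ln_le_minus_one) auto
    moreover have "ln 5 = ln (5 / 4) + 2 * ln (2 :: real)"
      using ln_mult_pos[of "5 / 4" 4] ln_mult_pos[of 2 2] by simp
    moreover have "ln (5 / 4 :: real) \<le> 5 / 4 - 1" by (intro ln_le_minus_one) auto
    ultimately show ?thesis using ln2_le_25_over_36 by simp
  qed
  then have "z * l \<le> z * (2 * (s / 5 + 13 / 20))" using zs ls by (intro mult_left_mono) auto
  then have "35 / 9 * (z * l) \<le> 14 / 9 * (z * s) + 91 / 18 * z" by (simp add: algebra_simps)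
  then have "\<bar>divisor_pairs_sum x - x * P4 (ln x)\<bar> \<le> 4 * (z * s) * l + 18 * z"
    unfolding eq using b1 b2 b3 b4 s3 zs(5) mult_pos_pos[OF zs(5,6)] by linarith
  also have "4 * (z * s) * l = 2 * x powr (3 / 4) * ln x"
  proof -
    have "x powr (3 / 4) = x powr (1 / 2) * x powr (1 / 4)" by (subst powr_add[symmetric]) simp
    also have "x powr (1 / 4) = (x powr (1 / 2)) powr (1 / 2)" by (simp add: powr_powr)
    finally have "x powr (3 / 4) = z * s" using assms by (simp add: powr_half_sqrt z_def s_def)
    then show ?thesis by (simp add: lx)
  qed
  finally show ?thesis by (simp add: z_def)
qed

section \<open>Numerical bounds for logarithms\<close>

text \<open>\<open>ln (a / b)\<close> is twice the inverse hyperbolic tangent of \<open>y\<close>,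
  whose series converges fast when \<open>a\<close> and \<open>b\<close> are close.\<close>

lemma ln_ratio_bounds:
  fixes a b :: real
  assumes "0 < b" "b < a"
  defines "y \<equiv> (a - b) / (a + b)"
  shows "(\<Sum>k<n. 2 * y ^ (2 * k + 1) / real (2 * k + 1)) \<le> ln a - ln b"
    "ln a - ln b \<le> (\<Sum>k<n. 2 * y ^ (2 * k + 1) / real (2 * k + 1)) + 2 * (y ^ (2 * n + 1) / (1 - y\<^sup>2) / real (2 * n + 1))"
proof -
  have "a / b - 1 = (a - b) / b" "a / b + 1 = (a + b) / b"
    using assms(1) by (simp_all add: diff_divide_distrib add_divide_distrib)
  then have "(a / b - 1) / (a / b + 1) = y" using assms(1) by (simp add: y_def)
  moreover have "ln (a / b) = ln a - ln b" using assms(1,2) by (simp add: ln_div)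
  ultimately show "(\<Sum>k<n. 2 * y ^ (2 * k + 1) / real (2 * k + 1)) \<le> ln a - ln b"
    "ln a - ln b \<le> (\<Sum>k<n. 2 * y ^ (2 * k + 1) / real (2 * k + 1)) + 2 * (y ^ (2 * n + 1) / (1 - y\<^sup>2) / real (2 * n + 1))"
    using ln_approx_bounds[of "a / b" n] assms(1,2) by auto
qed

lemma ln_2_1:
  "69314718054 / 100000000000 \<le> ln (2::real) - ln 1" "ln (2::real) - ln 1 \<le> 69314718058 / 100000000000"
  using ln_ratio_bounds[of 1 2 10] by (simp_all add: eval_nat_numeral)

lemma ln_3_2:
  "40546510810 / 100000000000 \<le> ln (3::real) - ln 2" "ln (3::real) - ln 2 \<le> 40546510812 / 100000000000"
  using ln_ratio_bounds[of 2 3 7] by (simp_all add: eval_nat_numeral)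

lemma ln_5_4:
  "22314355131 / 100000000000 \<le> ln (5::real) - ln 4" "ln (5::real) - ln 4 \<le> 22314355132 / 100000000000"
  using ln_ratio_bounds[of 4 5 6] by (simp_all add: eval_nat_numeral)

lemma ln_8_7:
  "13353139262 / 100000000000 \<le> ln (8::real) - ln 7" "ln (8::real) - ln 7 \<le> 13353139263 / 100000000000"
  using ln_ratio_bounds[of 7 8 5] by (simp_all add: eval_nat_numeral)

lemma ln_products:
  "ln (4::real) = 2 * ln 2" "ln (6::real) = ln 2 + ln 3" "ln (8::real) = 3 * ln 2"
  "ln (9::real) = 2 * ln 3" "ln (10::real) = ln 2 + ln 5"
  using ln_mult_pos[of 2 "2::real"] ln_mult_pos[of 2 "3::real"] ln_mult_pos[of 2 "4::real"]
    ln_mult_pos[of 3 "3::real"] ln_mult_pos[of 2 "5::real"] by simp_all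

text \<open>The ratios 2/1, 3/2, 5/4 and 8/7, with \<open>y\<close> equal to 1/3, 1/5, 1/9 and 1/15,
  bring in the primes 2, 3, 5 and 7 one at a time.\<close>

lemma ln_bounds:
  "69314717 / 100000000 \<le> ln (2::real)" "ln (2::real) \<le> 69314719 / 100000000"
  "109861228 / 100000000 \<le> ln (3::real)" "ln (3::real) \<le> 109861229 / 100000000"
  "138629436 / 100000000 \<le> ln (4::real)" "ln (4::real) \<le> 138629437 / 100000000"
  "160943791 / 100000000 \<le> ln (5::real)" "ln (5::real) \<le> 160943792 / 100000000"
  "179175946 / 100000000 \<le> ln (6::real)" "ln (6::real) \<le> 179175948 / 100000000"
  "194591014 / 100000000 \<le> ln (7::real)" "ln (7::real) \<le> 194591016 / 100000000"
  "207944154 / 100000000 \<le> ln (8::real)" "ln (8::real) \<le> 207944155 / 100000000"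
  "219722457 / 100000000 \<le> ln (9::real)" "ln (9::real) \<le> 219722458 / 100000000"
  "230258509 / 100000000 \<le> ln (10::real)" "ln (10::real) \<le> 230258510 / 100000000"
  using ln_2_1 ln_3_2 ln_5_4 ln_8_7 ln_products unfolding ln_one by linarith+

lemma power_lower: "a \<le> x \<Longrightarrow> 0 \<le> a \<Longrightarrow> b \<le> a ^ k \<Longrightarrow> b \<le> (x::real) ^ k"
  by (meson order.trans power_mono)

lemma power_upper: "x \<le> a \<Longrightarrow> 0 \<le> x \<Longrightarrow> a ^ k \<le> b \<Longrightarrow> (x::real) ^ k \<le> b"
  by (meson order.trans power_mono)

lemma ln_power2_bounds:
  "48045299 / 100000000 \<le> ln (2::real) ^ 2" "ln (2::real) ^ 2 \<le> 48045303 / 100000000"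
  "120694894 / 100000000 \<le> ln (3::real) ^ 2" "ln (3::real) ^ 2 \<le> 120694897 / 100000000"
  "192181205 / 100000000 \<le> ln (4::real) ^ 2" "ln (4::real) ^ 2 \<le> 192181209 / 100000000"
  "259029038 / 100000000 \<le> ln (5::real) ^ 2" "ln (5::real) ^ 2 \<le> 259029042 / 100000000"
  "321040196 / 100000000 \<le> ln (6::real) ^ 2" "ln (6::real) ^ 2 \<le> 321040204 / 100000000"
  "378656627 / 100000000 \<le> ln (7::real) ^ 2" "ln (7::real) ^ 2 \<le> 378656636 / 100000000"
  "432407711 / 100000000 \<le> ln (8::real) ^ 2" "ln (8::real) ^ 2 \<le> 432407716 / 100000000"
  "482779581 / 100000000 \<le> ln (9::real) ^ 2" "ln (9::real) ^ 2 \<le> 482779586 / 100000000"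
  "530189809 / 100000000 \<le> ln (10::real) ^ 2" "ln (10::real) ^ 2 \<le> 530189815 / 100000000"
  by (rule ln_bounds[THEN power_lower] ln_bounds[THEN power_upper]; simp add: power_divide)+

lemma ln_power3_bounds:
  "33302463 / 100000000 \<le> ln (2::real) ^ 3" "ln (2::real) ^ 3 \<le> 33302467 / 100000000"
  "132596892 / 100000000 \<le> ln (3::real) ^ 3" "ln (3::real) ^ 3 \<le> 132596897 / 100000000"
  "266419720 / 100000000 \<le> ln (4::real) ^ 3" "ln (4::real) ^ 3 \<le> 266419727 / 100000000"
  "416891154 / 100000000 \<le> ln (5::real) ^ 3" "ln (5::real) ^ 3 \<le> 416891163 / 100000000"
  "575226808 / 100000000 \<le> ln (6::real) ^ 3" "ln (6::real) ^ 3 \<le> 575226828 / 100000000"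
  "736831770 / 100000000 \<le> ln (7::real) ^ 3" "ln (7::real) ^ 3 \<le> 736831794 / 100000000"
  "899166558 / 100000000 \<le> ln (8::real) ^ 3" "ln (8::real) ^ 3 \<le> 899166572 / 100000000"
  "1060775157 / 100000000 \<le> ln (9::real) ^ 3" "ln (9::real) ^ 3 \<le> 1060775172 / 100000000"
  "1220807150 / 100000000 \<le> ln (10::real) ^ 3" "ln (10::real) ^ 3 \<le> 1220807167 / 100000000"
  by (rule ln_bounds[THEN power_lower] ln_bounds[THEN power_upper]; simp add: power_divide)+

section \<open>Euler-Maclaurin summation\<close>

text \<open>An integration in disguise: \<open>c / (n + 1) * h ^ (n + 1)\<close> plus or minus
  \<open>e h\<close> starts at 0 and does not decrease.\<close>

lemma derivative_power_bound:
  fixes e e' :: "real \<Rightarrow> real"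
  assumes der: "\<And>h. 0 \<le> h \<Longrightarrow> h \<le> 1 \<Longrightarrow> (e has_real_derivative e' h) (at h)"
    and zero: "e 0 = 0"
    and bd: "\<And>h. 0 \<le> h \<Longrightarrow> h \<le> 1 \<Longrightarrow> \<bar>e' h\<bar> \<le> c * h ^ n"
    and h: "0 \<le> h" "h \<le> 1"
  shows "\<bar>e h\<bar> \<le> c / real (Suc n) * h ^ Suc n"
proof -
  have "0 \<le> c / real (Suc n) * h ^ Suc n - s * e h" if s: "s = 1 \<or> s = -1" for s
  proof -
    have "c / real (Suc n) * 0 ^ Suc n - s * e 0 \<le> c / real (Suc n) * h ^ Suc n - s * e h"
    proof (rule DERIV_nonneg_imp_nondecreasing[OF h(1)])
      fix x assume x: "0 \<le> x" "x \<le> h"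
      have "((\<lambda>h. c / real (Suc n) * h ^ Suc n - s * e h) has_real_derivative
              c / real (Suc n) * (real (Suc n) * x ^ n) - s * e' x) (at x)"
        using x h by (auto intro!: derivative_eq_intros der simp del: of_nat_Suc power_Suc)
      then have "((\<lambda>h. c / real (Suc n) * h ^ Suc n - s * e h) has_real_derivative c * x ^ n - s * e' x) (at x)"
        by (simp del: of_nat_Suc power_Suc)
      moreover have "0 \<le> c * x ^ n - s * e' x" using bd[of x] x h s by (auto simp: abs_le_iff)
      ultimately show "\<exists>y. ((\<lambda>h. c / real (Suc n) * h ^ Suc n - s * e h) has_real_derivative y) (at x) \<and> 0 \<le> y"
        by blast
    qed
    then show ?thesis using zero by simp
  qed
  from this[of 1] this[of "-1"] show ?thesis by auto
qed

text \<open>The error of the corrected trapezoidal rule is viewed as a function \<open>e\<close> of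
  the step length \<open>h\<close>. It and its derivatives \<open>e1\<close>, \<open>e2\<close>
  vanish at 0, and the third derivative is \<open>h\<^sup>2 * f4 (a + h) / 12\<close>; integrating
  back three times divides by 3, 4 and 5, which turns 12 into 720.\<close>

lemma euler_maclaurin_step:
  fixes F f f1 f2 f3 f4 :: "real \<Rightarrow> real"
  assumes "\<And>u. a \<le> u \<Longrightarrow> u \<le> a + 1 \<Longrightarrow> (F has_real_derivative f u) (at u)"
    "\<And>u. a \<le> u \<Longrightarrow> u \<le> a + 1 \<Longrightarrow> (f has_real_derivative f1 u) (at u)"
    "\<And>u. a \<le> u \<Longrightarrow> u \<le> a + 1 \<Longrightarrow> (f1 has_real_derivative f2 u) (at u)"
    "\<And>u. a \<le> u \<Longrightarrow> u \<le> a + 1 \<Longrightarrow> (f2 has_real_derivative f3 u) (at u)"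
    "\<And>u. a \<le> u \<Longrightarrow> u \<le> a + 1 \<Longrightarrow> (f3 has_real_derivative f4 u) (at u)"
    and M: "\<And>u. a \<le> u \<Longrightarrow> u \<le> a + 1 \<Longrightarrow> \<bar>f4 u\<bar> \<le> M"
  shows "\<bar>F (a + 1) - F a - (f a + f (a + 1)) / 2 + (f1 (a + 1) - f1 a) / 12\<bar> \<le> M / 720"
proof -
  have shift: "((\<lambda>h. g (a + h)) has_real_derivative g' (a + h)) (at h)"
    if "\<And>u. a \<le> u \<Longrightarrow> u \<le> a + 1 \<Longrightarrow> (g has_real_derivative g' u) (at u)" "0 \<le> h" "h \<le> 1" for g g' h
    using that by (auto intro!: derivative_eq_intros DERIV_chain'[of "\<lambda>h. a + h" 1 h UNIV g, THEN DERIV_cong])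
  note d = shift[OF assms(1)] shift[OF assms(2)] shift[OF assms(3)] shift[OF assms(4)] shift[OF assms(5)]
  define e where "e = (\<lambda>h. F (a + h) - F a - h * (f a + f (a + h)) / 2 + h\<^sup>2 * (f1 (a + h) - f1 a) / 12)"
  define e1 where "e1 = (\<lambda>h. (f (a + h) - f a) / 2 - h * f1 (a + h) / 2 + h * (f1 (a + h) - f1 a) / 6 + h\<^sup>2 * f2 (a + h) / 12)"
  define e2 where "e2 = (\<lambda>h. (f1 (a + h) - f1 a) / 6 - h * f2 (a + h) / 6 + h\<^sup>2 * f3 (a + h) / 12)"
  have b3: "\<bar>h\<^sup>2 * f4 (a + h) / 12\<bar> \<le> M / 12 * h ^ 2" if "0 \<le> h" "h \<le> 1" for h
    using mult_left_mono[OF M[of "a + h"], of "h\<^sup>2 / 12"] that by (simp add: abs_mult mult.commute)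
  have b2: "\<bar>e2 h\<bar> \<le> M / 36 * h ^ 3" if h: "0 \<le> h" "h \<le> 1" for h
  proof -
    have "\<bar>e2 h\<bar> \<le> M / 12 / real (Suc 2) * h ^ Suc 2"
    proof (rule derivative_power_bound[OF _ _ b3 h])
      fix h :: real assume "0 \<le> h" "h \<le> 1"
      then show "(e2 has_real_derivative h\<^sup>2 * f4 (a + h) / 12) (at h)"
        unfolding e2_def by (auto intro!: derivative_eq_intros d) (simp add: field_simps power2_eq_square)
    qed (auto simp: e2_def)
    then show ?thesis by (simp add: eval_nat_numeral)
  qed
  have b1: "\<bar>e1 h\<bar> \<le> M / 144 * h ^ 4" if h: "0 \<le> h" "h \<le> 1" for h
  proof -
    have "\<bar>e1 h\<bar> \<le> M / 36 / real (Suc 3) * h ^ Suc 3"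
    proof (rule derivative_power_bound[OF _ _ b2 h])
      fix h :: real assume "0 \<le> h" "h \<le> 1"
      then show "(e1 has_real_derivative e2 h) (at h)"
        unfolding e1_def e2_def by (auto intro!: derivative_eq_intros d) (simp add: field_simps power2_eq_square)
    qed (auto simp: e1_def)
    then show ?thesis by (simp add: eval_nat_numeral)
  qed
  have "\<bar>e 1\<bar> \<le> M / 144 / real (Suc 4) * 1 ^ Suc 4"
  proof (rule derivative_power_bound[OF _ _ b1])
    fix h :: real assume "0 \<le> h" "h \<le> 1"
    then show "(e has_real_derivative e1 h) (at h)"
      unfolding e_def e1_def by (auto intro!: derivative_eq_intros d) (simp add: field_simps power2_eq_square)
  qed (auto simp: e_def)
  then show ?thesis by (simp add: e_def)
qed

text \<open>Quotients of this shape are closed under differentiation: \<open>P\<close> becomes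
  \<open>pderiv P - smult m P\<close> and \<open>m\<close> becomes \<open>m + 1\<close>. Higher
  derivatives thus reduce to arithmetic with coefficients.\<close>

definition log_quot :: "real poly \<Rightarrow> nat \<Rightarrow> real \<Rightarrow> real" where
  "log_quot P m u = poly P (ln u) / u ^ m"

definition log_quot_deriv :: "nat \<Rightarrow> real poly \<Rightarrow> real poly" where
  "log_quot_deriv m P = pderiv P - smult (real m) P"

lemma DERIV_log_quot:
  assumes "u > 0"
  shows "(log_quot P m has_real_derivative log_quot (log_quot_deriv m P) (Suc m) u) (at u)"
proof -
  have "((\<lambda>u. poly P (ln u) / u ^ m) has_real_derivative
      (poly (pderiv P) (ln u) * (1 / u) * u ^ m - poly P (ln u) * (real m * u ^ (m - 1))) / (u ^ m * u ^ m)) (at u)"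
    using assms
    by (auto intro!: derivative_eq_intros DERIV_chain'[of ln "1 / u" u UNIV "poly P", THEN DERIV_cong] simp: field_simps)
  moreover have "(poly (pderiv P) (ln u) * (1 / u) * u ^ m - poly P (ln u) * (real m * u ^ (m - 1))) / (u ^ m * u ^ m)
      = log_quot (log_quot_deriv m P) (Suc m) u"
  proof (cases m)
    case (Suc n)
    then show ?thesis using assms by (simp add: log_quot_def log_quot_deriv_def field_simps)
  qed (use assms in \<open>simp add: log_quot_def log_quot_deriv_def\<close>)
  ultimately show ?thesis by (simp add: log_quot_def[abs_def])
qed

lemma log_quot_tendsto_0:
  assumes "m > 0"
  shows "(\<lambda>n. log_quot P m (real n)) \<longlonglongrightarrow> 0"
proof -
  have "(\<lambda>n. ln (real n) ^ k / real n ^ m) \<longlonglongrightarrow> 0" for k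
  proof (rule Lim_null_comparison)
    show "\<forall>\<^sub>F n in sequentially. norm (ln (real n) ^ k / real n ^ m) \<le> ln (real n) ^ k / real n"
      using eventually_ge_at_top[of 1]
    proof eventually_elim
      case (elim n)
      then have "real n ^ 1 \<le> real n ^ m" using assms by (intro power_increasing) auto
      then show ?case using elim by (auto intro!: frac_le)
    qed
    show "(\<lambda>n. ln (real n) ^ k / real n) \<longlonglongrightarrow> 0" by real_asymp
  qed
  then have "(\<lambda>n. \<Sum>k\<le>degree P. coeff P k * (ln (real n) ^ k / real n ^ m)) \<longlonglongrightarrow> (\<Sum>k\<le>degree P. coeff P k * 0)"
    by (intro tendsto_sum tendsto_mult tendsto_const)
  then show ?thesis by (simp add: log_quot_def poly_altdef sum_divide_distrib)
qed

text \<open>\<open>R\<close> describes an antiderivative of the summand, so five steps give the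
  fourth derivative of the summand, the one that controls the remainder.\<close>

definition log_quot_deriv5 :: "nat \<Rightarrow> real poly \<Rightarrow> real poly" where
  "log_quot_deriv5 m R = log_quot_deriv (m + 4) (log_quot_deriv (m + 3) (log_quot_deriv (m + 2)
     (log_quot_deriv (m + 1) (log_quot_deriv m R))))"

definition euler_maclaurin_value :: "nat \<Rightarrow> real poly \<Rightarrow> nat \<Rightarrow> real" where
  "euler_maclaurin_value m R N = (\<Sum>k=1..N. log_quot (log_quot_deriv m R) (m + 1) (real k)) - log_quot R m (real N)
     - log_quot (log_quot_deriv m R) (m + 1) (real N) / 2
     - log_quot (log_quot_deriv (m + 1) (log_quot_deriv m R)) (m + 2) (real N) / 12"

text \<open>From \<open>N\<close> to \<open>N + 1\<close> the value changes only by the error of one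
  step, and it tends to \<open>c\<close>; its distance from \<open>c\<close> is therefore a tail sum
  of such errors. Dividing the hypothesis on the polynomial by \<open>u ^ (m + 5)\<close> bounds the
  fourth derivative by \<open>B / u ^ 4\<close>.\<close>

lemma euler_maclaurin_log_quot:
  assumes lim: "(\<lambda>n. (\<Sum>k=1..n. log_quot (log_quot_deriv m R) (m + 1) (real k)) - log_quot R m (real n)) \<longlonglongrightarrow> c"
    and B: "\<And>u. u \<ge> real N \<Longrightarrow> \<bar>poly (log_quot_deriv5 m R) (ln u)\<bar> \<le> B * u ^ (m + 1)"
    and N: "N \<ge> 2"
  shows "\<bar>euler_maclaurin_value m R N - c\<bar> \<le> B / 2160 / (real N - 1) ^ 3"
proof -
  define P where "P = log_quot_deriv m R"
  define Q1 where "Q1 = log_quot_deriv (m + 1) P"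
  define Q2 Q3 where "Q2 = log_quot_deriv (m + 2) Q1" and "Q3 = log_quot_deriv (m + 3) Q2"
  define Q4 where "Q4 = log_quot_deriv (m + 4) Q3"
  note lim = lim[folded P_def]
  have B: "\<bar>poly Q4 (ln u)\<bar> \<le> B * u ^ (m + 1)" if "u \<ge> real N" for u
    using B[OF that] by (simp add: log_quot_deriv5_def Q4_def Q3_def Q2_def Q1_def P_def)
  define r where "r = (\<lambda>n. (\<Sum>k=1..n. log_quot P (m + 1) (real k)) - log_quot R m (real n)
      - log_quot P (m + 1) (real n) / 2 - log_quot Q1 (m + 2) (real n) / 12 - c)"
  have "\<bar>r N\<bar> \<le> B / 2160 / (real N - 1) ^ 3"
  proof (rule telescope_tail_bound[where N = N and f = r and n = N and g = "\<lambda>n. B / 2160 / (real n - 1) ^ 3"])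
    fix n assume n: "n \<ge> N"
    define a where "a = real n"
    have a: "a \<ge> 2" using n N by (simp add: a_def)
    have "0 \<le> \<bar>poly Q4 (ln (real N))\<bar>" by simp
    also have "\<dots> \<le> B * real N ^ (m + 1)" by (rule B) simp
    finally have "0 \<le> B * real N ^ (m + 1)" .
    moreover have "real N ^ (m + 1) > 0" using N by simp
    ultimately have B0: "B \<ge> 0" unfolding zero_le_mult_iff by auto
    have "\<bar>log_quot R m (a + 1) - log_quot R m a - (log_quot P (m + 1) a + log_quot P (m + 1) (a + 1)) / 2
        + (log_quot Q1 (m + 2) (a + 1) - log_quot Q1 (m + 2) a) / 12\<bar> \<le> B / a ^ 4 / 720"
    proof (rule euler_maclaurin_step[where ?f2.0 = "log_quot Q2 (m + 3)" and ?f3.0 = "log_quot Q3 (m + 4)"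
          and ?f4.0 = "log_quot Q4 (m + 5)"])
      fix u assume u: "a \<le> u" "u \<le> a + 1"
      have u0: "u > 0" using u a by linarith
      show "(log_quot R m has_real_derivative log_quot P (m + 1) u) (at u)"
        using DERIV_log_quot[OF u0, of R m] by (simp add: P_def)
      show "(log_quot P (m + 1) has_real_derivative log_quot Q1 (m + 2) u) (at u)"
        using DERIV_log_quot[OF u0, of P "m + 1"] by (simp add: Q1_def)
      show "(log_quot Q1 (m + 2) has_real_derivative log_quot Q2 (m + 3) u) (at u)"
        using DERIV_log_quot[OF u0, of Q1 "m + 2"] by (simp add: Q2_def eval_nat_numeral)
      show "(log_quot Q2 (m + 3) has_real_derivative log_quot Q3 (m + 4) u) (at u)"
        using DERIV_log_quot[OF u0, of Q2 "m + 3"] by (simp add: Q3_def eval_nat_numeral)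
      show "(log_quot Q3 (m + 4) has_real_derivative log_quot Q4 (m + 5) u) (at u)"
        using DERIV_log_quot[OF u0, of Q3 "m + 4"] by (simp add: Q4_def eval_nat_numeral)
      have "\<bar>poly Q4 (ln u)\<bar> \<le> B * u ^ (m + 1)" using u n by (intro B) (simp add: a_def)
      then have "\<bar>log_quot Q4 (m + 5) u\<bar> \<le> B * u ^ (m + 1) / u ^ (m + 5)"
        unfolding log_quot_def using u0 by (intro abs_divide_right_mono) auto
      also have "\<dots> = B / u ^ 4" using u0 by (simp add: power_add eval_nat_numeral)
      also have "\<dots> \<le> B / a ^ 4" using u a B0 by (intro divide_left_mono power_mono mult_pos_pos zero_less_power) auto
      finally show "\<bar>log_quot Q4 (m + 5) u\<bar> \<le> B / a ^ 4" .
    qed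
    also have "log_quot R m (a + 1) - log_quot R m a - (log_quot P (m + 1) a + log_quot P (m + 1) (a + 1)) / 2
        + (log_quot Q1 (m + 2) (a + 1) - log_quot Q1 (m + 2) a) / 12 = - (r (Suc n) - r n)"
    proof -
      have a1: "real (Suc n) = a + 1" by (simp add: a_def)
      have s: "(\<Sum>k=1..Suc n. log_quot P (m + 1) (real k)) = (\<Sum>k=1..n. log_quot P (m + 1) (real k)) + log_quot P (m + 1) (a + 1)"
        unfolding a1[symmetric] by simp
      show ?thesis unfolding r_def s a1 a_def[symmetric] by (simp add: diff_divide_distrib add_divide_distrib)
    qed
    \<comment> \<open>The error of a step is compared with a telescoping difference:
      \<open>3 / a ^ 4\<close> is at most \<open>1 / (a - 1) ^ 3 - 1 / a ^ 3\<close>, hence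
      \<open>2160 = 3 * 720\<close>.\<close>
    also have "B / a ^ 4 / 720 \<le> B / 2160 / (a - 1) ^ 3 - B / 2160 / a ^ 3"
    proof -
      define b where "b = a - 1"
      have b: "b > 0" "a = b + 1" using a by (auto simp: b_def)
      have "3 / a ^ 4 \<le> 1 / b ^ 3 - 1 / a ^ 3"
      proof -
        have "a > 0" using a by simp
        then have "1 / b ^ 3 - 1 / a ^ 3 - 3 / a ^ 4 = (a ^ 4 - a * b ^ 3 - 3 * b ^ 3) / (b ^ 3 * a ^ 4)"
          using b(1) by (simp add: field_simps eval_nat_numeral)
        also have "a ^ 4 - a * b ^ 3 - 3 * b ^ 3 = 6 * b\<^sup>2 + 4 * b + 1"
          unfolding b(2) by (simp add: algebra_simps eval_nat_numeral)
        finally have "1 / b ^ 3 - 1 / a ^ 3 - 3 / a ^ 4 = (6 * b\<^sup>2 + 4 * b + 1) / (b ^ 3 * a ^ 4)" .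
        moreover have "(6 * b\<^sup>2 + 4 * b + 1) / (b ^ 3 * a ^ 4) \<ge> 0" using b by simp
        ultimately show ?thesis by linarith
      qed
      then have "B / 2160 * (3 / a ^ 4) \<le> B / 2160 * (1 / b ^ 3 - 1 / a ^ 3)" using B0 by (intro mult_left_mono) auto
      then show ?thesis by (simp add: b_def right_diff_distrib)
    qed
    finally show "\<bar>r (Suc n) - r n\<bar> \<le> B / 2160 / (real n - 1) ^ 3 - B / 2160 / (real (Suc n) - 1) ^ 3"
      by (simp add: a_def)
  next
    have "(\<lambda>n. ((\<Sum>k=1..n. log_quot P (m + 1) (real k)) - log_quot R m (real n))
      - log_quot P (m + 1) (real n) / 2 - log_quot Q1 (m + 2) (real n) / 12 - c) \<longlonglongrightarrow> c - 0 / 2 - 0 / 12 - c"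
      by (intro tendsto_diff tendsto_divide lim log_quot_tendsto_0 tendsto_const) auto
    then show "r \<longlonglongrightarrow> 0" by (simp add: r_def)
    show "(\<lambda>n. B / 2160 / (real n - 1) ^ 3) \<longlonglongrightarrow> 0" by real_asymp
  qed simp
  then show ?thesis by (simp add: r_def euler_maclaurin_value_def P_def Q1_def)
qed

text \<open>Tangents of \<open>ln\<close> at 10 and, for \<open>ln (sqrt u)\<close>, at
  \<open>sqrt 10\<close>; this is where the bounds have to be good, because all sums below are cut
  at 10.\<close>

lemma ln_power_le_linear:
  fixes u :: real
  assumes "u \<ge> 10"
  shows "0 \<le> ln u" "ln u \<le> (2304 / 10000) * u" "ln u ^ 2 \<le> (55 / 100) * u" "ln u ^ 3 \<le> (13 / 100) * u\<^sup>2"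
proof -
  show l0: "0 \<le> ln u" using assms by simp
  have *: "ln v \<le> v / c + ln c - 1" if "v > 0" "c > 0" for v c :: real
  proof -
    have "ln (v / c) \<le> v / c - 1" using that by (intro ln_le_minus_one) auto
    then show ?thesis using that by (simp add: ln_div)
  qed
  show l1: "ln u \<le> (2304 / 10000) * u" using *[of u 10] ln_bounds(18) assms by simp
  have "ln u = 2 * ln (sqrt u)" using assms by (simp add: ln_sqrt)
  also have "ln (sqrt u) \<le> sqrt u / sqrt 10 + ln (sqrt 10) - 1" using assms by (intro *) auto
  also have "sqrt u / sqrt 10 = sqrt u * (sqrt 10 / 10)" by (simp add: real_div_sqrt field_simps)
  also have "sqrt u * (sqrt 10 / 10) \<le> sqrt u * (3163 / 10000)"
  proof -
    have "sqrt 10 \<le> (3163 / 1000)" by (rule real_le_lsqrt) (auto simp: power2_eq_square)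
    then show ?thesis using assms by (intro mult_left_mono) auto
  qed
  also have "ln (sqrt 10) \<le> (11513 / 10000)" using ln_bounds(18) by (simp add: ln_sqrt)
  finally have "ln u \<le> 2 * (sqrt u * (3163 / 10000) + (11513 / 10000) - 1)" by simp
  moreover have "sqrt u \<ge> (316 / 100)" using assms by (intro real_le_rsqrt) (simp add: power2_eq_square)
  ultimately have "ln u \<le> (7284 / 10000) * sqrt u" by simp
  then have "ln u ^ 2 \<le> ((7284 / 10000) * sqrt u) ^ 2" using l0 by (intro power_mono) auto
  also have "\<dots> \<le> (55 / 100) * u" using assms by (simp add: power_mult_distrib power2_eq_square)
  finally show l2: "ln u ^ 2 \<le> (55 / 100) * u" .
  have "ln u ^ 3 = ln u ^ 2 * ln u" by (simp add: eval_nat_numeral)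
  also have "\<dots> \<le> ((55 / 100) * u) * ((2304 / 10000) * u)" using l0 l1 l2 assms by (intro mult_mono) auto
  also have "\<dots> \<le> (13 / 100) * u\<^sup>2" using zero_le_square[of u] by (simp add: power2_eq_square)
  finally show "ln u ^ 3 \<le> (13 / 100) * u\<^sup>2" .
qed

lemma stj_LIMSEQ:
  "(\<lambda>n. (\<Sum>k=1..n. ln (real k) ^ j / real k) - ln (real n) ^ Suc j / (real j + 1)) \<longlonglongrightarrow> stj j"
proof -
  have "(\<lambda>n. (\<Sum>k<n. stj_term j k) + (ln (real n + 1) ^ Suc j - ln (real n) ^ Suc j) / (real j + 1)) \<longlonglongrightarrow> stj j + 0 / (real j + 1)"
  proof (intro tendsto_add tendsto_divide tendsto_const)
    show "(\<lambda>n. \<Sum>k<n. stj_term j k) \<longlonglongrightarrow> stj j" using stj_sums[of j] by (simp add: sums_def)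
    show "(\<lambda>n. ln (real n + 1) ^ Suc j - ln (real n) ^ Suc j) \<longlonglongrightarrow> 0"
    proof (rule Lim_null_comparison)
      show "\<forall>\<^sub>F n in sequentially. norm (ln (real n + 1) ^ Suc j - ln (real n) ^ Suc j)
          \<le> (real j + 1) * ln (real n + 1) ^ j / real n"
        using eventually_ge_at_top[of 1]
      proof eventually_elim
        case (elim n)
        have "\<exists>y. real n < y \<and> y < real n + 1 \<and>
            ln (real n + 1) ^ Suc j - ln (real n) ^ Suc j = (real n + 1 - real n) * (real (Suc j) * ln y ^ j * (1 / y))"
          by (rule MVT2) (use elim in \<open>auto intro!: derivative_eq_intros simp del: power_Suc of_nat_Suc\<close>)
        then obtain y where y: "real n < y" "y < real n + 1"
            "ln (real n + 1) ^ Suc j - ln (real n) ^ Suc j = real (Suc j) * ln y ^ j * (1 / y)" by auto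
        have "norm (ln (real n + 1) ^ Suc j - ln (real n) ^ Suc j) = real (Suc j) * ln y ^ j / y"
          using y elim unfolding y(3) by (simp add: abs_mult)
        also have "\<dots> \<le> real (Suc j) * ln (real n + 1) ^ j / real n"
          using y elim by (intro frac_le mult_left_mono power_mono mult_nonneg_nonneg) auto
        finally show ?case by (simp add: add.commute)
      qed
      show "(\<lambda>n. (real j + 1) * ln (real n + 1) ^ j / real n) \<longlonglongrightarrow> 0" by real_asymp
    qed
  qed auto
  then show ?thesis by (simp add: sum_stj_term diff_divide_distrib)
qed

text \<open>This is \<open>(- 1) ^ k\<close> times the k-th derivative of zeta at 2. The term
  \<open>n = 0\<close> is 0 since division by 0 yields 0, even for \<open>k = 0\<close>, where its
  numerator is 1.\<close>

definition zeta2_deriv :: "nat \<Rightarrow> real" where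
  "zeta2_deriv k = (\<Sum>n. ln (real n) ^ k / real n ^ 2)"

lemma summable_ln_power_div_square: "summable (\<lambda>n. ln (real n) ^ k / real n ^ 2)"
proof (rule summable_comparison_test'[where N = 1])
  have "summable (\<lambda>n. real n powr (- 3 / 2))" by (subst summable_real_powr_iff) auto
  then show "summable (\<lambda>n. fact k * 2 ^ k * real n powr (- 3 / 2))" by (rule summable_mult)
  fix n :: nat assume n: "n \<ge> 1"
  have "ln (real n) ^ k \<le> fact k / (1 / 2) ^ k * exp (1 / 2 * ln (real n))"
    using n by (intro power_le_fact_exp) auto
  also have "exp (1 / 2 * ln (real n)) = real n powr (1 / 2)" using n by (simp add: powr_def)
  finally have "ln (real n) ^ k \<le> fact k * 2 ^ k * real n powr (1 / 2)" by (simp add: field_simps)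
  then have "ln (real n) ^ k / real n ^ 2 \<le> fact k * 2 ^ k * real n powr (1 / 2) / real n ^ 2"
    by (intro divide_right_mono) auto
  also have "\<dots> = fact k * 2 ^ k * (real n powr (1 / 2) / real n powr 2)" by (simp add: powr_numeral)
  also have "real n powr (1 / 2) / real n powr 2 = real n powr (- 3 / 2)"
    by (subst powr_diff[symmetric]) auto
  finally show "norm (ln (real n) ^ k / real n ^ 2) \<le> fact k * 2 ^ k * real n powr (- 3 / 2)"
    using n by simp
qed

lemma zeta2_deriv_LIMSEQ:
  assumes "log_quot_deriv 1 R = monom 1 j"
  shows "(\<lambda>n. (\<Sum>k=1..n. log_quot (log_quot_deriv 1 R) 2 (real k)) - log_quot R 1 (real n)) \<longlonglongrightarrow> zeta2_deriv j"
proof -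
  have "(\<lambda>n. \<Sum>k<Suc n. ln (real k) ^ j / real k ^ 2) \<longlonglongrightarrow> zeta2_deriv j"
    unfolding zeta2_deriv_def by (rule LIMSEQ_Suc[OF summable_LIMSEQ[OF summable_ln_power_div_square]])
  moreover have "(\<Sum>k<Suc n. ln (real k) ^ j / real k ^ 2) = (\<Sum>k=1..n. log_quot (log_quot_deriv 1 R) 2 (real k))" for n
    unfolding assms by (rule sum.mono_neutral_cong_right) (auto simp: log_quot_def poly_monom Suc_le_eq)
  ultimately have "(\<lambda>n. (\<Sum>k=1..n. log_quot (log_quot_deriv 1 R) 2 (real k)) - log_quot R 1 (real n)) \<longlonglongrightarrow> zeta2_deriv j - 0"
    by (intro tendsto_diff log_quot_tendsto_0) auto
  then show ?thesis by simp
qed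

lemmas log_quot_simps = log_quot_def log_quot_deriv_def log_quot_deriv5_def euler_maclaurin_value_def pderiv_pCons

lemma poly_ln_bound_10:
  assumes "u \<ge> real 10"
  shows "0 \<le> ln u" "ln u \<le> (2304 / 10000) * u" "ln u ^ 2 \<le> (55 / 100) * u" "ln u ^ 3 \<le> (13 / 100) * u\<^sup>2"
    "100 \<le> u\<^sup>2" "10 * u \<le> u\<^sup>2" "0 \<le> ln u ^ 3"
proof -
  show "100 \<le> u\<^sup>2" using power_mono[of 10 u 2] assms by simp
  show "10 * u \<le> u\<^sup>2" using assms by (simp add: power2_eq_square)
qed (use ln_power_le_linear[of u] assms in auto)

section \<open>Numerical values of the Stieltjes constants and of the derivatives of zeta at
  2\<close>

text \<open>The pattern of this and the next six lemmas: ten terms are summed, \<open>R\<close> is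
  the antiderivative, and \<open>B\<close> is chosen so that the fourth derivative obeys its bound
  for \<open>u \<ge> 10\<close>. The remainder is \<open>B / 1574640\<close>, because
  \<open>2160 * 9 ^ 3 = 1574640\<close>. Here \<open>R\<close> is the logarithm, and 24 is the
  factorial of 4.\<close>

lemma g0_bounds: "(5772149 / 10000000) \<le> g0" "g0 \<le> (5772181 / 10000000)"
proof -
  define R :: "real poly" where "R = [:0, 1:]"
  have "\<bar>euler_maclaurin_value 0 R 10 - g0\<bar> \<le> (24 / 10) / 2160 / (real 10 - 1) ^ 3"
  proof (rule euler_maclaurin_log_quot)
    show "(\<lambda>n. (\<Sum>k=1..n. log_quot (log_quot_deriv 0 R) (0 + 1) (real k)) - log_quot R 0 (real n)) \<longlonglongrightarrow> g0"
      using stj_LIMSEQ[of 0] by (simp add: R_def log_quot_simps stj_0)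
    fix u :: real assume u: "real 10 \<le> u"
    have p: "poly (log_quot_deriv5 0 R) (ln u) = 24"
      by (simp add: R_def log_quot_simps algebra_simps power2_eq_square power3_eq_cube)
    have "\<bar>24\<bar> \<le> (24 / 10) * u"
      using poly_ln_bound_10[OF u] u[simplified] zero_le_power2[of "ln u"] by linarith
    then show "\<bar>poly (log_quot_deriv5 0 R) (ln u)\<bar> \<le> (24 / 10) * u ^ (0 + 1)"
      unfolding p by (simp add: power2_eq_square)
  qed auto
  then have h: "\<bar>(1 / 1 + 1 / 2 + 1 / 3 + 1 / 4 + 1 / 5 + 1 / 6 + 1 / 7 + 1 / 8 + 1 / 9 + 1 / 10) - ln 10 - 1 / 20 + 1 / 1200 - g0\<bar> \<le> (24 / 10) / 1574640"
    by (simp add: R_def log_quot_simps eval_nat_numeral field_simps)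
  show "(5772149 / 10000000) \<le> g0"
    using abs_le_D1[OF h] ln_bounds(17,18) by linarith
  show "g0 \<le> (5772181 / 10000000)"
    using abs_le_D2[OF h] ln_bounds(17,18) by linarith
qed

lemma stj_1_bounds: "- (72823 / 1000000) \<le> stj 1" "stj 1 \<le> - (72808 / 1000000)"
proof -
  define R :: "real poly" where "R = [:0, 0, 1 / 2:]"
  have "\<bar>euler_maclaurin_value 0 R 10 - stj 1\<bar> \<le> (106 / 10) / 2160 / (real 10 - 1) ^ 3"
  proof (rule euler_maclaurin_log_quot)
    show "(\<lambda>n. (\<Sum>k=1..n. log_quot (log_quot_deriv 0 R) (0 + 1) (real k)) - log_quot R 0 (real n)) \<longlonglongrightarrow> stj 1"
      using stj_LIMSEQ[of 1] by (simp add: R_def log_quot_simps eval_nat_numeral)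
    fix u :: real assume u: "real 10 \<le> u"
    have p: "poly (log_quot_deriv5 0 R) (ln u) = 24 * ln u - 50"
      by (simp add: R_def log_quot_simps algebra_simps power2_eq_square power3_eq_cube)
    have "\<bar>24 * ln u - 50\<bar> \<le> (106 / 10) * u"
      using poly_ln_bound_10[OF u] u[simplified] zero_le_power2[of "ln u"] by linarith
    then show "\<bar>poly (log_quot_deriv5 0 R) (ln u)\<bar> \<le> (106 / 10) * u ^ (0 + 1)"
      unfolding p by (simp add: power2_eq_square)
  qed auto
  moreover define S :: real where "S = ln 2 / 2 + ln 3 / 3 + ln 4 / 4 + ln 5 / 5 + ln 6 / 6 + ln 7 / 7 + ln 8 / 8 + ln 9 / 9 + ln 10 / 10"
  ultimately have h: "\<bar>S - ln 10 ^ 2 / 2 - ln 10 / 20 - (1 / 1200 - ln 10 / 1200) - stj 1\<bar> \<le> (106 / 10) / 1574640"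
    by (simp add: R_def S_def log_quot_simps eval_nat_numeral field_simps)
  have lo: "(69314717 / 100000000 / 2 + 109861228 / 100000000 / 3 + 138629436 / 100000000 / 4 + 160943791 / 100000000 / 5 + 179175946 / 100000000 / 6 + 194591014 / 100000000 / 7 + 207944154 / 100000000 / 8 + 219722457 / 100000000 / 9 + 230258509 / 100000000 / 10) \<le> S"
    unfolding S_def by (intro add_mono divide_right_mono ln_bounds) simp_all
  have hi: "S \<le> (69314719 / 100000000 / 2 + 109861229 / 100000000 / 3 + 138629437 / 100000000 / 4 + 160943792 / 100000000 / 5 + 179175948 / 100000000 / 6 + 194591016 / 100000000 / 7 + 207944155 / 100000000 / 8 + 219722458 / 100000000 / 9 + 230258510 / 100000000 / 10)"
    unfolding S_def by (intro add_mono divide_right_mono ln_bounds) simp_all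
  show "- (72823 / 1000000) \<le> stj 1"
    using abs_le_D1[OF h] lo ln_bounds(17,18) ln_power2_bounds(17,18) by linarith
  show "stj 1 \<le> - (72808 / 1000000)"
    using abs_le_D2[OF h] hi ln_bounds(17,18) ln_power2_bounds(17,18) by linarith
qed

lemma stj_2_bounds: "- (9721 / 1000000) \<le> stj 2" "stj 2 \<le> - (9661 / 1000000)"
proof -
  define R :: "real poly" where "R = [:0, 0, 0, 1 / 3:]"
  have "\<bar>euler_maclaurin_value 0 R 10 - stj 2\<bar> \<le> (434 / 10) / 2160 / (real 10 - 1) ^ 3"
  proof (rule euler_maclaurin_log_quot)
    show "(\<lambda>n. (\<Sum>k=1..n. log_quot (log_quot_deriv 0 R) (0 + 1) (real k)) - log_quot R 0 (real n)) \<longlonglongrightarrow> stj 2"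
      using stj_LIMSEQ[of 2] by (simp add: R_def log_quot_simps eval_nat_numeral)
    fix u :: real assume u: "real 10 \<le> u"
    have p: "poly (log_quot_deriv5 0 R) (ln u) = 24 * ln u ^ 2 - 100 * ln u + 70"
      by (simp add: R_def log_quot_simps algebra_simps power2_eq_square power3_eq_cube)
    have "\<bar>24 * ln u ^ 2 - 100 * ln u + 70\<bar> \<le> (434 / 10) * u"
      using poly_ln_bound_10[OF u] u[simplified] zero_le_power2[of "ln u"] by linarith
    then show "\<bar>poly (log_quot_deriv5 0 R) (ln u)\<bar> \<le> (434 / 10) * u ^ (0 + 1)"
      unfolding p by (simp add: power2_eq_square)
  qed auto
  moreover define S :: real where "S = ln 2 ^ 2 / 2 + ln 3 ^ 2 / 3 + ln 4 ^ 2 / 4 + ln 5 ^ 2 / 5 + ln 6 ^ 2 / 6 + ln 7 ^ 2 / 7 + ln 8 ^ 2 / 8 + ln 9 ^ 2 / 9 + ln 10 ^ 2 / 10"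
  ultimately have h: "\<bar>S - ln 10 ^ 3 / 3 - ln 10 ^ 2 / 20 - (2 * ln 10 / 1200 - ln 10 ^ 2 / 1200) - stj 2\<bar> \<le> (434 / 10) / 1574640"
    by (simp add: R_def S_def log_quot_simps eval_nat_numeral field_simps)
  have lo: "(48045299 / 100000000 / 2 + 120694894 / 100000000 / 3 + 192181205 / 100000000 / 4 + 259029038 / 100000000 / 5 + 321040196 / 100000000 / 6 + 378656627 / 100000000 / 7 + 432407711 / 100000000 / 8 + 482779581 / 100000000 / 9 + 530189809 / 100000000 / 10) \<le> S"
    unfolding S_def by (intro add_mono divide_right_mono ln_power2_bounds) simp_all
  have hi: "S \<le> (48045303 / 100000000 / 2 + 120694897 / 100000000 / 3 + 192181209 / 100000000 / 4 + 259029042 / 100000000 / 5 + 321040204 / 100000000 / 6 + 378656636 / 100000000 / 7 + 432407716 / 100000000 / 8 + 482779586 / 100000000 / 9 + 530189815 / 100000000 / 10)"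
    unfolding S_def by (intro add_mono divide_right_mono ln_power2_bounds) simp_all
  show "- (9721 / 1000000) \<le> stj 2"
    using abs_le_D1[OF h] lo ln_bounds(17,18) ln_power2_bounds(17,18) ln_power3_bounds(17,18) by linarith
  show "stj 2 \<le> - (9661 / 1000000)"
    using abs_le_D2[OF h] hi ln_bounds(17,18) ln_power2_bounds(17,18) ln_power3_bounds(17,18) by linarith
qed

text \<open>\<open>R\<close> stands for \<open>- 1 / u\<close>, an antiderivative of
  \<open>1 / u\<^sup>2\<close>. The polynomials \<open>R\<close> of the next three lemmas arise from
  it by repeated integration by parts, such as \<open>- (ln u + 1) / u\<close> for
  \<open>ln u / u\<^sup>2\<close>.\<close>

lemma zeta2_deriv_0_bounds: "(1644933 / 1000000) \<le> zeta2_deriv 0" "zeta2_deriv 0 \<le> (1644936 / 1000000)"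
proof -
  define R :: "real poly" where "R = [:- 1:]"
  have "\<bar>euler_maclaurin_value 1 R 10 - zeta2_deriv 0\<bar> \<le> (12 / 10) / 2160 / (real 10 - 1) ^ 3"
  proof (rule euler_maclaurin_log_quot)
    show "(\<lambda>n. (\<Sum>k=1..n. log_quot (log_quot_deriv 1 R) (1 + 1) (real k)) - log_quot R 1 (real n)) \<longlonglongrightarrow> zeta2_deriv 0"
      using zeta2_deriv_LIMSEQ[of R 0] by (simp add: R_def log_quot_simps monom_altdef eval_nat_numeral)
    fix u :: real assume u: "real 10 \<le> u"
    have p: "poly (log_quot_deriv5 1 R) (ln u) = 120"
      by (simp add: R_def log_quot_simps algebra_simps power2_eq_square power3_eq_cube)
    have "\<bar>120\<bar> \<le> (12 / 10) * u\<^sup>2"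
      using poly_ln_bound_10[OF u] u[simplified] zero_le_power2[of "ln u"] by linarith
    then show "\<bar>poly (log_quot_deriv5 1 R) (ln u)\<bar> \<le> (12 / 10) * u ^ (1 + 1)"
      unfolding p by (simp add: power2_eq_square)
  qed auto
  then have h: "\<bar>(1 / 1 + 1 / 4 + 1 / 9 + 1 / 16 + 1 / 25 + 1 / 36 + 1 / 49 + 1 / 64 + 1 / 81 + 1 / 100) + 1 / 10 - 1 / 200 + 2 / 12000 - zeta2_deriv 0\<bar> \<le> (12 / 10) / 1574640"
    by (simp add: R_def log_quot_simps eval_nat_numeral field_simps)
  show "(1644933 / 1000000) \<le> zeta2_deriv 0"
    using abs_le_D1[OF h]  by linarith
  show "zeta2_deriv 0 \<le> (1644936 / 1000000)"
    using abs_le_D2[OF h]  by linarith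
qed

lemma zeta2_deriv_1_bounds: "(937544 / 1000000) \<le> zeta2_deriv 1" "zeta2_deriv 1 \<le> (937553 / 1000000)"
proof -
  define R :: "real poly" where "R = [:- 1, - 1:]"
  have "\<bar>euler_maclaurin_value 1 R 10 - zeta2_deriv 1\<bar> \<le> (44 / 10) / 2160 / (real 10 - 1) ^ 3"
  proof (rule euler_maclaurin_log_quot)
    show "(\<lambda>n. (\<Sum>k=1..n. log_quot (log_quot_deriv 1 R) (1 + 1) (real k)) - log_quot R 1 (real n)) \<longlonglongrightarrow> zeta2_deriv 1"
      using zeta2_deriv_LIMSEQ[of R 1] by (simp add: R_def log_quot_simps monom_altdef eval_nat_numeral)
    fix u :: real assume u: "real 10 \<le> u"
    have p: "poly (log_quot_deriv5 1 R) (ln u) = 120 * ln u - 154"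
      by (simp add: R_def log_quot_simps algebra_simps power2_eq_square power3_eq_cube)
    have "\<bar>120 * ln u - 154\<bar> \<le> (44 / 10) * u\<^sup>2"
      using poly_ln_bound_10[OF u] u[simplified] zero_le_power2[of "ln u"] by linarith
    then show "\<bar>poly (log_quot_deriv5 1 R) (ln u)\<bar> \<le> (44 / 10) * u ^ (1 + 1)"
      unfolding p by (simp add: power2_eq_square)
  qed auto
  moreover define S :: real where "S = ln 2 / 4 + ln 3 / 9 + ln 4 / 16 + ln 5 / 25 + ln 6 / 36 + ln 7 / 49 + ln 8 / 64 + ln 9 / 81 + ln 10 / 100"
  ultimately have h: "\<bar>S + (ln 10 / 10 + 1 / 10) - ln 10 / 200 - (1 / 12000 - 2 * ln 10 / 12000) - zeta2_deriv 1\<bar> \<le> (44 / 10) / 1574640"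
    by (simp add: R_def S_def log_quot_simps eval_nat_numeral field_simps)
  have lo: "(69314717 / 100000000 / 4 + 109861228 / 100000000 / 9 + 138629436 / 100000000 / 16 + 160943791 / 100000000 / 25 + 179175946 / 100000000 / 36 + 194591014 / 100000000 / 49 + 207944154 / 100000000 / 64 + 219722457 / 100000000 / 81 + 230258509 / 100000000 / 100) \<le> S"
    unfolding S_def by (intro add_mono divide_right_mono ln_bounds) simp_all
  have hi: "S \<le> (69314719 / 100000000 / 4 + 109861229 / 100000000 / 9 + 138629437 / 100000000 / 16 + 160943792 / 100000000 / 25 + 179175948 / 100000000 / 36 + 194591016 / 100000000 / 49 + 207944155 / 100000000 / 64 + 219722458 / 100000000 / 81 + 230258510 / 100000000 / 100)"
    unfolding S_def by (intro add_mono divide_right_mono ln_bounds) simp_all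
  show "(937544 / 1000000) \<le> zeta2_deriv 1"
    using abs_le_D1[OF h] lo ln_bounds(17,18) by linarith
  show "zeta2_deriv 1 \<le> (937553 / 1000000)"
    using abs_le_D2[OF h] hi ln_bounds(17,18) by linarith
qed

lemma zeta2_deriv_2_bounds: "(1989270 / 1000000) \<le> zeta2_deriv 2" "zeta2_deriv 2 \<le> (1989291 / 1000000)"
proof -
  define R :: "real poly" where "R = [:- 2, - 2, - 1:]"
  have "\<bar>euler_maclaurin_value 1 R 10 - zeta2_deriv 2\<bar> \<le> (152 / 10) / 2160 / (real 10 - 1) ^ 3"
  proof (rule euler_maclaurin_log_quot)
    show "(\<lambda>n. (\<Sum>k=1..n. log_quot (log_quot_deriv 1 R) (1 + 1) (real k)) - log_quot R 1 (real n)) \<longlonglongrightarrow> zeta2_deriv 2"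
      using zeta2_deriv_LIMSEQ[of R 2] by (simp add: R_def log_quot_simps monom_altdef eval_nat_numeral)
    fix u :: real assume u: "real 10 \<le> u"
    have p: "poly (log_quot_deriv5 1 R) (ln u) = 120 * ln u ^ 2 - 308 * ln u + 142"
      by (simp add: R_def log_quot_simps algebra_simps power2_eq_square power3_eq_cube)
    have "\<bar>120 * ln u ^ 2 - 308 * ln u + 142\<bar> \<le> (152 / 10) * u\<^sup>2"
      using poly_ln_bound_10[OF u] u[simplified] zero_le_power2[of "ln u"] by linarith
    then show "\<bar>poly (log_quot_deriv5 1 R) (ln u)\<bar> \<le> (152 / 10) * u ^ (1 + 1)"
      unfolding p by (simp add: power2_eq_square)
  qed auto
  moreover define S :: real where "S = ln 2 ^ 2 / 4 + ln 3 ^ 2 / 9 + ln 4 ^ 2 / 16 + ln 5 ^ 2 / 25 + ln 6 ^ 2 / 36 + ln 7 ^ 2 / 49 + ln 8 ^ 2 / 64 + ln 9 ^ 2 / 81 + ln 10 ^ 2 / 100"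
  ultimately have "\<bar>S + (ln 10 ^ 2 + 2 * ln 10 + 2) / 10 - ln 10 ^ 2 / 100 / 2 - (2 * ln 10 - 2 * ln 10 ^ 2) / 1000 / 12 - zeta2_deriv 2\<bar> \<le> (152 / 10) / 1574640"
    by (simp add: R_def S_def log_quot_simps eval_nat_numeral field_simps)
  then have h: "\<bar>S + (ln 10 ^ 2 / 10 + 2 * ln 10 / 10 + 2 / 10) - ln 10 ^ 2 / 200 - (ln 10 / 6000 - ln 10 ^ 2 / 6000) - zeta2_deriv 2\<bar> \<le> (152 / 10) / 1574640"
    by (simp add: add_divide_distrib diff_divide_distrib)
  have lo: "(48045299 / 100000000 / 4 + 120694894 / 100000000 / 9 + 192181205 / 100000000 / 16 + 259029038 / 100000000 / 25 + 321040196 / 100000000 / 36 + 378656627 / 100000000 / 49 + 432407711 / 100000000 / 64 + 482779581 / 100000000 / 81 + 530189809 / 100000000 / 100) \<le> S"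
    unfolding S_def by (intro add_mono divide_right_mono ln_power2_bounds) simp_all
  have hi: "S \<le> (48045303 / 100000000 / 4 + 120694897 / 100000000 / 9 + 192181209 / 100000000 / 16 + 259029042 / 100000000 / 25 + 321040204 / 100000000 / 36 + 378656636 / 100000000 / 49 + 432407716 / 100000000 / 64 + 482779586 / 100000000 / 81 + 530189815 / 100000000 / 100)"
    unfolding S_def by (intro add_mono divide_right_mono ln_power2_bounds) simp_all
  show "(1989270 / 1000000) \<le> zeta2_deriv 2"
    using abs_le_D1[OF h] lo ln_bounds(17,18) ln_power2_bounds(17,18) by linarith
  show "zeta2_deriv 2 \<le> (1989291 / 1000000)"
    using abs_le_D2[OF h] hi ln_bounds(17,18) ln_power2_bounds(17,18) by linarith
qed

lemma zeta2_deriv_3_bounds: "(6000112 / 1000000) \<le> zeta2_deriv 3" "zeta2_deriv 3 \<le> (6000180 / 1000000)"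
proof -
  define R :: "real poly" where "R = [:- 6, - 6, - 3, - 1:]"
  have "\<bar>euler_maclaurin_value 1 R 10 - zeta2_deriv 3\<bar> \<le> (518 / 10) / 2160 / (real 10 - 1) ^ 3"
  proof (rule euler_maclaurin_log_quot)
    show "(\<lambda>n. (\<Sum>k=1..n. log_quot (log_quot_deriv 1 R) (1 + 1) (real k)) - log_quot R 1 (real n)) \<longlonglongrightarrow> zeta2_deriv 3"
      using zeta2_deriv_LIMSEQ[of R 3] by (simp add: R_def log_quot_simps monom_altdef eval_nat_numeral)
    fix u :: real assume u: "real 10 \<le> u"
    have p: "poly (log_quot_deriv5 1 R) (ln u) = 120 * ln u ^ 3 - 462 * ln u ^ 2 + 426 * ln u - 84"
      by (simp add: R_def log_quot_simps algebra_simps power2_eq_square power3_eq_cube)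
    have "\<bar>120 * ln u ^ 3 - 462 * ln u ^ 2 + 426 * ln u - 84\<bar> \<le> (518 / 10) * u\<^sup>2"
      using poly_ln_bound_10[OF u] u[simplified] zero_le_power2[of "ln u"] by linarith
    then show "\<bar>poly (log_quot_deriv5 1 R) (ln u)\<bar> \<le> (518 / 10) * u ^ (1 + 1)"
      unfolding p by (simp add: power2_eq_square)
  qed auto
  moreover define S :: real where "S = ln 2 ^ 3 / 4 + ln 3 ^ 3 / 9 + ln 4 ^ 3 / 16 + ln 5 ^ 3 / 25 + ln 6 ^ 3 / 36 + ln 7 ^ 3 / 49 + ln 8 ^ 3 / 64 + ln 9 ^ 3 / 81 + ln 10 ^ 3 / 100"
  ultimately have h: "\<bar>S + (ln 10 ^ 3 / 10 + 3 * ln 10 ^ 2 / 10 + 6 * ln 10 / 10 + 6 / 10) - ln 10 ^ 3 / 200 - (3 * ln 10 ^ 2 / 12000 - 2 * ln 10 ^ 3 / 12000) - zeta2_deriv 3\<bar> \<le> (518 / 10) / 1574640"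
    by (simp add: R_def S_def log_quot_simps eval_nat_numeral field_simps)
  have lo: "(33302463 / 100000000 / 4 + 132596892 / 100000000 / 9 + 266419720 / 100000000 / 16 + 416891154 / 100000000 / 25 + 575226808 / 100000000 / 36 + 736831770 / 100000000 / 49 + 899166558 / 100000000 / 64 + 1060775157 / 100000000 / 81 + 1220807150 / 100000000 / 100) \<le> S"
    unfolding S_def by (intro add_mono divide_right_mono ln_power3_bounds) simp_all
  have hi: "S \<le> (33302467 / 100000000 / 4 + 132596897 / 100000000 / 9 + 266419727 / 100000000 / 16 + 416891163 / 100000000 / 25 + 575226828 / 100000000 / 36 + 736831794 / 100000000 / 49 + 899166572 / 100000000 / 64 + 1060775172 / 100000000 / 81 + 1220807167 / 100000000 / 100)"
    unfolding S_def by (intro add_mono divide_right_mono ln_power3_bounds) simp_all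
  show "(6000112 / 1000000) \<le> zeta2_deriv 3"
    using abs_le_D1[OF h] lo ln_bounds(17,18) ln_power2_bounds(17,18) ln_power3_bounds(17,18) by linarith
  show "zeta2_deriv 3 \<le> (6000180 / 1000000)"
    using abs_le_D2[OF h] hi ln_bounds(17,18) ln_power2_bounds(17,18) ln_power3_bounds(17,18) by linarith
qed

section \<open>Moebius inversion\<close>

definition mu :: "nat \<Rightarrow> real" where
  "mu n = (if squarefree n then (-1) ^ card (prime_factors n) else 0)"

lemma mu_0 [simp]: "mu 0 = 0"
  by (simp add: mu_def)

lemma mu_1 [simp]: "mu 1 = 1" "mu (Suc 0) = 1"
  by (simp_all add: mu_def)

lemma abs_mu_le: "\<bar>mu n\<bar> \<le> 1"
  by (simp add: mu_def)

lemma mu_prime_times: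
  assumes "prime p" "\<not> p dvd d" "d > 0"
  shows "mu (p * d) = - mu d"
proof -
  have cop: "coprime p d" using assms by (simp add: prime_imp_coprime)
  have "squarefree (p * d) \<longleftrightarrow> squarefree d"
    using squarefree_mult_coprime[OF cop] squarefree_prime[of p] squarefree_mono[of d "p * d"] assms by auto
  moreover have "prime_factors (p * d) = insert p (prime_factors d)"
    using assms by (subst prime_factors_product) (auto simp: prime_prime_factors)
  moreover have "p \<notin> prime_factors d" using assms by auto
  ultimately show ?thesis by (simp add: mu_def)
qed

text \<open>For a prime \<open>p\<close> dividing \<open>n\<close>, a divisor \<open>d\<close> prime
  to \<open>p\<close> with \<open>p * d\<close> as its partner contributes 0, since
  \<open>mu\<close> changes sign. The divisors left over are multiples of \<open>p\<^sup>2\<close>,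
  where \<open>mu\<close> is 0.\<close>

lemma sum_mu_divisors:
  assumes "n > 0"
  shows "(\<Sum>d | d dvd n. mu d) = (if n = 1 then 1 else 0)"
proof (cases "n = 1")
  case False
  obtain p where p: "prime p" "p dvd n" using prime_factor_nat[OF False] by blast
  have fin: "finite {d. d dvd n}" using assms by (rule finite_divisors_nat)
  define D1 D2 where "D1 = {d. d dvd n \<and> \<not> p dvd d}" and "D2 = {d. d dvd n \<and> p dvd d}"
  have fin12: "finite D1" "finite D2" using fin by (auto simp: D1_def D2_def intro: finite_subset)
  have "(\<Sum>d\<in>D2. mu d) = (\<Sum>d\<in>(*) p ` D1. mu d)"
  proof (rule sum.mono_neutral_right)
    show "(*) p ` D1 \<subseteq> D2"
      using p prime_imp_coprime[OF p(1)] by (auto simp: D1_def D2_def intro: divides_mult)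
    show "\<forall>d\<in>D2 - (*) p ` D1. mu d = 0"
    proof
      fix d assume d: "d \<in> D2 - (*) p ` D1"
      then obtain e where e: "d = p * e" "d dvd n" by (auto simp: D2_def)
      then have "e dvd n" by (metis dvd_mult_right)
      then have "p dvd e" using d e by (auto simp: D1_def)
      then have "p\<^sup>2 dvd d" using e by (simp add: power2_eq_square)
      then have "\<not> squarefree d" using p by (metis not_prime_unit squarefree_def)
      then show "mu d = 0" by (simp add: mu_def)
    qed
  qed (rule fin12)
  also have "\<dots> = (\<Sum>d\<in>D1. mu (p * d))"
    using p by (subst sum.reindex) (auto simp: inj_on_def prime_gt_0_nat)
  also have "\<dots> = - (\<Sum>d\<in>D1. mu d)"
    unfolding sum_negf[symmetric] using p assms
    by (intro sum.cong refl mu_prime_times) (auto simp: D1_def intro: gr0I)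
  finally have "(\<Sum>d\<in>D1. mu d) + (\<Sum>d\<in>D2. mu d) = 0" by simp
  moreover have "(\<Sum>d\<in>D1 \<union> D2. mu d) = (\<Sum>d\<in>D1. mu d) + (\<Sum>d\<in>D2. mu d)"
    using fin12 by (intro sum.union_disjoint) (auto simp: D1_def D2_def)
  moreover have "D1 \<union> D2 = {d. d dvd n}" by (auto simp: D1_def D2_def)
  ultimately show ?thesis using False by simp
qed simp

text \<open>After inserting \<open>divisor_pairs_sum_eq\<close>, the argument
  \<open>x / (m * t)\<^sup>2\<close> depends only on \<open>n = m * t\<close>; the sum of
  \<open>mu\<close> over the divisors of \<open>n\<close> factors out and leaves
  \<open>n = 1\<close>.\<close>

lemma divisor_square_sum_inversion:
  assumes "x \<ge> 1"
  shows "divisor_square_sum x = (\<Sum>m\<in>nle (sqrt x). mu m * divisor_pairs_sum (x / (real m)\<^sup>2))"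
proof -
  have "(\<Sum>m\<in>nle (sqrt x). mu m * divisor_pairs_sum (x / (real m)\<^sup>2))
      = (\<Sum>m\<in>nle (sqrt x). \<Sum>t\<in>nle (sqrt x / real m). mu m * divisor_square_sum (x / (real (m * t))\<^sup>2))"
  proof (rule sum.cong[OF refl])
    fix m assume m: "m \<in> nle (sqrt x)"
    have "sqrt (x / (real m)\<^sup>2) = sqrt x / real m" by (simp add: real_sqrt_divide)
    then have "divisor_pairs_sum (x / (real m)\<^sup>2)
        = (\<Sum>t\<in>nle (sqrt x / real m). divisor_square_sum (x / (real (m * t))\<^sup>2))"
      using divisor_pairs_sum_eq[of "x / (real m)\<^sup>2"] assms by (simp add: power_mult_distrib)
    then show "mu m * divisor_pairs_sum (x / (real m)\<^sup>2)
        = (\<Sum>t\<in>nle (sqrt x / real m). mu m * divisor_square_sum (x / (real (m * t))\<^sup>2))"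
      by (simp only: sum_distrib_left)
  qed
  also have "\<dots> = (\<Sum>n\<in>nle (sqrt x). \<Sum>a | a dvd n. mu a * divisor_square_sum (x / (real (a * (n div a)))\<^sup>2))"
    by (rule sum_divisors_lattice[symmetric])
  also have "\<dots> = (\<Sum>n\<in>nle (sqrt x). divisor_square_sum (x / (real n)\<^sup>2) * (\<Sum>a | a dvd n. mu a))"
    by (intro sum.cong refl) (simp add: sum_distrib_right mult.commute)
  also have "\<dots> = (\<Sum>n\<in>nle (sqrt x). if n = 1 then divisor_square_sum (x / (real n)\<^sup>2) else 0)"
    by (intro sum.cong refl) (auto simp: sum_mu_divisors mem_nle)
  also have "\<dots> = divisor_square_sum x"
    using assms by (subst sum.delta) (auto simp: mem_nle)
  finally show ?thesis ..
qed

section \<open>The estimate for the sum of squares\<close>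

lemma mult_bounds:
  fixes a b :: real
  assumes "al \<le> a" "a \<le> au" "bl \<le> b" "b \<le> bu" "0 \<le> al" "0 \<le> bl"
  shows "al * bl \<le> a * b" "a * b \<le> au * bu"
  using assms by (auto intro!: mult_mono)

lemma g0_power_bounds:
  "0.3331770 \<le> g0\<^sup>2" "g0\<^sup>2 \<le> 0.3331808" "0.1923147 \<le> g0 ^ 3" "g0 ^ 3 \<le> 0.1923180"
proof -
  note b = g0_bounds
  have 2: "0.5772149 * 0.5772149 \<le> g0\<^sup>2" "g0\<^sup>2 \<le> 0.5772181 * 0.5772181"
    using mult_bounds[OF b b] by (simp_all add: power2_eq_square)
  then show s: "0.3331770 \<le> g0\<^sup>2" "g0\<^sup>2 \<le> 0.3331808" by simp_all
  have "0.3331770 * 0.5772149 \<le> g0 ^ 3" "g0 ^ 3 \<le> 0.3331808 * 0.5772181"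
    using mult_bounds[OF s b] by (simp_all add: power2_eq_square power3_eq_cube)
  then show "0.1923147 \<le> g0 ^ 3" "g0 ^ 3 \<le> 0.1923180" by simp_all
qed

text \<open>\<open>mult_bounds\<close> needs nonnegative factors and \<open>stj 1\<close> is
  negative, so \<open>- stj 1\<close> takes its place.\<close>

lemma g0_stj_1_bounds: "- 0.0420349 \<le> g0 * stj 1" "g0 * stj 1 \<le> - 0.0420258"
  using mult_bounds[of "0.5772149" g0 "0.5772181" "0.072808" "- stj 1" "0.072823"] g0_bounds stj_1_bounds
  by simp_all

lemma c_bounds:
  "0.6544298 \<le> c2" "c2 \<le> 0.6544362" "0.9814216 \<le> c3" "c3 \<le> 0.9815172" "0.27259 \<le> c4" "c4 \<le> 0.27297"
  unfolding c2_def c3_def c4_def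
  using g0_bounds stj_1_bounds stj_2_bounds g0_power_bounds g0_stj_1_bounds by simp_all

text \<open>The terms of the completed series with \<open>m > sqrt x\<close> evaluate
  \<open>P4\<close> at \<open>- 2 * v\<close>, where \<open>v = ln (m / sqrt x)\<close>. The factor
  \<open>exp (v / 2)\<close> is the root of \<open>m / sqrt x\<close>; against
  \<open>1 / m\<^sup>2\<close> it leaves the exponent -3/2, so the tail converges and has size
  \<open>O(sqrt x)\<close>.\<close>

lemma abs_P4_neg_le:
  assumes "v \<ge> 0"
  shows "\<bar>P4 (- 2 * v)\<bar> \<le> 20 * exp (v / 2)"
proof -
  define y where "y = v / 2"
  have y: "y \<ge> 0" using assms by (simp add: y_def)
  have P: "P4 (- 2 * v) = 16 * (c2 * y\<^sup>2) - 32 / 3 * y ^ 3 - 4 * (c3 * y) + c4"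
    by (simp add: P4_def y_def power2_eq_square power3_eq_cube field_simps)
  have c: "65 / 100 * y\<^sup>2 \<le> c2 * y\<^sup>2" "c2 * y\<^sup>2 \<le> 66 / 100 * y\<^sup>2" "97 / 100 * y \<le> c3 * y" "c3 * y \<le> 99 / 100 * y"
  proof -
    have "65 / 100 \<le> c2" "c2 \<le> 66 / 100" "97 / 100 \<le> c3" "c3 \<le> 99 / 100" using c_bounds by auto
    then show "65 / 100 * y\<^sup>2 \<le> c2 * y\<^sup>2" "c2 * y\<^sup>2 \<le> 66 / 100 * y\<^sup>2" "97 / 100 * y \<le> c3 * y" "c3 * y \<le> 99 / 100 * y"
      using y by (intro mult_right_mono; simp)+
  qed
  have c4: "26 / 100 \<le> c4" "c4 \<le> 29 / 100" using c_bounds by auto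
  have e: "1 + y + y\<^sup>2 / 2 + y ^ 3 / 6 + y ^ 4 / 24 \<le> exp y"
  proof -
    have "(\<Sum>n<5. inverse (fact n) * y ^ n) \<le> exp y"
      using sum_le_suminf[OF summable_exp[of y], of "{..<5}"] y by (simp add: exp_def)
    then show ?thesis by (simp add: eval_nat_numeral fact_numeral field_simps)
  qed
  have "- (20 * exp y) \<le> P4 (- 2 * v)"
  proof -
    \<comment> \<open>The terms in \<open>y ^ 4\<close> and \<open>y ^ 3\<close> are completed to
      \<open>y\<^sup>2\<close> times a square that vanishes at \<open>22 / 5\<close>; the factor 20
      is large enough to leave only positive coefficients besides it.\<close>
    have "20 * (1 + y + y\<^sup>2 / 2 + y ^ 3 / 6 + y ^ 4 / 24) - (32 / 3 * y ^ 3 - 16 * (65 / 100 * y\<^sup>2) + 4 * (99 / 100 * y) - 26 / 100)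
        = 5 / 6 * y\<^sup>2 * (y - 22 / 5)\<^sup>2 + 64 / 15 * y\<^sup>2 + 401 / 25 * y + 1013 / 50"
      by (simp add: field_simps eval_nat_numeral)
    also have "\<dots> \<ge> 0" using y by (intro add_nonneg_nonneg mult_nonneg_nonneg) auto
    finally have "32 / 3 * y ^ 3 - 16 * (65 / 100 * y\<^sup>2) + 4 * (99 / 100 * y) - 26 / 100
        \<le> 20 * (1 + y + y\<^sup>2 / 2 + y ^ 3 / 6 + y ^ 4 / 24)" by simp
    moreover have "20 * (1 + y + y\<^sup>2 / 2 + y ^ 3 / 6 + y ^ 4 / 24) \<le> 20 * exp y" using e by (rule mult_left_mono) simp
    ultimately show ?thesis unfolding P using c c4 by linarith
  qed
  moreover have "P4 (- 2 * v) \<le> 20 * exp y"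
  proof -
    have "32 / 3 * y ^ 3 - 16 * (66 / 100 * y\<^sup>2) + 4 * (97 / 100 * y)
        = y * (32 / 3 * (y - 99 / 200)\<^sup>2 + 1583 / 1250)"
      by (simp add: field_simps eval_nat_numeral)
    also have "\<dots> \<ge> 0" using y by (intro add_nonneg_nonneg mult_nonneg_nonneg) auto
    finally have "32 / 3 * y ^ 3 - 16 * (66 / 100 * y\<^sup>2) + 4 * (97 / 100 * y) \<ge> 0" .
    moreover have "1 \<le> exp y" using y by simp
    ultimately show ?thesis unfolding P using c c4 by linarith
  qed
  ultimately show ?thesis by (simp add: abs_le_iff y_def)
qed

text \<open>A convex function is at the midpoint at most its mean over the interval, here of unit
  length around \<open>m\<close>. For the roots \<open>a\<close>, \<open>b\<close> of the ends this
  amounts to \<open>a * b \<le> m\<close> and \<open>a + b \<le> 2 * sqrt m\<close>.\<close>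

lemma inverse_mult_sqrt_le:
  assumes "m \<ge> 1"
  shows "1 / (real m * sqrt (real m)) \<le> 2 / sqrt (real m - 1 / 2) - 2 / sqrt (real m + 1 / 2)"
proof -
  define a b where "a = sqrt (real m - 1 / 2)" and "b = sqrt (real m + 1 / 2)"
  have ab: "0 < a" "0 < b" "a\<^sup>2 = real m - 1 / 2" "b\<^sup>2 = real m + 1 / 2" using assms by (auto simp: a_def b_def)
  have "(a * b)\<^sup>2 \<le> (real m)\<^sup>2"
    unfolding power_mult_distrib ab by (simp add: power2_eq_square algebra_simps)
  then have 1: "a * b \<le> real m" by (rule power2_le_imp_le) simp
  have "(a + b)\<^sup>2 \<le> (2 * sqrt (real m))\<^sup>2"
    unfolding power2_sum ab power_mult_distrib using 1 by simp
  then have 2: "a + b \<le> 2 * sqrt (real m)" by (rule power2_le_imp_le) simp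
  have "2 / a - 2 / b = 2 * (b - a) / (a * b)" using ab(1,2) by (simp add: field_simps)
  also have "\<dots> = 2 * ((b - a) * (a + b)) / (a * b * (a + b))" using ab(1,2) by simp
  also have "(b - a) * (a + b) = b\<^sup>2 - a\<^sup>2" by (simp add: power2_eq_square algebra_simps)
  also have "b\<^sup>2 - a\<^sup>2 = 1" using ab by simp
  finally have eq: "2 / a - 2 / b = 2 / (a * b * (a + b))" by simp
  have "1 / (real m * sqrt (real m)) = 2 / (real m * (2 * sqrt (real m)))" by simp
  also have "\<dots> \<le> 2 / (a * b * (a + b))"
    using 1 2 ab(1,2) assms by (intro divide_left_mono mult_mono mult_pos_pos add_pos_pos) auto
  finally show ?thesis unfolding eq[symmetric] by (simp add: a_def b_def)
qed

lemma sum_inverse_mult_sqrt_le: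
  assumes "M \<ge> 1"
  shows "(\<Sum>i=M..M + n. 1 / (real i * sqrt (real i)))
    \<le> 1 / (real M * sqrt (real M)) + 2 / sqrt (real M + 1 / 2) - 2 / sqrt (real (M + n) + 1 / 2)"
proof (induction n)
  case (Suc n)
  have "1 / (real (Suc (M + n)) * sqrt (real (Suc (M + n))))
      \<le> 2 / sqrt (real (Suc (M + n)) - 1 / 2) - 2 / sqrt (real (Suc (M + n)) + 1 / 2)"
    by (rule inverse_mult_sqrt_le) simp
  moreover have "real (Suc (M + n)) - 1 / 2 = real (M + n) + 1 / 2" by simp
  moreover have "(\<Sum>i=M..M + Suc n. 1 / (real i * sqrt (real i)))
      = (\<Sum>i=M..M + n. 1 / (real i * sqrt (real i))) + 1 / (real (Suc (M + n)) * sqrt (real (Suc (M + n))))" by simp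
  ultimately show ?case using Suc by (simp only: add_Suc_right)
qed auto

text \<open>The first term exactly and an integral from 3/2 on give
  \<open>1 + 2 / sqrt (3 / 2)\<close>, about 2.633. The full series is zeta(3/2), about 2.612, so
  little is lost.\<close>

lemma sum_nle_inverse_mult_sqrt_le:
  "(\<Sum>m\<in>nle t. 1 / (real m * sqrt (real m))) \<le> 2.64"
proof (cases "nat \<lfloor>t\<rfloor> \<ge> 1")
  case True
  then obtain n where n: "nat \<lfloor>t\<rfloor> = 1 + n" using le_Suc_ex by blast
  have "(\<Sum>m\<in>nle t. 1 / (real m * sqrt (real m))) = (\<Sum>i=1..1 + n. 1 / (real i * sqrt (real i)))"
    by (simp add: nle_eq n)
  also have "\<dots> \<le> 1 + 2 / sqrt (3 / 2) - 2 / sqrt (real (1 + n) + 1 / 2)"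
    using sum_inverse_mult_sqrt_le[of 1 n] by simp
  also have "\<dots> \<le> 1 + 2 / sqrt (3 / 2)" by simp
  also have "\<dots> \<le> 1 + 2 / (122 / 100)"
    by (intro add_mono divide_left_mono real_le_rsqrt mult_pos_pos) (auto simp: power2_eq_square)
  finally show ?thesis by simp
qed (simp add: nle_eq)

lemma L0_le:
  assumes "t \<ge> 1"
  shows "L0 t \<le> 1 + ln t"
proof -
  define N where "N = nat \<lfloor>t\<rfloor>"
  have N: "N \<ge> 1" "real N \<le> t" "nle t = {1..N}"
    using assms by (auto simp: N_def le_nat_iff nle_eq)
  have "(\<Sum>n=1..N. 1 / real n) \<le> 1 + ln (real N)" using N(1)
  proof (induction N rule: dec_induct)
    case (step n)
    have "ln (real n / real (Suc n)) \<le> real n / real (Suc n) - 1" using step by (intro ln_le_minus_one) auto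
    moreover have "real n / real (Suc n) - 1 = - (1 / real (Suc n))" by (simp add: field_simps)
    moreover have "ln (real n / real (Suc n)) = ln (real n) - ln (real (Suc n))" using step
      by (simp add: ln_div del: of_nat_Suc)
    ultimately show ?case using step by simp
  qed auto
  also have "\<dots> \<le> 1 + ln t" using N by simp
  finally show ?thesis by (simp add: L0_def N)
qed

text \<open>The k-th derivative at 1 of the Dirichlet series of \<open>1 / zeta (2 * s)\<close>,
  differentiated term by term; \<open>deriv_H\<close> shows that it is the derivative of
  \<open>H\<close>.\<close>

definition mu_zeta2 :: "nat \<Rightarrow> real" where
  "mu_zeta2 k = (\<Sum>m. mu m * (- 2 * ln (real m)) ^ k / (real m)\<^sup>2)"

lemma mu_zeta2_sums: "(\<lambda>m. mu m * (- 2 * ln (real m)) ^ k / (real m)\<^sup>2) sums mu_zeta2 k"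
  unfolding mu_zeta2_def
proof (rule summable_sums, rule summable_comparison_test'[where N = 1])
  show "summable (\<lambda>m. 2 ^ k * (ln (real m) ^ k / (real m)\<^sup>2))"
    by (intro summable_mult summable_ln_power_div_square)
  fix m :: nat assume "m \<ge> 1"
  then have "ln (real m) \<ge> 0" by simp
  then have "norm (mu m * (- 2 * ln (real m)) ^ k / (real m)\<^sup>2) = \<bar>mu m\<bar> * (2 ^ k * (ln (real m) ^ k / (real m)\<^sup>2))"
    by (simp add: abs_mult power_abs power_mult_distrib)
  also have "\<dots> \<le> 1 * (2 ^ k * (ln (real m) ^ k / (real m)\<^sup>2))"
    using abs_mu_le[of m] \<open>ln (real m) \<ge> 0\<close> by (intro mult_right_mono) auto
  finally show "norm (mu m * (- 2 * ln (real m)) ^ k / (real m)\<^sup>2) \<le> 2 ^ k * (ln (real m) ^ k / (real m)\<^sup>2)" by simp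
qed

text \<open>The polynomial with coefficients \<open>D1\<close> to \<open>D4\<close>, with
  \<open>mu_zeta2 k\<close> for the derivatives of \<open>H\<close>; see
  \<open>main_eq\<close>.\<close>

definition main :: "real \<Rightarrow> real" where
  "main l = mu_zeta2 0 / 6 * l ^ 3 + (c2 * mu_zeta2 0 + mu_zeta2 1 / 2) * l ^ 2
     + (c3 * mu_zeta2 0 + 2 * c2 * mu_zeta2 1 + mu_zeta2 2 / 2) * l
     + (c4 * mu_zeta2 0 + c3 * mu_zeta2 1 + c2 * mu_zeta2 2 + mu_zeta2 3 / 6)"

text \<open>Taylor expansion of the cubic \<open>P4\<close> at \<open>l\<close> with increment
  \<open>- 2 * ln m\<close>: the k-th power of the increment, weighted by
  \<open>mu m / m\<^sup>2\<close>, sums to \<open>mu_zeta2 k\<close>.\<close>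

lemma main_sums: "(\<lambda>m. mu m * P4 (l - 2 * ln (real m)) / (real m)\<^sup>2) sums main l"
proof -
  define t where "t = (\<lambda>k m. mu m * (- 2 * ln (real m)) ^ k / (real m)\<^sup>2)"
  have "(\<lambda>m. P4 l * t 0 m + (l ^ 2 / 2 + 2 * c2 * l + c3) * t 1 m + (l / 2 + c2) * t 2 m + 1 / 6 * t 3 m)
      sums (P4 l * mu_zeta2 0 + (l ^ 2 / 2 + 2 * c2 * l + c3) * mu_zeta2 1 + (l / 2 + c2) * mu_zeta2 2 + 1 / 6 * mu_zeta2 3)"
    unfolding t_def by (intro sums_add sums_mult mu_zeta2_sums)
  moreover have "P4 l * t 0 m + (l ^ 2 / 2 + 2 * c2 * l + c3) * t 1 m + (l / 2 + c2) * t 2 m + 1 / 6 * t 3 m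
      = mu m * P4 (l - 2 * ln (real m)) / (real m)\<^sup>2" for m
  proof -
    define w r where "w = - 2 * ln (real m)" and "r = mu m / (real m)\<^sup>2"
    have t: "t k m = r * w ^ k" for k by (simp add: t_def w_def r_def)
    have "P4 l + (l ^ 2 / 2 + 2 * c2 * l + c3) * w + (l / 2 + c2) * w ^ 2 + 1 / 6 * w ^ 3 = P4 (l + w)"
      by (simp add: P4_def power2_eq_square power3_eq_cube field_simps)
    then have "r * (P4 l + (l ^ 2 / 2 + 2 * c2 * l + c3) * w + (l / 2 + c2) * w ^ 2 + 1 / 6 * w ^ 3) = r * P4 (l + w)"
      by (rule arg_cong)
    then have "P4 l * t 0 m + (l ^ 2 / 2 + 2 * c2 * l + c3) * t 1 m + (l / 2 + c2) * t 2 m + 1 / 6 * t 3 m = r * P4 (l + w)"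
      unfolding t by (simp add: algebra_simps)
    then show ?thesis by (simp add: r_def w_def)
  qed
  moreover have "P4 l * mu_zeta2 0 + (l ^ 2 / 2 + 2 * c2 * l + c3) * mu_zeta2 1 + (l / 2 + c2) * mu_zeta2 2 + 1 / 6 * mu_zeta2 3
      = main l"
    by (simp add: main_def P4_def algebra_simps)
  ultimately show ?thesis by simp
qed

text \<open>For \<open>m \<le> sqrt x\<close> the estimates at \<open>x / m\<^sup>2\<close> are
  added: 5.28 is twice the bound 2.64, and the harmonic sum gives \<open>1 + ln x / 2\<close>.
  Beyond \<open>sqrt x\<close> only the main series has terms, and its tail costs
  \<open>40 * sqrt x + 20\<close>.\<close>

lemma divisor_square_sum_estimate:
  assumes x: "x \<ge> 1"
  shows "\<bar>divisor_square_sum x - x * main (ln x)\<bar>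
    \<le> 5.28 * x powr (3 / 4) * ln x + 18 * sqrt x * (1 + ln x / 2) + 40 * sqrt x + 20"
proof -
  define z l where "z = sqrt x" and "l = ln x"
  have z: "z \<ge> 1" "z * z = x" "z\<^sup>2 = x" using x by (auto simp: z_def)
  have l: "l \<ge> 0" using x by (simp add: l_def)
  have lz: "ln z = l / 2" using x by (simp add: z_def l_def ln_sqrt)
  define N where "N = nat \<lfloor>z\<rfloor>"
  have N: "nle z = {1..N}" by (simp add: N_def nle_eq)
  have N1: "z < real (Suc N)" using z by (simp add: N_def) linarith
  define q where "q = (\<lambda>m. x * (mu m * P4 (l - 2 * ln (real m)) / (real m)\<^sup>2))"
  have q: "q sums (x * main l)" unfolding q_def by (intro sums_mult main_sums)
  have p34: "x powr (3 / 4) = z * sqrt z"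
  proof -
    have "x powr (3 / 4) = x powr (1 / 2) * x powr (1 / 4)" by (subst powr_add[symmetric]) simp
    also have "x powr (1 / 4) = (x powr (1 / 2)) powr (1 / 2)" by (simp add: powr_powr)
    finally show ?thesis using x z by (simp add: powr_half_sqrt z_def)
  qed
  have head: "\<bar>(\<Sum>m\<in>nle z. mu m * divisor_pairs_sum (x / (real m)\<^sup>2) - q m)\<bar>
      \<le> 5.28 * x powr (3 / 4) * l + 18 * z * (1 + l / 2)"
  proof -
    have "\<bar>(\<Sum>m\<in>nle z. mu m * divisor_pairs_sum (x / (real m)\<^sup>2) - q m)\<bar>
        \<le> (\<Sum>m\<in>nle z. \<bar>mu m * divisor_pairs_sum (x / (real m)\<^sup>2) - q m\<bar>)" by (rule sum_abs)
    also have "\<dots> \<le> (\<Sum>m\<in>nle z. 2 * (z * sqrt z) * l * (1 / (real m * sqrt (real m))) + 18 * z * (1 / real m))"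
    proof (rule sum_mono)
      fix m assume m: "m \<in> nle z"
      then have m1: "real m \<ge> 1" "real m \<le> z" by (auto simp: mem_nle)
      define y where "y = x / (real m)\<^sup>2"
      have "(real m)\<^sup>2 \<le> z\<^sup>2" using m1 by (intro power_mono) auto
      then have y: "y \<ge> 1" using m1 z by (simp add: y_def)
      have ly: "ln y = l - 2 * ln (real m)" using m1 x by (simp add: y_def l_def ln_div ln_realpow)
      have "mu m * divisor_pairs_sum y - q m = mu m * (divisor_pairs_sum y - y * P4 (ln y))"
        unfolding q_def ly[symmetric] by (simp add: y_def algebra_simps)
      then have "\<bar>mu m * divisor_pairs_sum y - q m\<bar> = \<bar>mu m\<bar> * \<bar>divisor_pairs_sum y - y * P4 (ln y)\<bar>"
        by (simp add: abs_mult)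
      also have "\<dots> \<le> 1 * (2 * y powr (3 / 4) * ln y + 18 * sqrt y)"
        using abs_mu_le[of m] divisor_pairs_sum_estimate[OF y] by (intro mult_mono) auto
      also have "sqrt y = z / real m" by (simp add: y_def z_def real_sqrt_divide)
      also have "y powr (3 / 4) = z * sqrt z / (real m * sqrt (real m))"
      proof -
        have "(real m)\<^sup>2 powr (3 / 4) = real m * sqrt (real m)"
        proof -
          have "(real m)\<^sup>2 powr (3 / 4) = (real m powr 2) powr (3 / 4)" by (subst powr_numeral) (use m1 in auto)
          also have "\<dots> = real m powr (3 / 2)" unfolding powr_powr by simp
          also have "\<dots> = real m powr 1 * real m powr (1 / 2)" by (subst powr_add[symmetric]) simp
          also have "\<dots> = real m * sqrt (real m)" using m1 by (simp add: powr_half_sqrt)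
          finally show ?thesis .
        qed
        then show ?thesis unfolding y_def using x by (simp add: powr_divide p34)
      qed
      also have "1 * (2 * (z * sqrt z / (real m * sqrt (real m))) * ln y + 18 * (z / real m))
          \<le> 2 * (z * sqrt z) * l * (1 / (real m * sqrt (real m))) + 18 * z * (1 / real m)"
      proof -
        have "ln y \<le> l" unfolding ly using m1 by simp
        then have "2 * (z * sqrt z / (real m * sqrt (real m))) * ln y \<le> 2 * (z * sqrt z / (real m * sqrt (real m))) * l"
          using z m1 by (intro mult_left_mono) auto
        then show ?thesis by simp
      qed
      finally show "\<bar>mu m * divisor_pairs_sum (x / (real m)\<^sup>2) - q m\<bar>
          \<le> 2 * (z * sqrt z) * l * (1 / (real m * sqrt (real m))) + 18 * z * (1 / real m)"
        by (simp add: y_def)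
    qed
    also have "\<dots> = 2 * (z * sqrt z) * l * (\<Sum>m\<in>nle z. 1 / (real m * sqrt (real m))) + 18 * z * L0 z"
      by (simp only: sum.distrib sum_distrib_left[symmetric] L0_def)
    also have "\<dots> \<le> 2 * (z * sqrt z) * l * 2.64 + 18 * z * (1 + l / 2)"
      using z l L0_le[OF z(1)] sum_nle_inverse_mult_sqrt_le[of z] unfolding lz
      by (intro add_mono mult_left_mono) auto
    finally show ?thesis by (simp add: p34)
  qed
  \<comment> \<open>The majorant of the tail: with \<open>exp (v / 2) = sqrt m / sqrt z\<close>, the
    product of \<open>x / m\<^sup>2\<close> and this factor is
    \<open>z * sqrt z / (m * sqrt m)\<close>.\<close>
  define T where "T = (\<lambda>m. 20 * (z * sqrt z) * (1 / (real m * sqrt (real m))))"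
  have tail_term: "\<bar>q m\<bar> \<le> T m" if m: "real m \<ge> z" for m
  proof -
    define v where "v = ln (real m) - ln z"
    have m0: "real m > 0" using m z by linarith
    have v: "v \<ge> 0" using m z by (simp add: v_def)
    have "exp (v / 2) = sqrt (real m) / sqrt z"
    proof -
      have "exp (v / 2) = exp (ln (sqrt (real m)) - ln (sqrt z))" using m0 z by (simp add: v_def ln_sqrt diff_divide_distrib)
      also have "\<dots> = sqrt (real m) / sqrt z" using m0 z by (simp add: exp_diff)
      finally show ?thesis .
    qed
    moreover have "l - 2 * ln (real m) = - 2 * v" using lz by (simp add: v_def)
    ultimately have "\<bar>P4 (l - 2 * ln (real m))\<bar> \<le> 20 * (sqrt (real m) / sqrt z)"
      using abs_P4_neg_le[OF v] by simp
    moreover have "\<bar>q m\<bar> = x / (real m)\<^sup>2 * (\<bar>mu m\<bar> * \<bar>P4 (l - 2 * ln (real m))\<bar>)"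
      using x by (simp add: q_def abs_mult)
    ultimately have "\<bar>q m\<bar> \<le> x / (real m)\<^sup>2 * (1 * (20 * (sqrt (real m) / sqrt z)))"
      using abs_mu_le[of m] x by (simp only:) (intro mult_left_mono mult_mono, auto)
    also have "\<dots> = T m"
    proof -
      define a b where "a = sqrt (real m)" and "b = sqrt z"
      have ab: "a > 0" "b > 0" "real m = a * a" "z = b * b" using m0 z by (auto simp: a_def b_def)
      have "x = (b * b) * (b * b)" using z(2) ab by simp
      then show ?thesis unfolding T_def a_def[symmetric] b_def[symmetric] ab(3,4)
        using ab(1,2) by (simp add: field_simps power2_eq_square)
    qed
    finally show ?thesis .
  qed
  have Tsum: "(\<Sum>i<n. T (i + Suc N)) \<le> 40 * z + 20" for n
  proof (cases n)
    case (Suc k)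
    have "(\<Sum>i<n. T (i + Suc N)) = (\<Sum>i=Suc N..Suc N + k. T i)"
      unfolding Suc by (rule sum.reindex_bij_witness[of _ "\<lambda>i. i - Suc N" "\<lambda>i. i + Suc N"]) auto
    also have "\<dots> = 20 * (z * sqrt z) * (\<Sum>i=Suc N..Suc N + k. 1 / (real i * sqrt (real i)))"
      unfolding T_def by (simp only: sum_distrib_left)
    also have "\<dots> \<le> 20 * (z * sqrt z) * (1 / (z * sqrt z) + 2 / sqrt z)"
    proof (rule mult_left_mono)
      have "1 / (real (Suc N) * sqrt (real (Suc N))) \<le> 1 / (z * sqrt z)"
        using N1 z by (intro divide_left_mono mult_mono mult_pos_pos) auto
      moreover have "2 / sqrt (real (Suc N) + 1 / 2) \<le> 2 / sqrt z"
        using N1 z by (intro divide_left_mono mult_pos_pos) auto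
      moreover have "0 \<le> 2 / sqrt (real (Suc N + k) + 1 / 2)" by simp
      ultimately show "(\<Sum>i=Suc N..Suc N + k. 1 / (real i * sqrt (real i))) \<le> 1 / (z * sqrt z) + 2 / sqrt z"
        using sum_inverse_mult_sqrt_le[of "Suc N" k] by linarith
    qed (use z in auto)
    also have "\<dots> = 40 * z + 20" using z by (simp add: field_simps)
    finally show ?thesis .
  qed (use z in auto)
  have Tnn: "0 \<le> T m" for m using z by (simp add: T_def)
  have sT: "summable (\<lambda>i. T (i + Suc N))"
    by (rule summableI_nonneg_bounded[OF Tnn Tsum])
  have qT: "norm (q (i + Suc N)) \<le> T (i + Suc N)" for i
  proof -
    have "real (Suc N) \<le> real (i + Suc N)" by simp
    then show ?thesis using tail_term[of "i + Suc N"] N1 by simp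
  qed
  have "\<bar>\<Sum>i. q (i + Suc N)\<bar> \<le> 40 * z + 20"
  proof -
    have s: "summable (\<lambda>i. norm (q (i + Suc N)))"
      by (rule summable_comparison_test'[OF sT, of 0]) (use qT in auto)
    have "\<bar>\<Sum>i. q (i + Suc N)\<bar> \<le> (\<Sum>i. norm (q (i + Suc N)))"
      using summable_norm[OF s] by simp
    also have "\<dots> \<le> (\<Sum>i. T (i + Suc N))" by (rule suminf_le[OF qT s sT])
    also have "\<dots> \<le> 40 * z + 20" by (rule suminf_le_const[OF sT Tsum])
    finally show ?thesis .
  qed
  moreover have "x * main l = (\<Sum>m\<in>nle z. q m) + (\<Sum>i. q (i + Suc N))"
  proof -
    have "x * main l = (\<Sum>i. q (i + Suc N)) + (\<Sum>i<Suc N. q i)"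
      using suminf_split_initial_segment[OF sums_summable[OF q], of "Suc N"] sums_unique[OF q] by simp
    \<comment> \<open>The left side has one more term, \<open>q 0\<close>, which vanishes because
      \<open>mu 0 = 0\<close>.\<close>
    also have "(\<Sum>i<Suc N. q i) = (\<Sum>m\<in>nle z. q m)"
      unfolding N by (rule sum.mono_neutral_right) (auto simp: q_def Suc_le_eq)
    finally show ?thesis by simp
  qed
  moreover have "divisor_square_sum x = (\<Sum>m\<in>nle z. mu m * divisor_pairs_sum (x / (real m)\<^sup>2))"
    using divisor_square_sum_inversion[OF x] by (simp add: z_def)
  ultimately show ?thesis using head unfolding sum_subtractf l_def z_def by linarith
qed

section \<open>The Laurent coefficients of zeta at 1\<close>

lemma has_sum_double:
  fixes F :: "nat \<Rightarrow> nat \<Rightarrow> complex"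
  assumes row: "\<And>n. summable (\<lambda>k. norm (F n k))" and b: "summable (\<lambda>n. \<Sum>k. norm (F n k))"
  shows "\<exists>T. ((\<lambda>(n, k). F n k) has_sum T) (UNIV \<times> UNIV)"
proof -
  have inf: "(\<Sum>\<^sub>\<infinity>k. norm (F n k)) = (\<Sum>k. norm (F n k))" for n
    by (rule infsumI, rule norm_summable_imp_has_sum) (use row in \<open>auto intro: summable_sums\<close>)
  have "(\<lambda>p. norm ((\<lambda>(n, k). F n k) p)) summable_on (UNIV \<times> UNIV)"
  proof (rule Infinite_Sum.abs_summable_on_Sigma_iff[THEN iffD2], intro conjI ballI)
    show "(\<lambda>k. norm ((\<lambda>(n, k). F n k) (n, k))) summable_on UNIV" for n
      by (rule norm_summable_imp_summable_on) (use row in auto)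
    have "\<bar>\<Sum>k. norm (F n k)\<bar> = (\<Sum>k. norm (F n k))" for n
      by (intro abs_of_nonneg suminf_nonneg row) auto
    then show "(\<lambda>n. norm (\<Sum>\<^sub>\<infinity>k. norm ((\<lambda>(n, k). F n k) (n, k)))) summable_on UNIV"
      by (intro norm_summable_imp_summable_on) (use b in \<open>simp add: inf\<close>)
  qed
  then have "(\<lambda>(n, k). F n k) summable_on (UNIV \<times> UNIV)" by (rule Infinite_Sum.abs_summable_summable)
  then show ?thesis by (auto simp: summable_on_def)
qed

text \<open>Fubini for absolutely convergent double series. The unordered sum of the whole family
  carries the exchange, and the rows identify its value as \<open>S\<close>.\<close>

lemma sums_swap:
  fixes F :: "nat \<Rightarrow> nat \<Rightarrow> complex"
  assumes row: "\<And>n. summable (\<lambda>k. norm (F n k))" and b: "summable (\<lambda>n. \<Sum>k. norm (F n k))"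
    and rows: "\<And>n. (\<lambda>k. F n k) sums R n" and cols: "\<And>k. (\<lambda>n. F n k) sums C k" and R: "R sums S"
  shows "C sums S"
proof -
  obtain T where T: "((\<lambda>(n, k). F n k) has_sum T) (UNIV \<times> UNIV)" using has_sum_double[OF row b] by blast
  have "(R has_sum T) UNIV"
    by (rule has_sum_SigmaD[OF T]) (use row rows in \<open>auto intro!: norm_summable_imp_has_sum\<close>)
  then have "T = S" using R by (auto dest: has_sum_imp_sums intro: sums_unique2)
  have col: "summable (\<lambda>n. norm (F n k))" for k
  proof (rule summable_comparison_test'[OF b, of 0])
    show "norm (norm (F n k)) \<le> (\<Sum>k. norm (F n k))" for n
      using sum_le_suminf[OF row, of "{k}" n] by simp
  qed
  have "((\<lambda>(k, n). F n k) has_sum T) (UNIV \<times> UNIV)"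
    using T by (subst has_sum_reindex_bij_witness[of _ prod.swap prod.swap "UNIV \<times> UNIV" "\<lambda>(n, k). F n k"]) auto
  then have "(C has_sum T) UNIV"
    by (rule has_sum_SigmaD) (use col cols in \<open>auto intro!: norm_summable_imp_has_sum\<close>)
  then show ?thesis unfolding \<open>T = S\<close> by (rule has_sum_imp_sums)
qed

lemma of_nat_powr_eq_exp:
  assumes "n > 0"
  shows "of_nat n powr (z :: complex) = exp (z * of_real (ln (real n)))"
  using assms by (simp add: powr_def Ln_of_nat)

lemma exp_series_sums: "(\<lambda>k. z ^ k / fact k) sums exp (z :: complex)"
  using exp_converges[of z] by (simp add: scaleR_conv_of_real field_simps)

lemma zeta_sums:
  assumes "Re s > 1"
  shows "(\<lambda>n. of_nat (Suc n) powr (- s)) sums zeta s"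
  unfolding zeta_def
proof (rule summable_sums, rule summable_comparison_test'[where N = 0])
  have "summable (\<lambda>n. real n powr (- Re s))" using assms by (subst summable_real_powr_iff) auto
  then show "summable (\<lambda>n. real (Suc n) powr (- Re s))" by (subst summable_Suc_iff)
  show "norm (complex_of_nat (Suc n) powr (- s)) \<le> real (Suc n) powr (- Re s)" for n
    by (subst norm_powr_real_powr) auto
qed

text \<open>With \<open>w = s - 1\<close>, the power \<open>- s\<close> of \<open>u\<close> is
  \<open>exp (- w * ln u) / u\<close>. Its value at \<open>n + 1\<close> minus its integral to
  \<open>n + 2\<close>, summed over \<open>n\<close>, is \<open>zeta s - 1 / w\<close>; expanding
  the exponential in powers of \<open>w\<close> produces \<open>stj_term k n\<close>, and the two
  sums are exchanged.\<close>

lemma zeta_laurent_sums: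
  assumes s: "Re s > 1" and r: "norm (s - 1) < 1"
  shows "(\<lambda>k. (- 1) ^ k / fact k * complex_of_real (stj k) * (s - 1) ^ k) sums (zeta s - 1 / (s - 1))"
proof -
  define w r where "w = s - 1" and "r = norm (s - 1)"
  have w: "w \<noteq> 0" "Re w > 0" "norm w = r" using s by (auto simp: w_def r_def)
  have r01: "0 \<le> r" "r < 1" using assms by (auto simp: r_def)
  define l where "l = (\<lambda>n. ln (real n + 1))"
  define F where "F = (\<lambda>n k. (- 1) ^ k / fact k * complex_of_real (stj_term k n) * w ^ k)"
  define R where "R = (\<lambda>n. of_nat (Suc n) powr (- s)
    - (exp (- w * of_real (l n)) - exp (- w * of_real (l (Suc n)))) / w)"
  have normF: "norm (F n k) = r ^ k / fact k * \<bar>stj_term k n\<bar>" for n k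
    by (simp add: F_def norm_mult norm_divide norm_power w)
  \<comment> \<open>The two parts of \<open>abs_stj_term_le\<close>, each an exponential series in
    \<open>k\<close>; in the first one the index is shifted by one.\<close>
  define G where "G = (\<lambda>n k. (if k = 0 then 0 else r * (r * l (Suc n)) ^ (k - 1) / fact (k - 1)) / (real n + 1)\<^sup>2
      + (r * l (Suc n)) ^ k / fact k / (real n + 1)\<^sup>2)"
  have bd: "norm (F n k) \<le> G n k" for n k
  proof -
    have "norm (F n k) \<le> r ^ k / fact k * ((real k * l (Suc n) ^ (k - 1) + l (Suc n) ^ k) / (real n + 1)\<^sup>2)"
      unfolding normF using abs_stj_term_le[of k n] r01
      by (intro mult_left_mono) (auto simp: l_def add.commute)
    also have "\<dots> = (r ^ k / fact k * (real k * l (Suc n) ^ (k - 1)) + r ^ k / fact k * l (Suc n) ^ k) / (real n + 1)\<^sup>2"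
      by (simp add: distrib_left)
    also have "r ^ k / fact k * (real k * l (Suc n) ^ (k - 1)) = (if k = 0 then 0 else r * (r * l (Suc n)) ^ (k - 1) / fact (k - 1))"
      by (cases k) (simp_all add: power_mult_distrib del: of_nat_Suc)
    also have "r ^ k / fact k * l (Suc n) ^ k = (r * l (Suc n)) ^ k / fact k" by (simp add: power_mult_distrib)
    also have "((if k = 0 then 0 else r * (r * l (Suc n)) ^ (k - 1) / fact (k - 1)) + (r * l (Suc n)) ^ k / fact k) / (real n + 1)\<^sup>2 = G n k"
      by (simp only: G_def add_divide_distrib)
    finally show ?thesis .
  qed
  have bs: "G n sums (r * exp (r * l (Suc n)) / (real n + 1)\<^sup>2 + exp (r * l (Suc n)) / (real n + 1)\<^sup>2)" for n
    unfolding G_def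
  proof (intro sums_add sums_divide)
    have e: "(\<lambda>k. (r * l (Suc n)) ^ k / fact k) sums exp (r * l (Suc n))"
      using exp_converges[of "r * l (Suc n)"] by (simp add: field_simps)
    then show "(\<lambda>k. (r * l (Suc n)) ^ k / fact k) sums exp (r * l (Suc n))" .
    have "(\<lambda>k. r * ((r * l (Suc n)) ^ k / fact k)) sums (r * exp (r * l (Suc n)))" by (intro sums_mult e)
    then have "(\<lambda>k. if Suc k = 0 then 0 else r * (r * l (Suc n)) ^ (Suc k - 1) / fact (Suc k - 1)) sums (r * exp (r * l (Suc n)))"
      by simp
    then show "(\<lambda>k. if k = 0 then 0 else r * (r * l (Suc n)) ^ (k - 1) / fact (k - 1)) sums (r * exp (r * l (Suc n)))"
      by (subst (asm) sums_Suc_iff) simp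
  qed
  have row: "summable (\<lambda>k. norm (F n k))" for n
    by (rule summable_comparison_test'[OF sums_summable[OF bs[of n]], of 0]) (simp add: bd)
  have rowle: "(\<Sum>k. norm (F n k)) \<le> r * exp (r * l (Suc n)) / (real n + 1)\<^sup>2 + exp (r * l (Suc n)) / (real n + 1)\<^sup>2" for n
    using suminf_le[OF bd row sums_summable[OF bs[of n]]] unfolding sums_unique[OF bs[of n], symmetric] .
  have b: "summable (\<lambda>n. \<Sum>k. norm (F n k))"
  proof (rule summable_comparison_test'[where N = 0])
    \<comment> \<open>The row sums are of size \<open>n\<close> to the power \<open>r - 2\<close>,
      so this is the place where \<open>r < 1\<close> is needed.\<close>
    have "summable (\<lambda>n. real n powr (r - 2))" using r01 by (subst summable_real_powr_iff) auto
    then have "summable (\<lambda>n. real (Suc n) powr (r - 2))" by (subst summable_Suc_iff)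
    then show "summable (\<lambda>n. 4 * (real (Suc n) powr (r - 2)))" by (rule summable_mult)
    fix n :: nat
    have "exp (r * l (Suc n)) = (real n + 2) powr r" by (simp add: l_def powr_def add.commute)
    also have "\<dots> \<le> (2 * (real n + 1)) powr r" using r01 by (intro powr_mono2) auto
    also have "\<dots> = 2 powr r * (real n + 1) powr r" by (subst powr_mult) auto
    also have "\<dots> \<le> 2 powr 1 * (real n + 1) powr r" using r01 by (intro mult_right_mono powr_mono) auto
    finally have e: "exp (r * l (Suc n)) \<le> 2 * (real n + 1) powr r" by simp
    have "(\<Sum>k. norm (F n k)) \<le> (r + 1) * exp (r * l (Suc n)) / (real n + 1)\<^sup>2"
      using rowle[of n] by (simp add: add_divide_distrib distrib_right)
    also have "\<dots> \<le> 2 * (2 * (real n + 1) powr r) / (real n + 1)\<^sup>2"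
      using r01 e by (intro divide_right_mono mult_mono) auto
    also have "\<dots> = 4 * ((real n + 1) powr r / (real n + 1) powr 2)" by (simp add: powr_numeral)
    also have "(real n + 1) powr r / (real n + 1) powr 2 = real (Suc n) powr (r - 2)"
      by (subst powr_diff[symmetric]) (simp add: add.commute)
    finally have "(\<Sum>k. norm (F n k)) \<le> 4 * (real (Suc n) powr (r - 2))" .
    moreover have "0 \<le> (\<Sum>k. norm (F n k))" by (intro suminf_nonneg row) auto
    ultimately show "norm (\<Sum>k. norm (F n k)) \<le> 4 * (real (Suc n) powr (r - 2))" by simp
  qed
  have rows: "(\<lambda>k. F n k) sums R n" for n
  proof -
    \<comment> \<open>The limit is the integral of \<open>exp (- w * t)\<close> over
      \<open>t\<close> from 0 to \<open>x\<close>.\<close>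
    have shifted: "(\<lambda>k. (- 1) ^ k / fact k * w ^ k * (of_real x ^ Suc k / (of_nat k + 1))) sums ((exp (- w * of_real x) - 1) / (- w))" for x :: real
    proof -
      have "(\<lambda>k. (- w * of_real x) ^ Suc k / fact (Suc k)) sums (exp (- w * of_real x) - 1)"
        using exp_series_sums[of "- w * of_real x"] by (subst sums_Suc_iff) simp
      then have "(\<lambda>k. (- w * of_real x) ^ Suc k / fact (Suc k) / (- w)) sums ((exp (- w * of_real x) - 1) / (- w))"
        by (rule sums_divide)
      moreover have "(- w * of_real x) ^ Suc k / fact (Suc k) / (- w)
          = (- 1) ^ k / fact k * w ^ k * (of_real x ^ Suc k / (of_nat k + 1))" for k
      proof -
        have "(- w * of_real x) ^ Suc k = - w * ((- 1) ^ k * w ^ k * of_real x ^ Suc k)"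
          unfolding power_mult_distrib power_minus[of w] by (simp add: mult_ac)
        then show ?thesis using w(1) by (simp add: fact_Suc add.commute mult_ac)
      qed
      ultimately show ?thesis by simp
    qed
    have "(\<lambda>k. (- w * of_real (l n)) ^ k / fact k / of_nat (Suc n)
          - ((- 1) ^ k / fact k * w ^ k * (of_real (l (Suc n)) ^ Suc k / (of_nat k + 1))
              - (- 1) ^ k / fact k * w ^ k * (of_real (l n) ^ Suc k / (of_nat k + 1))))
        sums (exp (- w * of_real (l n)) / of_nat (Suc n)
          - ((exp (- w * of_real (l (Suc n))) - 1) / (- w) - (exp (- w * of_real (l n)) - 1) / (- w)))"
      by (intro sums_diff sums_divide exp_series_sums shifted)
    also have "(\<lambda>k. (- w * of_real (l n)) ^ k / fact k / of_nat (Suc n)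
          - ((- 1) ^ k / fact k * w ^ k * (of_real (l (Suc n)) ^ Suc k / (of_nat k + 1))
              - (- 1) ^ k / fact k * w ^ k * (of_real (l n) ^ Suc k / (of_nat k + 1)))) = F n"
    proof
      fix k
      define c :: complex where "c = (- 1) ^ k / fact k * w ^ k"
      have "(- w * of_real (l n)) ^ k / fact k = c * of_real (l n) ^ k"
        unfolding c_def power_mult_distrib power_minus[of w] by simp
      moreover have "complex_of_real (stj_term k n) = of_real (l n) ^ k / of_nat (Suc n)
          - (of_real (l (Suc n)) ^ Suc k / (of_nat k + 1) - of_real (l n) ^ Suc k / (of_nat k + 1))"
        by (simp add: stj_term_def l_def add.commute diff_divide_distrib)
      moreover have "F n k = c * complex_of_real (stj_term k n)" by (simp add: F_def c_def)
      ultimately show "(- w * of_real (l n)) ^ k / fact k / of_nat (Suc n)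
          - ((- 1) ^ k / fact k * w ^ k * (of_real (l (Suc n)) ^ Suc k / (of_nat k + 1))
              - (- 1) ^ k / fact k * w ^ k * (of_real (l n) ^ Suc k / (of_nat k + 1))) = F n k"
        unfolding c_def[symmetric] by (simp only: right_diff_distrib times_divide_eq_right)
    qed
    also have "exp (- w * of_real (l n)) / of_nat (Suc n)
          - ((exp (- w * of_real (l (Suc n))) - 1) / (- w) - (exp (- w * of_real (l n)) - 1) / (- w)) = R n"
    proof -
      have "of_nat (Suc n) powr (- s) = exp ((- w - 1) * of_real (l n))"
        by (subst of_nat_powr_eq_exp) (auto simp: w_def l_def add.commute)
      also have "\<dots> = exp (- w * of_real (l n)) / exp (of_real (l n))"
        by (simp add: exp_diff left_diff_distrib)
      also have "exp (of_real (l n)) = complex_of_real (exp (l n))" by (rule exp_of_real)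
      also have "exp (l n) = real (Suc n)" by (simp add: l_def)
      finally have "of_nat (Suc n) powr (- s) = exp (- w * of_real (l n)) / complex_of_nat (Suc n)" by simp
      then show ?thesis using w(1) by (simp add: R_def diff_divide_distrib)
    qed
    finally show ?thesis .
  qed
  \<comment> \<open>The integrals telescope, and \<open>Re w > 0\<close> makes the exponentials tend
    to 0, so the integrals contribute exactly \<open>1 / w\<close>.\<close>
  have "R sums (zeta s - 1 / w)"
  proof -
    have "(\<lambda>n. exp (- w * of_real (l n))) \<longlonglongrightarrow> 0"
    proof (rule tendsto_norm_zero_cancel)
      have "norm (exp (- w * of_real (l n))) = (real n + 1) powr (- Re w)" for n
        by (simp add: norm_exp_eq_Re l_def powr_def)
      moreover have "(\<lambda>n. (real n + 1) powr (- Re w)) \<longlonglongrightarrow> 0"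
        by (rule tendsto_neg_powr) (use w(2) in simp, real_asymp)
      ultimately show "(\<lambda>n. norm (exp (- w * of_real (l n)))) \<longlonglongrightarrow> 0" by simp
    qed
    then have "(\<lambda>n. exp (- w * of_real (l n)) - exp (- w * of_real (l (Suc n)))) sums (exp (- w * of_real (l 0)) - 0)"
      by (rule telescope_sums')
    then have "(\<lambda>n. (exp (- w * of_real (l n)) - exp (- w * of_real (l (Suc n)))) / w) sums (1 / w)"
      by (intro sums_divide) (simp add: l_def)
    then show ?thesis unfolding R_def using zeta_sums[OF s] by (intro sums_diff) auto
  qed
  moreover have "(\<lambda>n. F n k) sums ((- 1) ^ k / fact k * complex_of_real (stj k) * w ^ k)" for k
    unfolding F_def by (intro sums_mult sums_mult2 sums_of_real stj_sums)
  ultimately show ?thesis using sums_swap[OF row b rows] by (simp add: w_def)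
qed

text \<open>The zeros of a nonzero power series are isolated. The criterion used asks for a function
  that vanishes at the centre; the factor \<open>x\<close> in \<open>f\<close> provides this, and
  therefore \<open>b\<close> is the sequence \<open>a\<close> moved up by one place.\<close>

lemma powser_eq_0_near_0:
  fixes a :: "nat \<Rightarrow> complex"
  assumes d: "d > 0" and z: "\<And>x. 0 < x \<Longrightarrow> x < d \<Longrightarrow> (\<lambda>k. a k * complex_of_real x ^ k) sums 0"
  shows "a k = 0"
proof (rule ccontr)
  assume ak: "a k \<noteq> 0"
  define b where "b = (\<lambda>k. case k of 0 \<Rightarrow> 0 | Suc j \<Rightarrow> a j)"
  define f where "f = (\<lambda>x. x * (\<Sum>k. a k * x ^ k))"
  have sm: "(\<lambda>n. b n * (x - 0) ^ n) sums f x" if x: "norm (x - 0) < d / 2" for x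
  proof -
    have "summable (\<lambda>k. a k * complex_of_real (d / 2) ^ k)" using z[of "d / 2"] d by (auto simp: sums_iff)
    then have "summable (\<lambda>k. a k * x ^ k)" by (rule powser_inside) (use x d in simp)
    then have "(\<lambda>k. x * (a k * x ^ k)) sums f x" unfolding f_def by (intro sums_mult summable_sums)
    then have "(\<lambda>k. b (Suc k) * (x - 0) ^ Suc k) sums f x" by (simp add: b_def mult_ac)
    then show ?thesis by (subst (asm) sums_Suc_iff) (simp add: b_def)
  qed
  obtain s where s: "0 < s" "\<And>z. z \<in> cball 0 s - {0} \<Longrightarrow> f z \<noteq> 0"
  proof (rule powser_0_nonzero[of "d / 2" 0 b f "Suc k"])
    show "f 0 = 0" by (simp add: f_def)
  qed (use d sm ak in \<open>auto simp: b_def\<close>)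
  define x where "x = min s d / 2"
  have x: "0 < x" "x < d" "x \<le> s" using s d by (auto simp: x_def)
  have "f (complex_of_real x) \<noteq> 0" using x by (intro s(2)) auto
  moreover have "f (complex_of_real x) = 0" using sums_unique[OF z[OF x(1,2)]] by (simp add: f_def)
  ultimately show False by contradiction
qed

text \<open>Existence is \<open>zeta_laurent_sums\<close>. For uniqueness the ray
  \<open>s = 1 + x\<close> with small real \<open>x > 0\<close> suffices: there the difference of
  two expansions is a power series with sum 0.\<close>

lemma stieltjes_eq_stj: "stieltjes = stj"
  unfolding stieltjes_def
proof (rule the_equality)
  show "\<forall>\<^sub>F s in at 1 within {s. 1 < Re s}.
      (\<lambda>k. (- 1) ^ k / fact k * complex_of_real (stj k) * (s - 1) ^ k) sums (zeta s - 1 / (s - 1))"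
    unfolding eventually_at
  proof (intro exI conjI ballI impI)
    fix s :: complex assume "s \<in> {s. 1 < Re s}" "s \<noteq> 1 \<and> dist s 1 < 1"
    then show "(\<lambda>k. (- 1) ^ k / fact k * complex_of_real (stj k) * (s - 1) ^ k) sums (zeta s - 1 / (s - 1))"
      by (intro zeta_laurent_sums) (auto simp: dist_norm)
  qed simp
next
  fix g :: "nat \<Rightarrow> real"
  assume "\<forall>\<^sub>F s in at 1 within {s. 1 < Re s}.
      (\<lambda>k. (- 1) ^ k / fact k * complex_of_real (g k) * (s - 1) ^ k) sums (zeta s - 1 / (s - 1))"
  then obtain d where d: "d > 0" "\<And>s. 1 < Re s \<Longrightarrow> s \<noteq> 1 \<Longrightarrow> dist s 1 < d \<Longrightarrow>
      (\<lambda>k. (- 1) ^ k / fact k * complex_of_real (g k) * (s - 1) ^ k) sums (zeta s - 1 / (s - 1))"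
    unfolding eventually_at by auto
  have "(- 1) ^ k / fact k * (complex_of_real (g k) - complex_of_real (stj k)) = 0" for k
  proof (rule powser_eq_0_near_0[of "min d 1"])
    fix x :: real assume x: "0 < x" "x < min d 1"
    define s where "s = 1 + complex_of_real x"
    have s: "1 < Re s" "s \<noteq> 1" "dist s 1 < d" "norm (s - 1) < 1" "s - 1 = of_real x"
      using x by (auto simp: s_def dist_norm)
    have "(\<lambda>k. (- 1) ^ k / fact k * complex_of_real (g k) * (s - 1) ^ k
        - (- 1) ^ k / fact k * complex_of_real (stj k) * (s - 1) ^ k) sums
        (zeta s - 1 / (s - 1) - (zeta s - 1 / (s - 1)))"
      by (intro sums_diff d(2) zeta_laurent_sums s)
    then show "(\<lambda>k. (- 1) ^ k / fact k * (complex_of_real (g k) - complex_of_real (stj k)) * complex_of_real x ^ k) sums 0"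
      by (simp add: s(5) algebra_simps diff_divide_distrib)
  qed (use d in auto)
  then have "g k = stj k" for k by (simp flip: of_real_diff)
  then show "g = stj" by auto
qed

section \<open>The derivatives of H at 1\<close>

text \<open>Only a bound for the coefficients matters, so this serves \<open>mu\<close> as well as
  the constant 1. On the ball \<open>Re (2 * s) \<ge> 3 / 2\<close>, which gives uniform
  convergence, and uniform limits of holomorphic functions can be differentiated termwise.\<close>

lemma dirichlet_series_deriv:
  fixes c :: "nat \<Rightarrow> complex"
  assumes c: "\<And>n. norm (c n) \<le> 1"
  defines "f \<equiv> (\<lambda>s. \<Sum>n. c n * of_nat (Suc n) powr (- (2 * s)))"
  shows "f holomorphic_on ball 1 (1 / 4)"
    "(\<lambda>n. c n * of_real ((- 2 * ln (real (Suc n))) ^ k / (real (Suc n))\<^sup>2)) sums (deriv ^^ k) f 1"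
proof -
  define a where "a = (\<lambda>n. - 2 * complex_of_real (ln (real (Suc n))))"
  define g where "g = (\<lambda>N s. \<Sum>n<N. c n * exp (a n * s))"
  have e: "of_nat (Suc n) powr (- (2 * s)) = exp (a n * s)" for n s
    by (subst of_nat_powr_eq_exp) (auto simp: a_def mult_ac)
  have ulim: "uniform_limit (ball 1 (1 / 4)) g f sequentially"
    unfolding g_def f_def e
  proof (rule Weierstrass_m_test)
    have "summable (\<lambda>n. real n powr (- 3 / 2))" by (subst summable_real_powr_iff) auto
    then show "summable (\<lambda>n. real (Suc n) powr (- 3 / 2))" by (subst summable_Suc_iff)
    fix n s assume "s \<in> ball (1::complex) (1 / 4)"
    then have "norm (1 - s) < 1 / 4" by (simp add: dist_norm)
    then have Re: "Re s \<ge> 3 / 4" using complex_Re_le_cmod[of "1 - s"] by simp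
    have "norm (c n * exp (a n * s)) = norm (c n) * norm (of_nat (Suc n) powr (- (2 * s)))"
      unfolding e norm_mult ..
    also have "\<dots> \<le> 1 * real (Suc n) powr (- 3 / 2)"
    proof (intro mult_mono c)
      have "norm (of_nat (Suc n) powr (- (2 * s))) = real (Suc n) powr (- (2 * Re s))"
        by (subst norm_powr_real_powr) auto
      also have "\<dots> \<le> real (Suc n) powr (- 3 / 2)" using Re by (intro powr_mono) auto
      finally show "norm (complex_of_nat (Suc n) powr (- (2 * s))) \<le> real (Suc n) powr (- 3 / 2)" .
    qed auto
    finally show "norm (c n * exp (a n * s)) \<le> real (Suc n) powr (- 3 / 2)" by simp
  qed
  have hol: "g N holomorphic_on ball 1 (1 / 4)" for N
    unfolding g_def by (intro holomorphic_intros)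
  show "f holomorphic_on ball 1 (1 / 4)"
  proof (rule holomorphic_uniform_sequence[OF open_ball hol])
    fix x assume x: "x \<in> ball (1::complex) (1 / 4)"
    obtain d where d: "d > 0" "cball x d \<subseteq> ball 1 (1 / 4)"
      using x open_ball[of "1::complex"] open_contains_cball by blast
    show "\<exists>d>0. cball x d \<subseteq> ball 1 (1 / 4) \<and> uniform_limit (cball x d) g f sequentially"
      using d uniform_limit_on_subset[OF ulim] by blast
  qed
  have "(deriv ^^ k) (g N) = (\<lambda>s. \<Sum>n<N. c n * a n ^ k * exp (a n * s))" for N
  proof (induction k)
    case (Suc k)
    have "deriv (\<lambda>s. \<Sum>n<N. c n * a n ^ k * exp (a n * s)) s = (\<Sum>n<N. c n * a n ^ Suc k * exp (a n * s))" for s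
      by (rule DERIV_imp_deriv) (auto intro!: derivative_eq_intros sum.cong simp: mult_ac)
    then show ?case by (simp add: Suc)
  qed (simp add: g_def)
  moreover have "(\<lambda>N. (deriv ^^ k) (g N) 1) \<longlonglongrightarrow> (deriv ^^ k) f 1"
    by (rule higher_deriv_complex_uniform_limit[OF ulim]) (auto simp: hol)
  moreover have "c n * a n ^ k * exp (a n * 1) = c n * of_real ((- 2 * ln (real (Suc n))) ^ k / (real (Suc n))\<^sup>2)" for n
  proof -
    have "exp (a n * 1) = of_nat (Suc n) powr (- 2)" using e[of n 1] by simp
    also have "\<dots> = 1 / of_nat (Suc n) ^ 2"
      by (simp add: powr_minus divide_inverse powr_numeral del: of_nat_Suc)
    finally show ?thesis by (simp add: a_def del: of_nat_Suc)
  qed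
  ultimately show "(\<lambda>n. c n * of_real ((- 2 * ln (real (Suc n))) ^ k / (real (Suc n))\<^sup>2)) sums (deriv ^^ k) f 1"
    by (simp add: sums_def)
qed

text \<open>Collecting the double series by the product of the two indices leaves the sum of
  \<open>mu\<close> over the divisors of \<open>n\<close> as coefficient. All indices are shifted by
  one, as in the definition of \<open>zeta\<close>.\<close>

lemma mu_zeta_product:
  assumes s: "Re s > 1"
  shows "(\<Sum>n. of_real (mu (Suc n)) * of_nat (Suc n) powr (- s)) * zeta s = 1"
proof -
  define P where "P = (\<lambda>n. complex_of_nat (Suc n) powr (- s))"
  define F where "F = (\<lambda>a b. of_real (mu (Suc a)) * P a * P b)"
  have zs: "P sums zeta s" unfolding P_def by (rule zeta_sums[OF s])
  have nP: "summable (\<lambda>n. norm (P n))"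
  proof -
    have "summable (\<lambda>n. real n powr (- Re s))" using s by (subst summable_real_powr_iff) auto
    then have "summable (\<lambda>n. real (Suc n) powr (- Re s))" by (subst summable_Suc_iff)
    moreover have "norm (P n) = real (Suc n) powr (- Re s)" for n
      unfolding P_def by (subst norm_powr_real_powr) auto
    ultimately show ?thesis by simp
  qed
  have nM: "summable (\<lambda>n. norm (of_real (mu (Suc n)) * P n))"
    by (rule summable_comparison_test'[OF nP, of 0])
       (simp add: norm_mult mult_left_le_one_le abs_mu_le)
  have M: "(\<lambda>n. of_real (mu (Suc n)) * P n) sums (\<Sum>n. of_real (mu (Suc n)) * P n)"
    by (rule summable_sums[OF summable_norm_cancel[OF nM]])
  have row: "summable (\<lambda>b. norm (F a b))" for a
    unfolding F_def norm_mult[of _ "P _"] by (intro summable_mult nP)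
  have "(\<Sum>b. norm (F a b)) = norm (of_real (mu (Suc a)) * P a) * (\<Sum>b. norm (P b))" for a
    unfolding F_def norm_mult[of _ "P _"] by (rule suminf_mult[OF nP])
  then have b: "summable (\<lambda>a. \<Sum>b. norm (F a b))"
    by (simp only:) (intro summable_mult2 nM)
  obtain T where T: "((\<lambda>(a, b). F a b) has_sum T) (UNIV \<times> UNIV)" using has_sum_double[OF row b] by blast
  have "((\<lambda>a. of_real (mu (Suc a)) * P a * zeta s) has_sum T) UNIV"
    by (rule has_sum_SigmaD[OF T])
       (use row zs in \<open>auto simp: F_def intro!: norm_summable_imp_has_sum sums_mult\<close>)
  then have 1: "T = (\<Sum>n. of_real (mu (Suc n)) * P n) * zeta s"
    using sums_mult2[OF M, of "zeta s"] by (auto dest: has_sum_imp_sums intro: sums_unique2)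
  have "((\<lambda>(n, a). of_real (mu a) * of_nat n powr (- s)) has_sum T) (SIGMA n:{1..}. {a. a dvd n})"
  proof (subst has_sum_reindex_bij_witness[of _ "\<lambda>(a, b). (Suc a * Suc b, Suc a)" "\<lambda>(n, a). (a - 1, n div a - 1)"
        "UNIV \<times> UNIV" "\<lambda>(a, b). F a b" _ T T])
    fix p assume "p \<in> (SIGMA n:{1::nat..}. {a. a dvd n})"
    then obtain a b where p: "p = (a * b, a)" "a * b \<ge> 1" by auto
    then have "a > 0" "b > 0" by (auto intro: gr0I)
    then obtain c d where cd: "a = Suc c" "b = Suc d" by (auto simp: gr0_conv_Suc)
    show "(\<lambda>(a, b). (Suc a * Suc b, Suc a)) ((\<lambda>(n, a). (a - 1, n div a - 1)) p) = p"
      unfolding p cd by (simp del: mult_Suc mult_Suc_right)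
    have "of_nat (Suc c * Suc d) powr (- s) = of_nat (Suc c) powr (- s) * complex_of_nat (Suc d) powr (- s)"
      unfolding of_nat_mult by (rule powr_times_real) auto
    then show "(\<lambda>(a, b). F a b) ((\<lambda>(n, a). (a - 1, n div a - 1)) p)
        = (\<lambda>(n, a). of_real (mu a) * of_nat n powr (- s)) p"
      unfolding p cd by (simp add: F_def P_def del: mult_Suc mult_Suc_right of_nat_Suc of_nat_mult)
  qed (use T in \<open>auto simp del: mult_Suc mult_Suc_right\<close>)
  then have "((\<lambda>n. if n = 1 then 1 else 0) has_sum T) {1::nat..}"
  proof (rule has_sum_SigmaD)
    fix n :: nat assume n: "n \<in> {1..}"
    have "(\<Sum>a | a dvd n. complex_of_real (mu a) * of_nat n powr (- s)) = of_real (\<Sum>a | a dvd n. mu a) * of_nat n powr (- s)"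
      by (simp add: sum_distrib_right)
    also have "\<dots> = (if n = 1 then 1 else 0)" using n by (simp add: sum_mu_divisors)
    finally show "((\<lambda>a. case (n, a) of (n, a) \<Rightarrow> complex_of_real (mu a) * of_nat n powr (- s)) has_sum (if n = 1 then 1 else 0)) {a. a dvd n}"
      using n by (intro has_sum_finiteI) auto
  qed
  moreover have "((\<lambda>n. if n = 1 then 1 else 0) has_sum (1::complex)) {1::nat..}"
    by (rule has_sum_finite_neutralI[of "{1}"]) auto
  ultimately have "T = 1" by (rule has_sum_unique)
  then show ?thesis using 1 by (simp add: P_def)
qed

text \<open>On a ball around 1 the function \<open>H\<close> coincides with the Dirichlet series
  \<open>M\<close>, which can be differentiated termwise. The third statement is the Leibniz rule
  for \<open>M s * Z s = 1\<close>, a recursion that expresses the derivatives of \<open>H\<close>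
  through those of zeta at 2, for which numerical bounds exist.\<close>

lemma deriv_H:
  "(deriv ^^ k) H 1 = of_real (mu_zeta2 k)"
  "(deriv ^^ k) (\<lambda>s. zeta (2 * s)) 1 = of_real ((- 2) ^ k * zeta2_deriv k)"
  "(\<Sum>i=0..k. of_nat (k choose i) * mu_zeta2 i * ((- 2) ^ (k - i) * zeta2_deriv (k - i))) = (if k = 0 then 1 else 0)"
proof -
  define M where "M = (\<lambda>s. \<Sum>n. of_real (mu (Suc n)) * of_nat (Suc n) powr (- (2 * s)) :: complex)"
  define Z where "Z = (\<lambda>s. zeta (2 * s))"
  have Z': "Z = (\<lambda>s. \<Sum>n. 1 * of_nat (Suc n) powr (- (2 * s)))" by (simp add: Z_def zeta_def fun_eq_iff)
  have prod: "M s * Z s = 1" if "s \<in> ball 1 (1 / 4)" for s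
  proof -
    have "norm (1 - s) < 1 / 4" using that by (simp add: dist_norm)
    then have "Re (2 * s) > 1" using complex_Re_le_cmod[of "1 - s"] by simp
    then show ?thesis unfolding M_def Z_def by (rule mu_zeta_product)
  qed
  have nmu: "norm (complex_of_real (mu (Suc n))) \<le> 1" for n using abs_mu_le by simp
  have hM: "M holomorphic_on ball 1 (1 / 4)" unfolding M_def by (rule dirichlet_series_deriv[OF nmu])
  have hZ: "Z holomorphic_on ball 1 (1 / 4)" unfolding Z' by (rule dirichlet_series_deriv(1)) simp
  have dM: "(deriv ^^ k) M 1 = of_real (mu_zeta2 k)" for k
  proof -
    have "(\<lambda>n. mu (Suc n) * (- 2 * ln (real (Suc n))) ^ k / (real (Suc n))\<^sup>2) sums mu_zeta2 k"
      using mu_zeta2_sums[of k] by (subst sums_Suc_iff) simp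
    then have "(\<lambda>n. of_real (mu (Suc n) * (- 2 * ln (real (Suc n))) ^ k / (real (Suc n))\<^sup>2)) sums complex_of_real (mu_zeta2 k)"
      by (rule sums_of_real)
    moreover have "(\<lambda>n. of_real (mu (Suc n)) * of_real ((- 2 * ln (real (Suc n))) ^ k / (real (Suc n))\<^sup>2)) sums (deriv ^^ k) M 1"
      unfolding M_def by (rule dirichlet_series_deriv(2)[OF nmu])
    ultimately show ?thesis by (intro sums_unique2) (auto simp del: of_nat_Suc)
  qed
  have dZ: "(deriv ^^ k) Z 1 = of_real ((- 2) ^ k * zeta2_deriv k)" for k
  proof -
    have "(\<lambda>n. ln (real n) ^ k / real n ^ 2) sums zeta2_deriv k"
      unfolding zeta2_deriv_def by (rule summable_sums[OF summable_ln_power_div_square])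
    then have "(\<lambda>n. ln (real (Suc n)) ^ k / real (Suc n) ^ 2) sums zeta2_deriv k"
      by (subst sums_Suc_iff) simp
    then have "(\<lambda>n. (- 2) ^ k * (ln (real (Suc n)) ^ k / real (Suc n) ^ 2)) sums ((- 2) ^ k * zeta2_deriv k)"
      by (rule sums_mult)
    then have "(\<lambda>n. of_real ((- 2) ^ k * (ln (real (Suc n)) ^ k / real (Suc n) ^ 2))) sums complex_of_real ((- 2) ^ k * zeta2_deriv k)"
      by (rule sums_of_real)
    moreover have "(- 2) ^ k * (ln (real (Suc n)) ^ k / real (Suc n) ^ 2) = (- 2 * ln (real (Suc n))) ^ k / (real (Suc n))\<^sup>2" for n
      unfolding power_mult_distrib by simp
    ultimately have "(\<lambda>n. 1 * of_real ((- 2 * ln (real (Suc n))) ^ k / (real (Suc n))\<^sup>2)) sums complex_of_real ((- 2) ^ k * zeta2_deriv k)"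
      by (simp only: mult_1)
    moreover have "(\<lambda>n. 1 * of_real ((- 2 * ln (real (Suc n))) ^ k / (real (Suc n))\<^sup>2)) sums (deriv ^^ k) Z 1"
      unfolding Z' by (rule dirichlet_series_deriv(2)) simp
    ultimately show ?thesis by (rule sums_unique2[symmetric])
  qed
  show "(deriv ^^ k) (\<lambda>s. zeta (2 * s)) 1 = of_real ((- 2) ^ k * zeta2_deriv k)" using dZ[of k] by (simp add: Z_def)
  have HM: "H s = M s" if "s \<in> ball 1 (1 / 4)" for s
  proof -
    have "Z s \<noteq> 0" using prod[OF that] by auto
    then show ?thesis using prod[OF that] by (simp add: H_def Z_def field_simps)
  qed
  have "H holomorphic_on ball 1 (1 / 4)" by (rule holomorphic_transform[OF hM]) (rule HM[symmetric])
  then have "(deriv ^^ k) H 1 = (deriv ^^ k) M 1"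
    by (rule higher_deriv_transform_within_open[OF _ hM]) (auto simp: HM)
  then show "(deriv ^^ k) H 1 = of_real (mu_zeta2 k)" by (simp add: dM)
  have "(\<Sum>i=0..k. of_nat (k choose i) * (deriv ^^ i) M 1 * (deriv ^^ (k - i)) Z 1) = (deriv ^^ k) (\<lambda>s. M s * Z s) 1"
    by (rule higher_deriv_mult[OF hM hZ, symmetric]) auto
  also have "\<dots> = (deriv ^^ k) (\<lambda>s. 1) 1"
    by (rule higher_deriv_transform_within_open[of _ "ball 1 (1 / 4)"]) (auto simp: prod intro!: holomorphic_intros hM hZ)
  also have "\<dots> = (if k = 0 then 1 else 0)" by (simp add: higher_deriv_const)
  finally have "complex_of_real (\<Sum>i=0..k. of_nat (k choose i) * mu_zeta2 i * ((- 2) ^ (k - i) * zeta2_deriv (k - i)))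
      = of_real (if k = 0 then 1 else 0)"
    unfolding dM dZ by (simp add: mult.assoc)
  then show "(\<Sum>i=0..k. of_nat (k choose i) * mu_zeta2 i * ((- 2) ^ (k - i) * zeta2_deriv (k - i))) = (if k = 0 then 1 else 0)"
    by (simp only: of_real_eq_iff)
qed

section \<open>Numerical values of the constants\<close>

lemma C_eq: "C2 = c2" "C3 = c3" "C4 = c4"
  by (simp_all add: C2_def C3_def C4_def c2_def c3_def c4_def stieltjes_eq_stj)

lemma H_deriv1_eq: "H_deriv1 k = mu_zeta2 k"
  by (simp add: H_deriv1_def deriv_H(1))

lemma main_eq: "main l = D1 * l ^ 3 + D2 * l ^ 2 + D3 * l + D4"
  by (simp add: main_def D1_def D2_def D3_def D4_def C1_def C_eq H_deriv1_eq)

lemma zeta2_deriv_0_eq: "zeta2_deriv 0 = pi\<^sup>2 / 6"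
proof -
  have "(\<lambda>n. 1 / real ((n + 1)\<^sup>2)) sums zeta2_deriv 0"
  proof -
    have "(\<lambda>n. ln (real n) ^ 0 / real n ^ 2) sums zeta2_deriv 0"
      unfolding zeta2_deriv_def by (rule summable_sums[OF summable_ln_power_div_square])
    then have "(\<lambda>n. ln (real (Suc n)) ^ 0 / real (Suc n) ^ 2) sums zeta2_deriv 0"
      by (subst sums_Suc_iff) simp
    then show ?thesis by simp
  qed
  then show ?thesis using inverse_squares_sums by (rule sums_unique2)
qed

text \<open>The Leibniz relations for \<open>k\<close> from 0 to 3, solved for the last unknown by
  multiplying with \<open>h\<close> instead of dividing. They are grouped into products of positive
  quantities, as \<open>mult_bounds\<close> requires; this is why \<open>mu_zeta2 2\<close>, which
  is negative, occurs with a minus sign.\<close>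

lemma mu_zeta2_rec:
  defines "h \<equiv> mu_zeta2 0"
  shows "h = 1 / zeta2_deriv 0"
    "mu_zeta2 1 = 2 * (zeta2_deriv 1 * h * h)"
    "- mu_zeta2 2 = 4 * ((h * zeta2_deriv 2 - mu_zeta2 1 * zeta2_deriv 1) * h)"
    "mu_zeta2 3 = (8 * (h * zeta2_deriv 3) - 12 * (mu_zeta2 1 * zeta2_deriv 2)
        - 6 * (- mu_zeta2 2 * zeta2_deriv 1)) * h"
proof -
  define z where "z = zeta2_deriv"
  have z0: "z 0 > 0" using zeta2_deriv_0_bounds by (simp add: z_def)
  have e0: "h * z 0 = 1" using deriv_H(3)[of 0] by (simp add: h_def z_def)
  have e1: "mu_zeta2 1 * z 0 = 2 * (h * z 1)"
    using deriv_H(3)[of 1] by (simp add: h_def z_def)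
  have e2: "mu_zeta2 2 * z 0 = 4 * (mu_zeta2 1 * z 1) - 4 * (h * z 2)"
    using deriv_H(3)[of 2] by (simp add: h_def z_def eval_nat_numeral algebra_simps)
  have e3: "mu_zeta2 3 * z 0 = 8 * (h * z 3) - 12 * (mu_zeta2 1 * z 2) + 6 * (mu_zeta2 2 * z 1)"
    using deriv_H(3)[of 3] by (simp add: h_def z_def eval_nat_numeral algebra_simps)
  have cancel: "a = b * h" if "a * z 0 = b" for a b
  proof -
    have "a = a * (h * z 0)" by (simp add: e0)
    also have "\<dots> = b * h" using that by (simp add: mult_ac)
    finally show ?thesis .
  qed
  show "h = 1 / zeta2_deriv 0" using e0 z0 by (simp add: z_def field_simps)
  show "mu_zeta2 1 = 2 * (zeta2_deriv 1 * h * h)" using cancel[OF e1] by (simp add: z_def mult_ac)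
  show "- mu_zeta2 2 = 4 * ((h * zeta2_deriv 2 - mu_zeta2 1 * zeta2_deriv 1) * h)"
    using cancel[OF e2] by (simp add: z_def algebra_simps)
  show "mu_zeta2 3 = (8 * (h * zeta2_deriv 3) - 12 * (mu_zeta2 1 * zeta2_deriv 2)
        - 6 * (- mu_zeta2 2 * zeta2_deriv 1)) * h"
    using cancel[OF e3] by (simp add: z_def)
qed

text \<open>Interval arithmetic along \<open>mu_zeta2_rec\<close>, rounded outwards at each step.
  The interval for \<open>D4\<close> is the widest and begins less than 0.0001 above 0.46.\<close>

lemma D_bounds:
  "74433746 / 100000000 \<le> D2" "D2 \<le> 74434672 / 100000000"
  "82320926 / 100000000 \<le> D3" "D3 \<le> 82332710 / 100000000"
  "46007525 / 100000000 \<le> D4" "D4 \<le> 46057019 / 100000000"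
  "10132106 / 100000000 \<le> D1" "D1 \<le> 10132125 / 100000000"
proof -
  define h h1 n2 h3 where "h = mu_zeta2 0" and "h1 = mu_zeta2 1" and "n2 = - mu_zeta2 2" and "h3 = mu_zeta2 3"
  note b = zeta2_deriv_0_bounds zeta2_deriv_1_bounds zeta2_deriv_2_bounds zeta2_deriv_3_bounds
  have h: "60792638 / 100000000 \<le> h" "h \<le> 60792750 / 100000000"
  proof -
    have e: "h * zeta2_deriv 0 = 1" using mu_zeta2_rec(1) b(1) by (simp add: h_def)
    have hp: "h > 0" using mu_zeta2_rec(1) b(1) by (simp add: h_def)
    show "60792638 / 100000000 \<le> h"
    proof (rule ccontr)
      assume "\<not> ?thesis"
      then have "h * zeta2_deriv 0 < 60792638 / 100000000 * (1644936 / 1000000)"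
        using b(1,2) hp by (intro mult_less_le_imp_less) auto
      then show False using e by simp
    qed
    show "h \<le> 60792750 / 100000000"
    proof (rule ccontr)
      assume "\<not> ?thesis"
      then have "60792750 / 100000000 * (1644933 / 1000000) < h * zeta2_deriv 0"
        using b(1,2) hp by (intro mult_less_le_imp_less) auto
      then show False using e by simp
    qed
  qed
  have A1: "56995773 / 100000000 \<le> zeta2_deriv 1 * h" "zeta2_deriv 1 * h \<le> 56996426 / 100000000"
    using mult_bounds[OF b(3,4) h] by simp_all
  have A2: "34649233 / 100000000 \<le> (zeta2_deriv 1 * h) * h" "(zeta2_deriv 1 * h) * h \<le> 34649695 / 100000000"
    using mult_bounds[OF A1 h] by simp_all
  have h1: "69298466 / 100000000 \<le> h1" "h1 \<le> 69299390 / 100000000"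
    using A2 mu_zeta2_rec(2) by (simp_all add: h_def h1_def)
  have B1: "120932970 / 100000000 \<le> h * zeta2_deriv 2" "h * zeta2_deriv 2 \<le> 120934471 / 100000000"
    using mult_bounds[OF h b(5,6)] by simp_all
  have B2: "64970361 / 100000000 \<le> h1 * zeta2_deriv 1" "h1 * zeta2_deriv 1 \<le> 64971851 / 100000000"
    using mult_bounds[OF h1 b(3,4)] by simp_all
  have B3: "55961119 / 100000000 \<le> h * zeta2_deriv 2 - h1 * zeta2_deriv 1" "h * zeta2_deriv 2 - h1 * zeta2_deriv 1 \<le> 55964110 / 100000000"
    using B1 B2 by linarith+
  have B4: "34020240 / 100000000 \<le> (h * zeta2_deriv 2 - h1 * zeta2_deriv 1) * h" "(h * zeta2_deriv 2 - h1 * zeta2_deriv 1) * h \<le> 34022122 / 100000000"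
    using mult_bounds[OF B3 h] by simp_all
  have n2: "136080960 / 100000000 \<le> n2" "n2 \<le> 136088488 / 100000000"
    using B4 mu_zeta2_rec(3) unfolding h_def[symmetric] h1_def[symmetric] n2_def[symmetric] by linarith+
  have E1: "364762636 / 100000000 \<le> h * zeta2_deriv 3" "h * zeta2_deriv 3 \<le> 364767443 / 100000000"
    using mult_bounds[OF h b(7,8)] by simp_all
  have E2: "137853359 / 100000000 \<le> h1 * zeta2_deriv 2" "h1 * zeta2_deriv 2 \<le> 137856653 / 100000000"
    using mult_bounds[OF h1 b(5,6)] by simp_all
  have E3: "127581887 / 100000000 \<le> n2 * zeta2_deriv 1" "n2 * zeta2_deriv 1 \<le> 127590171 / 100000000"
    using mult_bounds[OF n2 b(3,4)] by simp_all
  have E4: "498280226 / 100000000 \<le> 8 * (h * zeta2_deriv 3) - 12 * (h1 * zeta2_deriv 2) - 6 * (n2 * zeta2_deriv 1)" "8 * (h * zeta2_deriv 3) - 12 * (h1 * zeta2_deriv 2) - 6 * (n2 * zeta2_deriv 1) \<le> 498407914 / 100000000"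
    using E1 E2 E3 by linarith+
  have E5: "302917694 / 100000000 \<le> (8 * (h * zeta2_deriv 3) - 12 * (h1 * zeta2_deriv 2) - 6 * (n2 * zeta2_deriv 1)) * h" "(8 * (h * zeta2_deriv 3) - 12 * (h1 * zeta2_deriv 2) - 6 * (n2 * zeta2_deriv 1)) * h \<le> 302995878 / 100000000"
    using mult_bounds[OF E4 h] by simp_all
  have h3: "302917694 / 100000000 \<le> h3" "h3 \<le> 302995878 / 100000000"
    using E5 mu_zeta2_rec(4) unfolding h_def[symmetric] h1_def[symmetric] n2_def[symmetric] h3_def[symmetric] by linarith+
  have F1: "39784513 / 100000000 \<le> c2 * h" "c2 * h \<le> 39784977 / 100000000"
    using mult_bounds[OF c_bounds(1,2) h] by simp_all
  have F2: "59663208 / 100000000 \<le> c3 * h" "c3 * h \<le> 59669130 / 100000000"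
    using mult_bounds[OF c_bounds(3,4) h] by simp_all
  have F3: "45350981 / 100000000 \<le> c2 * h1" "c2 * h1 \<le> 45352030 / 100000000"
    using mult_bounds[OF c_bounds(1,2) h1] by simp_all
  have F4: "16571465 / 100000000 \<le> c4 * h" "c4 * h \<le> 16594597 / 100000000"
    using mult_bounds[OF c_bounds(5,6) h] by simp_all
  have F5: "68011011 / 100000000 \<le> c3 * h1" "c3 * h1 \<le> 68018544 / 100000000"
    using mult_bounds[OF c_bounds(3,4) h1] by simp_all
  have F6: "89055435 / 100000000 \<le> c2 * n2" "c2 * n2 \<le> 89061233 / 100000000"
    using mult_bounds[OF c_bounds(1,2) n2] by simp_all
  have D: "D1 = h / 6" "D2 = c2 * h + h1 / 2" "D3 = c3 * h + 2 * (c2 * h1) - n2 / 2"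
      "D4 = c4 * h + c3 * h1 - c2 * n2 + h3 / 6"
    by (simp_all add: D1_def D2_def D3_def D4_def C1_def C_eq H_deriv1_eq h_def h1_def n2_def h3_def)
  show "74433746 / 100000000 \<le> D2" "D2 \<le> 74434672 / 100000000" "82320926 / 100000000 \<le> D3" "D3 \<le> 82332710 / 100000000" "46007525 / 100000000 \<le> D4" "D4 \<le> 46057019 / 100000000" "10132106 / 100000000 \<le> D1" "D1 \<le> 10132125 / 100000000"
    unfolding D using h h1 n2 h3 F1 F2 F3 F4 F5 F6 by linarith+
qed

lemma D1_eq: "D1 = 1 / pi\<^sup>2"
  using mu_zeta2_rec(1) by (simp add: D1_def C1_def H_deriv1_eq zeta2_deriv_0_eq)

section \<open>Verified computation of the sum\<close>

definition dsum :: "nat \<Rightarrow> nat" where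
  "dsum n = (\<Sum>m<n. divisor_count m ^ 2)"

text \<open>Every number divides 0, and \<open>card\<close> of an infinite set is 0; so sums may
  start at index 0.\<close>

lemma divisor_count_0 [simp]: "divisor_count 0 = 0"
  by (simp add: divisor_count_def)

lemma dsum_Suc: "dsum (Suc n) = dsum n + divisor_count n ^ 2"
  by (simp add: dsum_def)

lemma dsum_mono: "m \<le> n \<Longrightarrow> dsum m \<le> dsum n"
  unfolding dsum_def by (rule sum_mono2) auto

lemma divisor_square_sum_eq_dsum:
  assumes "real n \<le> x" "x < real n + 1"
  shows "divisor_square_sum x = real (dsum (Suc n))"
proof -
  have "{m. 1 \<le> m \<and> real m \<le> x} = {1..n}" using assms by auto
  then have "divisor_square_sum x = (\<Sum>m=1..n. real (divisor_count m) ^ 2)"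
    by (simp add: divisor_square_sum_def)
  also have "\<dots> = (\<Sum>m<Suc n. real (divisor_count m) ^ 2)"
    by (rule sum.mono_neutral_left) (auto simp: not_le)
  finally show ?thesis by (simp add: dsum_def)
qed

text \<open>Division into \<open>n\<close> exchanges the divisors above the integer root with those
  up to it, except that the root of a square is its own partner.\<close>

lemma divisor_count_eq_small_divisors:
  assumes "0 < n" "s * s \<le> n" "n < (s + 1) * (s + 1)"
  shows "divisor_count n = 2 * card {j. 1 \<le> j \<and> j \<le> s \<and> j dvd n} - (if n = s * s then 1 else 0)"
proof -
  define A where "A = {j. 1 \<le> j \<and> j \<le> s \<and> j dvd n}"
  define B where "B = {j. s < j \<and> j dvd n}"
  define A' where "A' = (if n = s * s then A - {s} else A)"
  have fin: "finite A" "finite B" using assms(1) by (auto simp: A_def B_def)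
  have "{k. k dvd n} = A \<union> B" using assms(1) by (auto simp: A_def B_def Suc_le_eq intro!: Nat.gr0I)
  moreover have "A \<inter> B = {}" by (auto simp: A_def B_def)
  ultimately have "divisor_count n = card A + card B"
    using fin by (simp add: divisor_count_def card_Un_disjoint)
  moreover have "card B = card A'"
  proof (rule bij_betw_same_card)
    have 1: "n div j \<in> A' \<and> n div (n div j) = j" if "j \<in> B" for j
    proof -
      from that obtain k where k: "n = j * k" and j: "s < j" by (auto simp: B_def)
      have kp: "k > 0" using assms(1) k by auto
      have ks: "k \<le> s"
      proof (rule ccontr)
        assume "\<not> k \<le> s"
        then have "(s + 1) * (s + 1) \<le> j * k" using j by (intro mult_le_mono) auto
        then show False using assms(3) k by simp
      qed
      moreover have "k \<noteq> s" if "n = s * s"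
      proof
        assume "k = s"
        then show False using that k j kp by simp
      qed
      moreover have "k dvd n" using k by simp
      ultimately have "k \<in> A'" using kp by (auto simp: A'_def A_def)
      moreover have "n div j = k" "n div k = j" using k j kp by auto
      ultimately show ?thesis by simp
    qed
    have 2: "n div j \<in> B \<and> n div (n div j) = j" if "j \<in> A'" for j
    proof -
      have jA: "j \<in> A" using that by (auto simp: A'_def split: if_splits)
      then obtain k where k: "n = j * k" and j: "1 \<le> j" "j \<le> s" by (auto simp: A_def)
      have kp: "k > 0" using assms(1) k by auto
      have "s < k"
      proof (rule ccontr)
        assume "\<not> s < k"
        then have le: "k \<le> s" by simp
        have "j * k \<le> s * s" using le j by (intro mult_le_mono) auto
        then have n: "n = s * s" using assms(2) k by simp
        have "j \<noteq> s" using that n by (auto simp: A'_def)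
        then have "j * k < s * s" using j le by (intro le_less_trans[OF mult_le_mono2[OF le]]) auto
        then show False using n k by simp
      qed
      then have "k \<in> B" using k by (auto simp: B_def)
      moreover have "n div j = k" "n div k = j" using k j kp by auto
      ultimately show ?thesis by simp
    qed
    show "bij_betw (\<lambda>j. n div j) B A'"
      by (rule bij_betwI[where g = "\<lambda>j. n div j"]) (use 1 2 in auto)
  qed
  moreover have "s \<in> A" if "n = s * s" using that assms(1) by (auto simp: A_def Suc_le_eq)
  moreover have "card A > 0"
  proof -
    have "1 \<le> s" using assms by (cases s) auto
    then have "1 \<in> A" by (simp add: A_def)
    then show ?thesis using fin by (auto simp: card_gt_0_iff)
  qed
  ultimately have "divisor_count n = 2 * card A - (if n = s * s then 1 else 0)"
    using fin by (simp add: A'_def mult_2)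
  then show ?thesis by (simp only: A_def)
qed

text \<open>
  Instead of testing divisibility, one keeps for every \<open>j \<le> s\<close> the pair of \<open>j - 1\<close> and the distance
  from \<open>n\<close> to the next multiple of \<open>j\<close>; a divisor of \<open>n\<close> is an entry with distance \<open>0\<close>.
\<close>

fun hits :: "(nat \<times> nat) list \<Rightarrow> nat" where
  "hits [] = 0"
| "hits ((m, 0) # L) = hits L + 1"
| "hits ((m, Suc c) # L) = hits L"

fun adv :: "(nat \<times> nat) list \<Rightarrow> (nat \<times> nat) list" where
  "adv [] = []"
| "adv ((m, 0) # L) = (m, m) # adv L"
| "adv ((m, Suc c) # L) = (m, c) # adv L"

text \<open>The condition \<open>c \<le> m\<close> makes \<open>c\<close> the least number with
  \<open>Suc m dvd n + c\<close>, so \<open>c = 0\<close> holds exactly for the divisors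
  \<open>Suc m\<close>. Storing \<open>j - 1\<close> makes the reset after a hit a mere copy of the
  first component.\<close>

definition counters :: "nat \<Rightarrow> nat \<Rightarrow> (nat \<times> nat) list \<Rightarrow> bool" where
  "counters n s L \<longleftrightarrow> map fst L = rev [0..<s] \<and> (\<forall>(m, c)\<in>set L. c \<le> m \<and> Suc m dvd n + c)"

text \<open>Reducing \<open>n - 1\<close> instead of \<open>n\<close> gives distance 0, not
  \<open>j\<close>, when \<open>j\<close> divides \<open>n\<close>.\<close>

fun init :: "nat \<Rightarrow> nat \<Rightarrow> (nat \<times> nat) list" where
  "init n 0 = []"
| "init n (Suc m) = (m, m - (n - 1) mod Suc m) # init n m"

lemma counters_init: "n > 0 \<Longrightarrow> counters n s (init n s)"
proof (induction s)
  case (Suc m)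
  define q r where "q = (n - 1) div Suc m" and "r = (n - 1) mod Suc m"
  have "n = q * Suc m + r + 1" using Suc.prems by (simp add: q_def r_def del: mult_Suc_right)
  moreover have "r \<le> m" by (simp add: r_def less_Suc_eq_le flip: less_Suc_eq_le)
  ultimately have "n + (m - r) = Suc m * (q + 1)" by simp
  then have "Suc m dvd n + (m - r)" by (metis dvd_triv_left)
  then show ?case using Suc by (auto simp: counters_def r_def)
qed (simp add: counters_def)

lemma hits_altdef: "hits L = length (filter (\<lambda>p. snd p = 0) L)"
  by (induction L rule: hits.induct) auto

lemma adv_altdef: "adv L = map (\<lambda>(m, c). (m, if c = 0 then m else c - 1)) L"
  by (induction L rule: adv.induct) auto

lemma counters_adv:
  assumes "counters n s L"
  shows "counters (Suc n) s (adv L)"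
proof -
  have "map fst (adv L) = map fst L" by (auto simp: adv_altdef)
  moreover have "c \<le> m \<and> Suc m dvd Suc n + c" if mc: "(m, c) \<in> set (adv L)" for m c
  proof -
    from mc obtain d where d: "(m, d) \<in> set L" "c = (if d = 0 then m else d - 1)"
      by (auto simp: adv_altdef)
    have *: "d \<le> m" "Suc m dvd n + d" using d(1) assms by (auto simp: counters_def)
    show ?thesis
    proof (cases "d = 0")
      case True
      have "Suc m dvd n + Suc m" using * True by (simp only: dvd_add_triv_right_iff) simp
      then show ?thesis using d(2) True by simp
    next
      case False
      then show ?thesis using * d(2) by auto
    qed
  qed
  ultimately show ?thesis using assms by (auto simp: counters_def)
qed

lemma hits_eq_card:
  assumes "counters n s L"
  shows "hits L = card {j. 1 \<le> j \<and> j \<le> s \<and> j dvd n}"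
proof -
  have L: "map fst L = rev [0..<s]" "\<And>m c. (m, c) \<in> set L \<Longrightarrow> c \<le> m \<and> Suc m dvd n + c"
    using assms by (auto simp: counters_def)
  define F where "F = filter (\<lambda>p. snd p = 0) L"
  have d: "distinct (map fst F)"
    using L(1) by (simp add: F_def distinct_map_filter)
  have "hits L = length (map fst F)" by (simp add: hits_altdef F_def)
  also have "\<dots> = card (fst ` set F)" using distinct_card[OF d] by simp
  also have "\<dots> = card (Suc ` fst ` set F)" by (simp add: card_image)
  also have "Suc ` fst ` set F = {j. 1 \<le> j \<and> j \<le> s \<and> j dvd n}"
  proof (intro equalityI subsetI)
    fix j assume "j \<in> Suc ` fst ` set F"
    then obtain m where m: "(m, 0) \<in> set L" "j = Suc m" by (auto simp: F_def)
    have "m \<in> set (map fst L)" using m(1) by force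
    then have "m < s" by (simp add: L(1))
    then show "j \<in> {j. 1 \<le> j \<and> j \<le> s \<and> j dvd n}" using L(2)[OF m(1)] m(2) by auto
  next
    fix j assume j: "j \<in> {j. 1 \<le> j \<and> j \<le> s \<and> j dvd n}"
    then obtain m where m: "j = Suc m" "m < s" by (cases j) auto
    then have "m \<in> set (map fst L)" by (simp add: L(1))
    then obtain c where c: "(m, c) \<in> set L" by force
    have *: "c \<le> m" "Suc m dvd n + c" using L(2)[OF c] by auto
    have "Suc m dvd c" using *(2) j m(1) by (auto simp: dvd_add_right_iff)
    then have "c = 0" using *(1) by (auto dest: dvd_imp_le)
    then show "j \<in> Suc ` fst ` set F" using c m(1) by (force simp: F_def)
  qed
  finally show ?thesis .
qed

text \<open>
  The flag \<open>e\<close> is 1 if \<open>n\<close> is a square, whose root is paired with itself; this only happens at the first step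
  of a run, because a run stays between consecutive squares.
\<close>

fun run :: "nat \<Rightarrow> nat \<Rightarrow> (nat \<times> nat) list \<Rightarrow> nat \<Rightarrow> nat \<Rightarrow> nat \<Rightarrow> nat \<Rightarrow> nat \<Rightarrow> bool" where
  "run 0 e L C T t S F \<longleftrightarrow> S = F"
| "run (Suc k) e L C T t S F \<longleftrightarrow>
    C * (S + (2 * hits L - e)\<^sup>2) \<le> T \<and> run k 0 (adv L) C (T + t) t (S + (2 * hits L - e)\<^sup>2) F"

text \<open>The invariant: \<open>S\<close> is \<open>dsum n\<close>, and \<open>T\<close> is the
  bound for the present \<open>n\<close>, raised by \<open>t\<close> per step, so that a linear
  function is tested at every integer. Ending at \<open>(s + 1) * (s + 1)\<close> keeps
  \<open>s\<close> the integer root throughout.\<close>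

lemma run_sound:
  assumes "run k e L C T t S F" "counters n s L" "0 < n" "s * s \<le> n" "n + k \<le> (s + 1) * (s + 1)"
    "e = (if n = s * s then 1 else 0)" "S = dsum n"
  shows "dsum (n + k) = F \<and> (\<forall>i<k. C * dsum (Suc (n + i)) \<le> T + t * i)"
  using assms
proof (induction k arbitrary: e L T S n)
  case 0
  then show ?case by simp
next
  case (Suc k)
  have "divisor_count n = 2 * hits L - e"
    unfolding hits_eq_card[OF Suc.prems(2)] Suc.prems(6)
    by (rule divisor_count_eq_small_divisors) (use Suc.prems in auto)
  then have S: "S + (2 * hits L - e)\<^sup>2 = dsum (Suc n)" using Suc.prems(7) by (simp add: dsum_Suc)
  have le: "C * dsum (Suc n) \<le> T" and r: "run k 0 (adv L) C (T + t) t (dsum (Suc n)) F"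
    using Suc.prems(1) by (simp_all add: S)
  have "dsum (Suc n + k) = F \<and> (\<forall>i<k. C * dsum (Suc (Suc n + i)) \<le> T + t + t * i)"
    by (rule Suc.IH[OF r counters_adv[OF Suc.prems(2)]]) (use Suc.prems(3-5) in auto)
  moreover from this have "C * dsum (Suc (n + i)) \<le> T + t * i" if "i < Suc k" for i
    using that le by (cases i) (auto simp: add_ac)
  ultimately show ?case by simp
qed

text \<open>This fixes the order of evaluation by the simplifier: the argument \<open>S\<close> is
  normalised to a numeral before unfolding \<open>run_test\<close> copies it to two places.\<close>

definition run_test :: "nat \<Rightarrow> (nat \<times> nat) list \<Rightarrow> nat \<Rightarrow> nat \<Rightarrow> nat \<Rightarrow> nat \<Rightarrow> nat \<Rightarrow> bool" where
  "run_test k L C T t S F \<longleftrightarrow> C * S \<le> T \<and> run k 0 L C (T + t) t S F"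

lemma run_numeral:
  "run (numeral k) e L C T t S F = run_test (pred_numeral k) (adv L) C T t (S + (2 * hits L - e)\<^sup>2) F"
  "run (Suc 0) e L C T t S F = run_test 0 (adv L) C T t (S + (2 * hits L - e)\<^sup>2) F"
  by (simp_all add: run_test_def numeral_eq_Suc)

lemma hits_numeral:
  "hits ((m, Suc 0) # L) = hits L" "hits ((m, numeral k) # L) = hits L"
  by (simp_all add: numeral_eq_Suc)

lemma adv_numeral:
  "adv ((m, Suc 0) # L) = (m, 0) # adv L" "adv ((m, numeral k) # L) = (m, pred_numeral k) # adv L"
  by (simp_all add: numeral_eq_Suc)

lemma init_numeral:
  "init n (numeral k) = (pred_numeral k, pred_numeral k - (n - 1) mod numeral k) # init n (pred_numeral k)"
  "init n (Suc 0) = [(0, 0)]"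
  by (simp_all add: numeral_eq_Suc)

lemmas run_simps = init.simps(1) init_numeral run.simps(1) run_numeral run_test_def hits.simps(1,2) hits_numeral
  adv.simps(1,2) adv_numeral

section \<open>Testing \<open>x * ln x ^ 3\<close> in integers\<close>

text \<open>With \<open>d = 1 - a / y\<close> one has \<open>ln y \<ge> ln a + d\<close>, and the
  cube of \<open>r + d\<close> is at least its first two terms in \<open>d\<close>. Since
  \<open>y * d = y - a\<close>, the bound is linear in \<open>y\<close>; for \<open>r = ln a\<close>
  it is the tangent of \<open>y * ln y ^ 3\<close> at \<open>a\<close>.\<close>

lemma mult_ln_power3_tangent:
  fixes a x y r :: real
  assumes "1 \<le> a" "a \<le> y" "y \<le> x" "0 \<le> r" "r \<le> ln a"
  shows "y * r ^ 3 + 3 * r\<^sup>2 * (y - a) \<le> x * ln x ^ 3"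
proof -
  define d where "d = (y - a) / y"
  have d: "d \<ge> 0" using assms by (simp add: d_def)
  have "ln (a / y) \<le> a / y - 1" using assms by (intro ln_le_minus_one) auto
  then have "ln a + d \<le> ln y" using assms by (simp add: ln_div d_def diff_divide_distrib)
  then have "(r + d) ^ 3 \<le> ln x ^ 3"
    using assms d ln_le_cancel_iff[of y x] by (intro power_mono; linarith)
  moreover have "r ^ 3 + 3 * r\<^sup>2 * d \<le> (r + d) ^ 3"
  proof -
    have "(r + d) ^ 3 = r ^ 3 + 3 * r\<^sup>2 * d + (3 * r * d\<^sup>2 + d ^ 3)"
      by (simp add: power2_eq_square power3_eq_cube algebra_simps)
    moreover have "0 \<le> 3 * r * d\<^sup>2 + d ^ 3" using d assms(4) by simp
    ultimately show ?thesis by linarith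
  qed
  moreover have "0 \<le> r ^ 3 + 3 * r\<^sup>2 * d" using d assms(4) by simp
  ultimately have "y * (r ^ 3 + 3 * r\<^sup>2 * d) \<le> x * ln x ^ 3"
    using assms by (intro mult_mono) auto
  moreover have "y * (r ^ 3 + 3 * r\<^sup>2 * d) = y * r ^ 3 + 3 * r\<^sup>2 * (y - a)"
    using assms by (simp add: d_def field_simps)
  ultimately show ?thesis by simp
qed

text \<open>The bound tested by \<open>run\<close> is the tangent line above, multiplied by 1000 and rounded down.\<close>

lemma run_bound:
  fixes r :: real
  assumes "run k e L C (P * n + Q * (n - a)) (P + Q) S F" "counters n s L"
    "e = (if n = s * s then 1 else 0)" "s * s \<le> n" "n + k \<le> (s + 1) * (s + 1)" "0 < k"
    "dsum n = S" "0 \<le> r" "r \<le> ln (real a)" "1 \<le> a" "a \<le> n"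
    "real P \<le> 1000 * r ^ 3" "real Q \<le> 3000 * r\<^sup>2"
  shows "dsum (n + k) = F"
    "real n \<le> x \<Longrightarrow> x < real (n + k) \<Longrightarrow> real C * divisor_square_sum x \<le> 1000 * (x * ln x ^ 3)"
proof -
  have *: "dsum (n + k) = F \<and> (\<forall>i<k. C * dsum (Suc (n + i)) \<le> P * n + Q * (n - a) + (P + Q) * i)"
    by (rule run_sound[OF assms(1,2)]) (use assms in auto)
  then show "dsum (n + k) = F" by blast
  assume x: "real n \<le> x" "x < real (n + k)"
  define i where "i = nat \<lfloor>x\<rfloor> - n"
  have i: "n + i = nat \<lfloor>x\<rfloor>" using x(1) by (simp add: i_def le_nat_floor)
  have xi: "real (n + i) \<le> x" "x < real (n + i) + 1" unfolding i using x(1) by linarith+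
  then have ik: "i < k" using x(2) by linarith
  have "real C * divisor_square_sum x = real (C * dsum (Suc (n + i)))"
    using divisor_square_sum_eq_dsum[OF xi] by simp
  also have "\<dots> \<le> real (P * n + Q * (n - a) + (P + Q) * i)" using * ik by (intro of_nat_mono) auto
  also have "\<dots> = real P * real (n + i) + real Q * (real (n + i) - real a)"
    using of_nat_diff[OF assms(11), where ?'a = real] by (simp only: of_nat_add of_nat_mult) (simp add: algebra_simps)
  also have "\<dots> \<le> 1000 * r ^ 3 * real (n + i) + 3000 * r\<^sup>2 * (real (n + i) - real a)"
    using assms(11-13) by (intro add_mono mult_right_mono) auto
  also have "\<dots> = 1000 * (real (n + i) * r ^ 3 + 3 * r\<^sup>2 * (real (n + i) - real a))"
    by (simp add: algebra_simps)
  also have "\<dots> \<le> 1000 * (x * ln x ^ 3)"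
    using mult_ln_power3_tangent[of "real a" "real (n + i)" x r] assms(8-11) xi by simp
  finally show "real C * divisor_square_sum x \<le> 1000 * (x * ln x ^ 3)" .
qed

section \<open>The error term on short intervals and for large arguments\<close>

lemma main_mono:
  assumes "0 \<le> l" "l \<le> m"
  shows "main l \<le> main m"
  unfolding main_eq using assms D_bounds by (intro add_mono mult_left_mono power_mono) auto

lemma main_le:
  assumes "0 \<le> l"
  shows "main l \<le> 10133 / 100000 * l ^ 3 + 745 / 1000 * l\<^sup>2 + 824 / 1000 * l + 461 / 1000"
  unfolding main_eq using assms D_bounds by (intro add_mono mult_right_mono) auto

lemma main_ge:
  assumes "0 \<le> l"
  shows "1013 / 10000 * l ^ 3 + 744 / 1000 * l\<^sup>2 + 823 / 1000 * l + 460 / 1000 \<le> main l"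
  unfolding main_eq using assms D_bounds by (intro add_mono mult_right_mono) auto

lemma interval_error_bound:
  fixes a a' b u l :: nat and x r v q :: real
  assumes "real a \<le> x" "x < real b" "1 \<le> a" "dsum a' = l" "a' \<le> Suc a" "dsum b = u"
    "0 \<le> r" "r \<le> ln (real a)" "ln (real b) \<le> v" "0 \<le> q" "q ^ 4 \<le> real a ^ 3"
    "real u \<le> real a * (1013 / 10000 * r ^ 3 + 744 / 1000 * r\<^sup>2 + 823 / 1000 * r + 460 / 1000)
      + 973 / 100 * (q * r)"
    "real b * (10133 / 100000 * v ^ 3 + 745 / 1000 * v\<^sup>2 + 824 / 1000 * v + 461 / 1000)
      \<le> real l + 973 / 100 * (q * r)"
  shows "\<bar>divisor_square_sum x - x * main (ln x)\<bar> \<le> 973 / 100 * (x powr (3 / 4) * ln x)"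
proof -
  define n where "n = nat \<lfloor>x\<rfloor>"
  have x0: "x \<ge> 1" using assms(1,3) by linarith
  have n: "real n \<le> x" "x < real n + 1" unfolding n_def using x0 by linarith+
  have an: "a \<le> n" using assms(1) n(2) by linarith
  have nb: "n < b" using assms(2) n(1) by linarith
  have S: "real l \<le> divisor_square_sum x" "divisor_square_sum x \<le> real u"
    unfolding divisor_square_sum_eq_dsum[OF n]
    using dsum_mono[of a' "Suc n"] dsum_mono[of "Suc n" b] assms(4-6) an nb by auto
  have la: "r \<le> ln x" using assms(1,3,8) ln_mono[of "real a" x] by linarith
  have lb: "ln x \<le> v" using assms(2,9) x0 ln_mono[of x "real b"] by linarith
  have lnx: "0 \<le> ln x" using x0 by simp
  have "real a * main r \<le> x * main (ln x)"
  proof (rule mult_mono)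
    show "0 \<le> main r" unfolding main_eq using D_bounds assms(7) by (intro add_nonneg_nonneg mult_nonneg_nonneg) auto
  qed (use assms main_mono[OF assms(7) la] x0 in auto)
  then have lo: "real a * (1013 / 10000 * r ^ 3 + 744 / 1000 * r\<^sup>2 + 823 / 1000 * r + 460 / 1000) \<le> x * main (ln x)"
    using mult_left_mono[OF main_ge[OF assms(7)], of "real a"] by linarith
  have "x * main (ln x) \<le> real b * main v"
  proof (rule mult_mono)
    show "0 \<le> main (ln x)" unfolding main_eq using D_bounds lnx by (intro add_nonneg_nonneg mult_nonneg_nonneg) auto
  qed (use assms main_mono[OF lnx lb] x0 in auto)
  then have up: "x * main (ln x) \<le> real b * (10133 / 100000 * v ^ 3 + 745 / 1000 * v\<^sup>2 + 824 / 1000 * v + 461 / 1000)"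
    using mult_left_mono[OF main_le[of v], of "real b"] lnx lb by linarith
  have "q \<le> x powr (3 / 4)"
  proof (rule power_le_imp_le_base)
    have "q ^ Suc 3 \<le> real a ^ 3" using assms(11) by simp
    also have "\<dots> \<le> x ^ 3" using assms(1) by (intro power_mono) auto
    also have "\<dots> = (x powr (3 / 4)) ^ Suc 3" using x0 by (simp add: powr_powr del: power_Suc flip: powr_numeral)
    finally show "q ^ Suc 3 \<le> (x powr (3 / 4)) ^ Suc 3" .
  qed simp
  then have "q * r \<le> x powr (3 / 4) * ln x" using la assms(7,10) by (intro mult_mono) auto
  then show ?thesis using S lo up assms(12,13) by (simp only: abs_le_iff) linarith
qed

lemma ln_lower_1296: "7167 / 1000 \<le> ln (1296::real)"
proof -
  have "ln (1296::real) = 4 * (ln 2 + ln 3)"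
    using ln_realpow[of "6::real" 4] ln_products(2) by simp
  then show ?thesis using ln_bounds(1,3) by simp
qed

text \<open>With \<open>w = x powr (1 / 4)\<close> the claim follows from
  \<open>20 \<le> w\<^sup>2 * (4.45 * w * ln x - 9 * ln x - 57.27)\<close>, where
  \<open>4.45 = 9.73 - 5.28\<close> and \<open>57.27 = 18 + 40 - 0.73\<close>. The bracket grows
  with \<open>w\<close> and \<open>ln x\<close> and is already above 3.8 at
  \<open>x = 361\<close>.\<close>

lemma divisor_square_sum_error_large:
  fixes x :: real
  assumes "361 \<le> x" "2944 / 1000 \<le> ln (19::real)"
  shows "\<bar>divisor_square_sum x - x * main (ln x)\<bar>
    \<le> 973 / 100 * (x powr (3 / 4) * ln x) + 73 / 100 * x powr (1 / 2)"
proof -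
  define w where "w = x powr (1 / 4)"
  have w: "w ^ 2 = sqrt x" "w ^ 3 = x powr (3 / 4)" "w ^ 4 = x"
    using assms(1) by (simp_all add: w_def powr_power powr_half_sqrt)
  have "4358 / 1000 \<le> w"
  proof (rule power_le_imp_le_base)
    show "(4358 / 1000) ^ Suc 3 \<le> w ^ Suc 3" using w(3) assms(1) by (simp add: numeral_eq_Suc power_divide)
  qed (simp add: w_def)
  moreover have L: "5888 / 1000 \<le> ln x"
  proof -
    have "ln (361::real) = 2 * ln 19" using ln_realpow[of 19 2] by simp
    then show ?thesis using ln_le_cancel_iff[of 361 x] assms by linarith
  qed
  moreover have "(445 / 100 * (4358 / 1000) - 9) * (5888 / 1000) \<le> (445 / 100 * w - 9) * ln x"
    using calculation by (intro mult_mono) auto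
  ultimately have "38 / 10 \<le> 445 / 100 * (w * ln x) - 9 * ln x - 5727 / 100"
    by (simp add: algebra_simps)
  moreover have "18 \<le> w\<^sup>2" using power_mono[of "4358 / 1000" w 2] \<open>4358 / 1000 \<le> w\<close> by (simp add: power_divide)
  ultimately have "18 * (38 / 10) \<le> w\<^sup>2 * (445 / 100 * (w * ln x) - 9 * ln x - 5727 / 100)"
    by (intro mult_mono) auto
  then have *: "20 \<le> 445 / 100 * (w ^ 3 * ln x) - 9 * (w\<^sup>2 * ln x) - 5727 / 100 * w\<^sup>2"
    by (simp add: algebra_simps power2_eq_square power3_eq_cube)
  have "\<bar>divisor_square_sum x - x * main (ln x)\<bar>
      \<le> 528 / 100 * (w ^ 3 * ln x) + 58 * w\<^sup>2 + 9 * (w\<^sup>2 * ln x) + 20"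
    using divisor_square_sum_estimate[of x] assms(1) unfolding w by (simp add: algebra_simps)
  then show ?thesis using * assms(1) unfolding w by (simp add: powr_half_sqrt)
qed

text \<open>From \<open>w \<ge> 6\<close> follow \<open>w ^ 3 \<le> x / 6\<close> and
  \<open>w\<^sup>2 \<le> x / 36\<close>, so the error is at most \<open>x\<close> times a linear
  function of \<open>L\<close>. What remains is a cubic inequality in \<open>L\<close>, with leading
  coefficient about \<open>1 / 4 - 1 / pi\<^sup>2\<close>.\<close>

lemma divisor_square_sum_upper_large:
  fixes x :: real
  assumes "1296 \<le> x"
  shows "4 * divisor_square_sum x \<le> x * ln x ^ 3"
proof -
  define w L where "w = x powr (1 / 4)" and "L = ln x"
  have w: "w ^ 2 = sqrt x" "w ^ 3 = x powr (3 / 4)" "w ^ 4 = x"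
    using assms(1) by (simp_all add: w_def powr_power powr_half_sqrt)
  have w6: "6 \<le> w"
  proof (rule power_le_imp_le_base)
    show "6 ^ Suc 3 \<le> w ^ Suc 3" using w(3) assms(1) by (simp add: numeral_eq_Suc)
  qed (simp add: w_def)
  have L: "7167 / 1000 \<le> L" using ln_lower_1296 ln_le_cancel_iff[of 1296 x] assms unfolding L_def by linarith
  have "6 * w ^ 3 \<le> w * w ^ 3" "36 * w ^ 2 \<le> w ^ 2 * w ^ 2"
    using w6 power_mono[of 6 w 2] by (intro mult_right_mono; simp)+
  then have w': "w ^ 3 \<le> x / 6" "w\<^sup>2 \<le> x / 36" using w(3) by (simp_all add: numeral_eq_Suc)
  have "divisor_square_sum x \<le> x * main L + (528 / 100 * (w ^ 3 * L) + 58 * w\<^sup>2 + 9 * (w\<^sup>2 * L) + 20)"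
    using divisor_square_sum_estimate[of x] assms(1) unfolding w L_def by (simp add: algebra_simps)
  also have "\<dots> \<le> x * main L + (528 / 100 * (x / 6 * L) + 58 * (x / 36) + 9 * (x / 36 * L) + 20 * (x / 1296))"
    using w' assms L by (intro add_mono mult_left_mono mult_right_mono) auto
  also have "\<dots> = x * (main L + (113 / 100 * L + 16266 / 10000 + (58 / 36 + 20 / 1296 - 16266 / 10000)))"
    by (simp add: algebra_simps)
  also have "\<dots> \<le> x * (1 / 4 * L ^ 3)"
  proof (rule mult_left_mono)
    have 1: "main L \<le> 10132125 / 100000000 * L ^ 3 + 74434672 / 100000000 * L ^ 2 + 82332710 / 100000000 * L + 46057019 / 100000000"
      unfolding main_eq using L D_bounds by (intro add_mono mult_right_mono) auto
    \<comment> \<open>The cubic in Horner form: every bracket is positive at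
      \<open>7167 / 1000\<close>, so this lower bound for \<open>L\<close> can be inserted from the
      inside out.\<close>
    have "(14867875 / 100000000 * (7167 / 1000) - 74434672 / 100000000) * (7167 / 1000) \<le> (14867875 / 100000000 * L - 74434672 / 100000000) * L"
      using L by (intro mult_mono) auto
    then have "23 / 10 \<le> (14867875 / 100000000 * L - 74434672 / 100000000) * L"
      by (rule order.trans[rotated]) simp
    then have "23 / 10 - 195332710 / 100000000 \<le> (14867875 / 100000000 * L - 74434672 / 100000000) * L - 195332710 / 100000000"
      by (rule diff_right_mono)
    then have "(7167 / 1000) * (23 / 10 - 195332710 / 100000000) \<le> L * ((14867875 / 100000000 * L - 74434672 / 100000000) * L - 195332710 / 100000000)"
      using L by (intro mult_mono[OF L]) linarith+
    then have "2089 / 1000 \<le> 14867875 / 100000000 * L ^ 3 - 74434672 / 100000000 * L ^ 2 - 195332710 / 100000000 * L"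
      by (simp add: algebra_simps power2_eq_square power3_eq_cube)
    with 1 show "main L + (113 / 100 * L + 16266 / 10000 + (58 / 36 + 20 / 1296 - 16266 / 10000)) \<le> 1 / 4 * L ^ 3"
      by linarith
  qed (use assms in auto)
  finally show ?thesis by (simp add: L_def)
qed

text \<open>Each prime \<open>p\<close> is compared with \<open>p - 1\<close>, whose prime factors
  are already available; two terms of the series suffice.\<close>

lemma ln_large_primes:
  "239789 / 100000 \<le> ln (11::real)" "ln (11::real) \<le> 239790 / 100000"
  "256494 / 100000 \<le> ln (13::real)" "ln (13::real) \<le> 256495 / 100000"
  "283321 / 100000 \<le> ln (17::real)" "ln (17::real) \<le> 283322 / 100000"
  "294443 / 100000 \<le> ln (19::real)" "ln (19::real) \<le> 294444 / 100000"
  "313549 / 100000 \<le> ln (23::real)"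
  "336729 / 100000 \<le> ln (29::real)"
  "343398 / 100000 \<le> ln (31::real)"
proof -
  have p: "ln (12::real) = 2 * ln 2 + ln 3" "ln (16::real) = 4 * ln 2" "ln (18::real) = ln 2 + 2 * ln 3"
      "ln (22::real) = ln 2 + ln 11" "ln (28::real) = 2 * ln 2 + ln 7" "ln (30::real) = ln 3 + ln 10"
    using ln_mult_pos[of 2 "6::real"] ln_mult_pos[of 2 "8::real"] ln_mult_pos[of 2 "9::real"]
      ln_mult_pos[of 2 "11::real"] ln_mult_pos[of 4 "7::real"] ln_mult_pos[of 3 "10::real"] ln_products by simp_all
  have r11: "953100 / 10000000 \<le> ln (11::real) - ln 10" "ln (11::real) - ln 10 \<le> 953102 / 10000000"
    using ln_ratio_bounds[of 10 11 2] by (simp_all add: eval_nat_numeral)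
  have r13: "800426 / 10000000 \<le> ln (13::real) - ln 12" "ln (13::real) - ln 12 \<le> 800428 / 10000000"
    using ln_ratio_bounds[of 12 13 2] by (simp_all add: eval_nat_numeral)
  have r17: "606246 / 10000000 \<le> ln (17::real) - ln 16" "ln (17::real) - ln 16 \<le> 606247 / 10000000"
    using ln_ratio_bounds[of 16 17 2] by (simp_all add: eval_nat_numeral)
  have r19: "540672 / 10000000 \<le> ln (19::real) - ln 18" "ln (19::real) - ln 18 \<le> 540673 / 10000000"
    using ln_ratio_bounds[of 18 19 2] by (simp_all add: eval_nat_numeral)
  have r23: "444517 / 10000000 \<le> ln (23::real) - ln 22" "ln (23::real) - ln 22 \<le> 444518 / 10000000"
    using ln_ratio_bounds[of 22 23 2] by (simp_all add: eval_nat_numeral)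
  have r29: "350913 / 10000000 \<le> ln (29::real) - ln 28" "ln (29::real) - ln 28 \<le> 350914 / 10000000"
    using ln_ratio_bounds[of 28 29 2] by (simp_all add: eval_nat_numeral)
  have r31: "327898 / 10000000 \<le> ln (31::real) - ln 30" "ln (31::real) - ln 30 \<le> 327899 / 10000000"
    using ln_ratio_bounds[of 30 31 2] by (simp_all add: eval_nat_numeral)
  show "239789 / 100000 \<le> ln (11::real)" "ln (11::real) \<le> 239790 / 100000" "256494 / 100000 \<le> ln (13::real)" "ln (13::real) \<le> 256495 / 100000" "283321 / 100000 \<le> ln (17::real)" "ln (17::real) \<le> 283322 / 100000" "294443 / 100000 \<le> ln (19::real)" "ln (19::real) \<le> 294444 / 100000" "313549 / 100000 \<le> ln (23::real)" "336729 / 100000 \<le> ln (29::real)" "343398 / 100000 \<le> ln (31::real)"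
    using r11 r13 r17 r19 r23 r29 r31 p ln_bounds by linarith+
qed

lemma ln_composites:
  "ln (12::real) = 2 * ln 2 + ln 3"
  "ln (14::real) = ln 2 + ln 7"
  "ln (15::real) = ln 3 + ln 5"
  "ln (16::real) = 4 * ln 2"
  "ln (18::real) = ln 2 + 2 * ln 3"
  "ln (20::real) = 2 * ln 2 + ln 5"
  "ln (21::real) = ln 3 + ln 7"
  "ln (22::real) = ln 2 + ln 11"
  "ln (24::real) = 3 * ln 2 + ln 3"
  "ln (25::real) = 2 * ln 5"
  "ln (26::real) = ln 2 + ln 13"
  "ln (27::real) = 3 * ln 3"
  "ln (28::real) = 2 * ln 2 + ln 7"
  "ln (30::real) = ln 2 + ln 3 + ln 5"
  "ln (32::real) = 5 * ln 2"
  "ln (33::real) = ln 3 + ln 11"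
  "ln (34::real) = ln 2 + ln 17"
  "ln (35::real) = ln 5 + ln 7"
proof -
  show "ln (12::real) = 2 * ln 2 + ln 3"
    using ln_mult_pos[of 2 "6::real"] ln_mult_pos[of 2 "3::real"] by simp
  show "ln (14::real) = ln 2 + ln 7"
    using ln_mult_pos[of 2 "7::real"] by simp
  show "ln (15::real) = ln 3 + ln 5"
    using ln_mult_pos[of 3 "5::real"] by simp
  show "ln (16::real) = 4 * ln 2"
    using ln_mult_pos[of 2 "8::real"] ln_mult_pos[of 2 "4::real"] ln_mult_pos[of 2 "2::real"] by simp
  show "ln (18::real) = ln 2 + 2 * ln 3"
    using ln_mult_pos[of 2 "9::real"] ln_mult_pos[of 3 "3::real"] by simp
  show "ln (20::real) = 2 * ln 2 + ln 5"
    using ln_mult_pos[of 2 "10::real"] ln_mult_pos[of 2 "5::real"] by simp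
  show "ln (21::real) = ln 3 + ln 7"
    using ln_mult_pos[of 3 "7::real"] by simp
  show "ln (22::real) = ln 2 + ln 11"
    using ln_mult_pos[of 2 "11::real"] by simp
  show "ln (24::real) = 3 * ln 2 + ln 3"
    using ln_mult_pos[of 2 "12::real"] ln_mult_pos[of 2 "6::real"] ln_mult_pos[of 2 "3::real"] by simp
  show "ln (25::real) = 2 * ln 5"
    using ln_mult_pos[of 5 "5::real"] by simp
  show "ln (26::real) = ln 2 + ln 13"
    using ln_mult_pos[of 2 "13::real"] by simp
  show "ln (27::real) = 3 * ln 3"
    using ln_mult_pos[of 3 "9::real"] ln_mult_pos[of 3 "3::real"] by simp
  show "ln (28::real) = 2 * ln 2 + ln 7"
    using ln_mult_pos[of 2 "14::real"] ln_mult_pos[of 2 "7::real"] by simp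
  show "ln (30::real) = ln 2 + ln 3 + ln 5"
    using ln_mult_pos[of 2 "15::real"] ln_mult_pos[of 3 "5::real"] by simp
  show "ln (32::real) = 5 * ln 2"
    using ln_mult_pos[of 2 "16::real"] ln_mult_pos[of 2 "8::real"] ln_mult_pos[of 2 "4::real"] ln_mult_pos[of 2 "2::real"] by simp
  show "ln (33::real) = ln 3 + ln 11"
    using ln_mult_pos[of 3 "11::real"] by simp
  show "ln (34::real) = ln 2 + ln 17"
    using ln_mult_pos[of 2 "17::real"] by simp
  show "ln (35::real) = ln 5 + ln 7"
    using ln_mult_pos[of 5 "7::real"] by simp
qed

lemma ln_432: "ln (432::real) = 2 * ln 12 + ln 3"
  using ln_mult_pos[of 12 "36::real"] ln_mult_pos[of 12 "3::real"] by simp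

text \<open>A checkpoint of the computation. With \<open>C = 0\<close> the inequality is trivial for
  \<open>b = 1\<close> and only the value of \<open>dsum\<close> is recorded;
  \<open>C = 1000\<close> and \<open>C = 4000\<close> encode the two claimed upper bounds.\<close>

definition verified :: "nat \<Rightarrow> real \<Rightarrow> nat \<Rightarrow> nat \<Rightarrow> bool" where
  "verified C b n S \<longleftrightarrow> dsum n = S \<and>
    (\<forall>x. b \<le> x \<and> x < real n \<longrightarrow> real C * divisor_square_sum x \<le> 1000 * (x * ln x ^ 3))"

lemma verified_run:
  fixes r :: real
  assumes "verified C b n S" "r \<le> ln (real a)"
    "run k (if n = s * s then 1 else 0) (init n s) C (P * n + Q * (n - a)) (P + Q) S F"
    "n' = n + k" "s * s \<le> n" "n + k \<le> (s + 1) * (s + 1)" "0 < k" "0 \<le> r" "1 \<le> a" "a \<le> n"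
    "real P \<le> 1000 * r ^ 3" "real Q \<le> 3000 * r\<^sup>2"
  shows "verified C b n' F"
proof -
  have "dsum n = S" using assms(1) by (simp add: verified_def)
  moreover have "counters n s (init n s)" using assms(9,10) by (intro counters_init) simp
  ultimately have "dsum (n + k) = F"
    "\<And>x. real n \<le> x \<Longrightarrow> x < real (n + k) \<Longrightarrow> real C * divisor_square_sum x \<le> 1000 * (x * ln x ^ 3)"
    using run_bound[OF assms(3)] assms(2,5-12) by blast+
  then show ?thesis
    unfolding verified_def assms(4) using assms(1) by (meson not_le verified_def)
qed

text \<open>The range from \<open>n\<close> to \<open>n\<close> is empty, so the factor may change
  there; this is used at 7 and 433, where the two claims begin.\<close>

lemma verified_restart: "verified C b n S \<Longrightarrow> verified C' (real n) n S"
  by (simp add: verified_def)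

lemma verified_1: "verified 0 1 1 0"
  by (simp add: verified_def dsum_def)

lemma verified_3: "verified 0 1 3 5"
proof -
  have l: "0 \<le> ln (real 1)" by simp
  show ?thesis
    by (rule verified_run[OF verified_1 l, where k = 2 and s = 1 and P = 0 and Q = 0])
      (simp_all add: run_simps power_divide)
qed

lemma verified_4: "verified 0 1 4 9"
proof -
  have l: "0 \<le> ln (real 1)" by simp
  show ?thesis
    by (rule verified_run[OF verified_3 l, where k = 1 and s = 1 and P = 0 and Q = 0])
      (simp_all add: run_simps power_divide)
qed

lemma verified_7: "verified 0 1 7 38"
proof -
  have l: "0 \<le> ln (real 1)" by simp
  show ?thesis
    by (rule verified_run[OF verified_4 l, where k = 3 and s = 2 and P = 0 and Q = 0])
      (simp_all add: run_simps power_divide)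
qed

text \<open>From here on \<open>P\<close> and \<open>Q\<close> are \<open>1000 * r ^ 3\<close> and
  \<open>3000 * r\<^sup>2\<close>, rounded down.\<close>

lemma verified_9: "verified 1000 7 9 58"
proof -
  have l: "194591 / 100000 \<le> ln (real 7)"
    using ln_bounds(11,12) by simp
  show ?thesis
    by (rule verified_run[OF verified_7[THEN verified_restart[where C' = 1000], simplified] l, where k = 2 and s = 2 and P = 7368 and Q = 11359])
      (simp_all add: run_simps power_divide)
qed

lemma verified_12: "verified 1000 7 12 87"
proof -
  have l: "21972 / 10000 \<le> ln (real 9)"
    using ln_bounds(15,16) by simp
  show ?thesis
    by (rule verified_run[OF verified_9 l, where k = 3 and s = 3 and P = 10607 and Q = 14483])
      (simp_all add: run_simps power_divide)
qed

text \<open>The tangent stays at 9; the checkpoint 12 in between serves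
  \<open>divisor_square_sum_error_small\<close>.\<close>

lemma verified_16: "verified 1000 7 16 159"
proof -
  have l: "21972 / 10000 \<le> ln (real 9)"
    using ln_bounds(15,16) by simp
  show ?thesis
    by (rule verified_run[OF verified_12 l, where k = 4 and s = 3 and P = 10607 and Q = 14483])
      (simp_all add: run_simps power_divide)
qed

lemma verified_25: "verified 1000 7 25 364"
proof -
  have l: "27725 / 10000 \<le> ln (real 16)"
    using ln_mult_pos[of 4 "4::real"] ln_bounds(5,6) by simp
  show ?thesis
    by (rule verified_run[OF verified_16 l, where k = 9 and s = 4 and P = 21311 and Q = 23060])
      (simp_all add: run_simps power_divide)
qed

lemma verified_36: "verified 1000 7 36 597"
proof -
  have l: "32188 / 10000 \<le> ln (real 25)"
    using ln_mult_pos[of 5 "5::real"] ln_bounds(7,8) by simp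
  show ?thesis
    by (rule verified_run[OF verified_25 l, where k = 11 and s = 5 and P = 33348 and Q = 31082])
      (simp_all add: run_simps power_divide)
qed

lemma verified_49: "verified 1000 7 49 1042"
proof -
  have l: "35835 / 10000 \<le> ln (real 36)"
    using ln_mult_pos[of 6 "6::real"] ln_bounds(9,10) by simp
  show ?thesis
    by (rule verified_run[OF verified_36 l, where k = 13 and s = 6 and P = 46017 and Q = 38524])
      (simp_all add: run_simps power_divide)
qed

lemma verified_64: "verified 1000 7 64 1523"
proof -
  have l: "38918 / 10000 \<le> ln (real 49)"
    using ln_mult_pos[of 7 "7::real"] ln_bounds(11,12) by simp
  show ?thesis
    by (rule verified_run[OF verified_49 l, where k = 15 and s = 7 and P = 58945 and Q = 45438])
      (simp_all add: run_simps power_divide)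
qed

lemma verified_81: "verified 1000 7 81 2196"
proof -
  have l: "41588 / 10000 \<le> ln (real 64)"
    using ln_mult_pos[of 8 "8::real"] ln_bounds(13,14) by simp
  show ?thesis
    by (rule verified_run[OF verified_64 l, where k = 17 and s = 8 and P = 71929 and Q = 51886])
      (simp_all add: run_simps power_divide)
qed

lemma verified_100: "verified 1000 7 100 2965"
proof -
  have l: "43944 / 10000 \<le> ln (real 81)"
    using ln_mult_pos[of 9 "9::real"] ln_bounds(15,16) by simp
  show ?thesis
    by (rule verified_run[OF verified_81 l, where k = 19 and s = 9 and P = 84859 and Q = 57932])
      (simp_all add: run_simps power_divide)
qed

lemma verified_121: "verified 1000 7 121 4038"
proof -
  have l: "46051 / 10000 \<le> ln (real 100)"
    using ln_mult_pos[of 10 "10::real"] ln_bounds(17,18) by simp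
  show ?thesis
    by (rule verified_run[OF verified_100 l, where k = 21 and s = 10 and P = 97660 and Q = 63620])
      (simp_all add: run_simps power_divide)
qed

lemma verified_144: "verified 1000 7 144 4995"
proof -
  have l: "47957 / 10000 \<le> ln (real 121)"
    using ln_mult_pos[of 11 "11::real"] ln_large_primes(1,2) by simp
  show ?thesis
    by (rule verified_run[OF verified_121 l, where k = 23 and s = 11 and P = 110295 and Q = 68996])
      (simp_all add: run_simps power_divide)
qed

lemma verified_169: "verified 1000 7 169 6476"
proof -
  have l: "49698 / 10000 \<le> ln (real 144)"
    using ln_mult_pos[of 12 "12::real"] ln_composites(1) ln_bounds(1,2) ln_bounds(3,4) by simp
  show ?thesis
    by (rule verified_run[OF verified_144 l, where k = 25 and s = 12 and P = 122748 and Q = 74096])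
      (simp_all add: run_simps power_divide)
qed

lemma verified_196: "verified 1000 7 196 7877"
proof -
  have l: "51298 / 10000 \<le> ln (real 169)"
    using ln_mult_pos[of 13 "13::real"] ln_large_primes(3,4) by simp
  show ?thesis
    by (rule verified_run[OF verified_169 l, where k = 27 and s = 13 and P = 134989 and Q = 78944])
      (simp_all add: run_simps power_divide)
qed

lemma verified_225: "verified 1000 7 225 9650"
proof -
  have l: "52781 / 10000 \<le> ln (real 196)"
    using ln_mult_pos[of 14 "14::real"] ln_composites(2) ln_bounds(1,2) ln_bounds(11,12) by simp
  show ?thesis
    by (rule verified_run[OF verified_196 l, where k = 29 and s = 14 and P = 147039 and Q = 83575])
      (simp_all add: run_simps power_divide)
qed

lemma verified_256: "verified 1000 7 256 11571"
proof -
  have l: "54161 / 10000 \<le> ln (real 225)"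
    using ln_mult_pos[of 15 "15::real"] ln_composites(3) ln_bounds(3,4) ln_bounds(7,8) by simp
  show ?thesis
    by (rule verified_run[OF verified_225 l, where k = 31 and s = 15 and P = 158876 and Q = 88002])
      (simp_all add: run_simps power_divide)
qed

lemma verified_289: "verified 1000 7 289 13836"
proof -
  have l: "55451 / 10000 \<le> ln (real 256)"
    using ln_mult_pos[of 16 "16::real"] ln_composites(4) ln_bounds(1,2) by simp
  show ?thesis
    by (rule verified_run[OF verified_256 l, where k = 33 and s = 16 and P = 170501 and Q = 92244])
      (simp_all add: run_simps power_divide)
qed

lemma verified_324: "verified 1000 7 324 15981"
proof -
  have l: "56664 / 10000 \<le> ln (real 289)"
    using ln_mult_pos[of 17 "17::real"] ln_large_primes(5,6) by simp
  show ?thesis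
    by (rule verified_run[OF verified_289 l, where k = 35 and s = 17 and P = 181937 and Q = 96324])
      (simp_all add: run_simps power_divide)
qed

lemma verified_361: "verified 1000 7 361 18922"
proof -
  have l: "57807 / 10000 \<le> ln (real 324)"
    using ln_mult_pos[of 18 "18::real"] ln_composites(5) ln_bounds(1,2) ln_bounds(3,4) by simp
  show ?thesis
    by (rule verified_run[OF verified_324 l, where k = 37 and s = 18 and P = 193170 and Q = 100249])
      (simp_all add: run_simps power_divide)
qed

lemma verified_400: "verified 1000 7 400 21507"
proof -
  have l: "58888 / 10000 \<le> ln (real 361)"
    using ln_mult_pos[of 19 "19::real"] ln_large_primes(7,8) by simp
  show ?thesis
    by (rule verified_run[OF verified_361 l, where k = 39 and s = 19 and P = 204211 and Q = 104033])
      (simp_all add: run_simps power_divide)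
qed

lemma verified_433: "verified 1000 7 433 24192"
proof -
  have l: "59914 / 10000 \<le> ln (real 400)"
    using ln_mult_pos[of 20 "20::real"] ln_composites(6) ln_bounds(1,2) ln_bounds(7,8) by simp
  show ?thesis
    by (rule verified_run[OF verified_400 l, where k = 33 and s = 20 and P = 215072 and Q = 107690])
      (simp_all add: run_simps power_divide)
qed

text \<open>At 432 the inequality still fails: \<open>4 * 24192 = 96768\<close> exceeds
  \<open>432 * ln 432 ^ 3\<close>, about 96541. With so little room the tangent must touch close to
  433, and 432 has only the prime factors 2 and 3.\<close>

lemma verified_441: "verified 4000 433 441 24700"
proof -
  have l: "606842 / 100000 \<le> ln (real 432)"
    using ln_432 ln_composites(1) ln_bounds(1,2) ln_bounds(3,4) by simp
  show ?thesis
    by (rule verified_run[OF verified_433[THEN verified_restart[where C' = 4000], simplified] l, where k = 8 and s = 20 and P = 223473 and Q = 110477])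
      (simp_all add: run_simps power_divide)
qed

lemma verified_484: "verified 4000 433 484 28117"
proof -
  have l: "608904 / 100000 \<le> ln (real 441)"
    using ln_mult_pos[of 21 "21::real"] ln_composites(7) ln_bounds(3,4) ln_bounds(11,12) by simp
  show ?thesis
    by (rule verified_run[OF verified_441 l, where k = 43 and s = 21 and P = 225759 and Q = 111229])
      (simp_all add: run_simps power_divide)
qed

lemma verified_529: "verified 4000 433 529 31782"
proof -
  have l: "61820 / 10000 \<le> ln (real 484)"
    using ln_mult_pos[of 22 "22::real"] ln_composites(8) ln_bounds(1,2) ln_large_primes(1,2) by simp
  show ?thesis
    by (rule verified_run[OF verified_484 l, where k = 45 and s = 22 and P = 236258 and Q = 114651])
      (simp_all add: run_simps power_divide)
qed

lemma verified_576: "verified 4000 433 576 35427"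
proof -
  have l: "62709 / 10000 \<le> ln (real 529)"
    using ln_mult_pos[of 23 "23::real"] ln_large_primes(9) by simp
  show ?thesis
    by (rule verified_run[OF verified_529 l, where k = 47 and s = 23 and P = 246598 and Q = 117972])
      (simp_all add: run_simps power_divide)
qed

lemma verified_625: "verified 4000 433 625 39840"
proof -
  have l: "63561 / 10000 \<le> ln (real 576)"
    using ln_mult_pos[of 24 "24::real"] ln_composites(9) ln_bounds(1,2) ln_bounds(3,4) by simp
  show ?thesis
    by (rule verified_run[OF verified_576 l, where k = 49 and s = 24 and P = 256786 and Q = 121200])
      (simp_all add: run_simps power_divide)
qed

lemma verified_676: "verified 4000 433 676 44341"
proof -
  have l: "64377 / 10000 \<le> ln (real 625)"
    using ln_mult_pos[of 25 "25::real"] ln_composites(10) ln_bounds(7,8) by simp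
  show ?thesis
    by (rule verified_run[OF verified_625 l, where k = 51 and s = 25 and P = 266803 and Q = 124331])
      (simp_all add: run_simps power_divide)
qed

lemma verified_729: "verified 4000 433 729 49214"
proof -
  have l: "65161 / 10000 \<le> ln (real 676)"
    using ln_mult_pos[of 26 "26::real"] ln_composites(11) ln_bounds(1,2) ln_large_primes(3,4) by simp
  show ?thesis
    by (rule verified_run[OF verified_676 l, where k = 53 and s = 26 and P = 276670 and Q = 127378])
      (simp_all add: run_simps power_divide)
qed

lemma verified_784: "verified 4000 433 784 54087"
proof -
  have l: "65916 / 10000 \<le> ln (real 729)"
    using ln_mult_pos[of 27 "27::real"] ln_composites(12) ln_bounds(3,4) by simp
  show ?thesis
    by (rule verified_run[OF verified_729 l, where k = 55 and s = 27 and P = 286399 and Q = 130347])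
      (simp_all add: run_simps power_divide)
qed

lemma verified_841: "verified 4000 433 841 59944"
proof -
  have l: "66644 / 10000 \<le> ln (real 784)"
    using ln_mult_pos[of 28 "28::real"] ln_composites(13) ln_bounds(1,2) ln_bounds(11,12) by simp
  show ?thesis
    by (rule verified_run[OF verified_784 l, where k = 57 and s = 28 and P = 295994 and Q = 133242])
      (simp_all add: run_simps power_divide)
qed

lemma verified_900: "verified 4000 433 900 64789"
proof -
  have l: "67345 / 10000 \<le> ln (real 841)"
    using ln_mult_pos[of 29 "29::real"] ln_large_primes(10) by simp
  show ?thesis
    by (rule verified_run[OF verified_841 l, where k = 59 and s = 29 and P = 305433 and Q = 136060])
      (simp_all add: run_simps power_divide)
qed

lemma verified_961: "verified 4000 433 961 71458"
proof -
  have l: "68023 / 10000 \<le> ln (real 900)"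
    using ln_mult_pos[of 30 "30::real"] ln_composites(14) ln_bounds(1,2) ln_bounds(3,4) ln_bounds(7,8) by simp
  show ?thesis
    by (rule verified_run[OF verified_900 l, where k = 61 and s = 30 and P = 314751 and Q = 138813])
      (simp_all add: run_simps power_divide)
qed

lemma verified_1024: "verified 4000 433 1024 77527"
proof -
  have l: "68679 / 10000 \<le> ln (real 961)"
    using ln_mult_pos[of 31 "31::real"] ln_large_primes(11) by simp
  show ?thesis
    by (rule verified_run[OF verified_961 l, where k = 63 and s = 31 and P = 323945 and Q = 141504])
      (simp_all add: run_simps power_divide)
qed

lemma verified_1089: "verified 4000 433 1089 84132"
proof -
  have l: "69314 / 10000 \<le> ln (real 1024)"
    using ln_mult_pos[of 32 "32::real"] ln_composites(15) ln_bounds(1,2) by simp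
  show ?thesis
    by (rule verified_run[OF verified_1024 l, where k = 65 and s = 32 and P = 333014 and Q = 144132])
      (simp_all add: run_simps power_divide)
qed

lemma verified_1156: "verified 4000 433 1156 91293"
proof -
  have l: "69930 / 10000 \<le> ln (real 1089)"
    using ln_mult_pos[of 33 "33::real"] ln_composites(16) ln_bounds(3,4) ln_large_primes(1,2) by simp
  show ?thesis
    by (rule verified_run[OF verified_1089 l, where k = 67 and s = 33 and P = 341972 and Q = 146706])
      (simp_all add: run_simps power_divide)
qed

lemma verified_1225: "verified 4000 433 1225 98622"
proof -
  have l: "70527 / 10000 \<le> ln (real 1156)"
    using ln_mult_pos[of 34 "34::real"] ln_composites(17) ln_bounds(1,2) ln_large_primes(5,6) by simp
  show ?thesis
    by (rule verified_run[OF verified_1156 l, where k = 69 and s = 34 and P = 350805 and Q = 149221])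
      (simp_all add: run_simps power_divide)
qed

lemma verified_1296: "verified 4000 433 1296 105803"
proof -
  have l: "71106 / 10000 \<le> ln (real 1225)"
    using ln_mult_pos[of 35 "35::real"] ln_composites(18) ln_bounds(7,8) ln_bounds(11,12) by simp
  show ?thesis
    by (rule verified_run[OF verified_1225 l, where k = 71 and s = 35 and P = 359516 and Q = 151681])
      (simp_all add: run_simps power_divide)
qed

lemma verified_dsum: "verified C b n S \<Longrightarrow> dsum n = S"
  by (simp add: verified_def)

text \<open>One test per interval between checkpoints: \<open>r\<close> and \<open>v\<close> enclose
  the logarithms of the ends to three decimals, and \<open>q\<close> is \<open>a\<close> to the
  power 3/4, rounded down to two.\<close>

lemma divisor_square_sum_error_small:
  fixes x :: real
  assumes "2 \<le> x" "x < 361"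
  shows "\<bar>divisor_square_sum x - x * main (ln x)\<bar> \<le> 973 / 100 * (x powr (3 / 4) * ln x)"
proof -
  \<comment> \<open>Here \<open>a' = 3\<close>, because \<open>dsum 2 = 1\<close> leaves out
    \<open>n = 2\<close> and the main term at 4 would exceed it by more than the allowed
    error.\<close>
  have i2: ?thesis if "2 \<le> x" "x < 4"
    by (rule interval_error_bound[where a = 2 and a' = 3 and b = 4 and l = 5 and u = 9
        and r = "693 / 1000" and v = "1387 / 1000" and q = "168 / 100"])
      (use that verified_3[THEN verified_dsum] verified_4[THEN verified_dsum] ln_bounds(1,2) ln_bounds(5,6) in \<open>simp_all add: power_divide\<close>)
  have i4: ?thesis if "4 \<le> x" "x < 7"
    by (rule interval_error_bound[where a = 4 and a' = 4 and b = 7 and l = 9 and u = 38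
        and r = "1386 / 1000" and v = "1946 / 1000" and q = "282 / 100"])
      (use that verified_4[THEN verified_dsum] verified_7[THEN verified_dsum] ln_bounds(5,6) ln_bounds(11,12) in \<open>simp_all add: power_divide\<close>)
  have i7: ?thesis if "7 \<le> x" "x < 9"
    by (rule interval_error_bound[where a = 7 and a' = 7 and b = 9 and l = 38 and u = 58
        and r = "1945 / 1000" and v = "2198 / 1000" and q = "430 / 100"])
      (use that verified_7[THEN verified_dsum] verified_9[THEN verified_dsum] ln_bounds(11,12) ln_bounds(15,16) in \<open>simp_all add: power_divide\<close>)
  have i9: ?thesis if "9 \<le> x" "x < 12"
    by (rule interval_error_bound[where a = 9 and a' = 9 and b = 12 and l = 58 and u = 87
        and r = "2197 / 1000" and v = "2485 / 1000" and q = "519 / 100"])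
      (use that verified_9[THEN verified_dsum] verified_12[THEN verified_dsum] ln_bounds(15,16) ln_composites(1) ln_bounds(1,2) ln_bounds(3,4) in \<open>simp_all add: power_divide\<close>)
  have i12: ?thesis if "12 \<le> x" "x < 16"
    by (rule interval_error_bound[where a = 12 and a' = 12 and b = 16 and l = 87 and u = 159
        and r = "2484 / 1000" and v = "2773 / 1000" and q = "644 / 100"])
      (use that verified_12[THEN verified_dsum] verified_16[THEN verified_dsum] ln_composites(1) ln_bounds(1,2) ln_bounds(3,4) ln_mult_pos[of 4 "4::real"] ln_bounds(5,6) in \<open>simp_all add: power_divide\<close>)
  have i16: ?thesis if "16 \<le> x" "x < 25"
    by (rule interval_error_bound[where a = 16 and a' = 16 and b = 25 and l = 159 and u = 364
        and r = "2772 / 1000" and v = "3219 / 1000" and q = "800 / 100"])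
      (use that verified_16[THEN verified_dsum] verified_25[THEN verified_dsum] ln_mult_pos[of 4 "4::real"] ln_bounds(5,6) ln_mult_pos[of 5 "5::real"] ln_bounds(7,8) in \<open>simp_all add: power_divide\<close>)
  have i25: ?thesis if "25 \<le> x" "x < 36"
    by (rule interval_error_bound[where a = 25 and a' = 25 and b = 36 and l = 364 and u = 597
        and r = "3218 / 1000" and v = "3584 / 1000" and q = "1118 / 100"])
      (use that verified_25[THEN verified_dsum] verified_36[THEN verified_dsum] ln_mult_pos[of 5 "5::real"] ln_bounds(7,8) ln_mult_pos[of 6 "6::real"] ln_bounds(9,10) in \<open>simp_all add: power_divide\<close>)
  have i36: ?thesis if "36 \<le> x" "x < 49"
    by (rule interval_error_bound[where a = 36 and a' = 36 and b = 49 and l = 597 and u = 1042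
        and r = "3583 / 1000" and v = "3892 / 1000" and q = "1469 / 100"])
      (use that verified_36[THEN verified_dsum] verified_49[THEN verified_dsum] ln_mult_pos[of 6 "6::real"] ln_bounds(9,10) ln_mult_pos[of 7 "7::real"] ln_bounds(11,12) in \<open>simp_all add: power_divide\<close>)
  have i49: ?thesis if "49 \<le> x" "x < 64"
    by (rule interval_error_bound[where a = 49 and a' = 49 and b = 64 and l = 1042 and u = 1523
        and r = "3891 / 1000" and v = "4159 / 1000" and q = "1852 / 100"])
      (use that verified_49[THEN verified_dsum] verified_64[THEN verified_dsum] ln_mult_pos[of 7 "7::real"] ln_bounds(11,12) ln_mult_pos[of 8 "8::real"] ln_bounds(13,14) in \<open>simp_all add: power_divide\<close>)
  have i64: ?thesis if "64 \<le> x" "x < 81"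
    by (rule interval_error_bound[where a = 64 and a' = 64 and b = 81 and l = 1523 and u = 2196
        and r = "4158 / 1000" and v = "4395 / 1000" and q = "2262 / 100"])
      (use that verified_64[THEN verified_dsum] verified_81[THEN verified_dsum] ln_mult_pos[of 8 "8::real"] ln_bounds(13,14) ln_mult_pos[of 9 "9::real"] ln_bounds(15,16) in \<open>simp_all add: power_divide\<close>)
  have i81: ?thesis if "81 \<le> x" "x < 100"
    by (rule interval_error_bound[where a = 81 and a' = 81 and b = 100 and l = 2196 and u = 2965
        and r = "4394 / 1000" and v = "4606 / 1000" and q = "2700 / 100"])
      (use that verified_81[THEN verified_dsum] verified_100[THEN verified_dsum] ln_mult_pos[of 9 "9::real"] ln_bounds(15,16) ln_mult_pos[of 10 "10::real"] ln_bounds(17,18) in \<open>simp_all add: power_divide\<close>)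
  have i100: ?thesis if "100 \<le> x" "x < 121"
    by (rule interval_error_bound[where a = 100 and a' = 100 and b = 121 and l = 2965 and u = 4038
        and r = "4605 / 1000" and v = "4796 / 1000" and q = "3162 / 100"])
      (use that verified_100[THEN verified_dsum] verified_121[THEN verified_dsum] ln_mult_pos[of 10 "10::real"] ln_bounds(17,18) ln_mult_pos[of 11 "11::real"] ln_large_primes(1,2) in \<open>simp_all add: power_divide\<close>)
  have i121: ?thesis if "121 \<le> x" "x < 144"
    by (rule interval_error_bound[where a = 121 and a' = 121 and b = 144 and l = 4038 and u = 4995
        and r = "4795 / 1000" and v = "4970 / 1000" and q = "3648 / 100"])
      (use that verified_121[THEN verified_dsum] verified_144[THEN verified_dsum] ln_mult_pos[of 11 "11::real"] ln_large_primes(1,2) ln_mult_pos[of 12 "12::real"] ln_composites(1) ln_bounds(1,2) ln_bounds(3,4) in \<open>simp_all add: power_divide\<close>)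
  have i144: ?thesis if "144 \<le> x" "x < 169"
    by (rule interval_error_bound[where a = 144 and a' = 144 and b = 169 and l = 4995 and u = 6476
        and r = "4969 / 1000" and v = "5130 / 1000" and q = "4156 / 100"])
      (use that verified_144[THEN verified_dsum] verified_169[THEN verified_dsum] ln_mult_pos[of 12 "12::real"] ln_composites(1) ln_bounds(1,2) ln_bounds(3,4) ln_mult_pos[of 13 "13::real"] ln_large_primes(3,4) in \<open>simp_all add: power_divide\<close>)
  have i169: ?thesis if "169 \<le> x" "x < 196"
    by (rule interval_error_bound[where a = 169 and a' = 169 and b = 196 and l = 6476 and u = 7877
        and r = "5129 / 1000" and v = "5279 / 1000" and q = "4687 / 100"])
      (use that verified_169[THEN verified_dsum] verified_196[THEN verified_dsum] ln_mult_pos[of 13 "13::real"] ln_large_primes(3,4) ln_mult_pos[of 14 "14::real"] ln_composites(2) ln_bounds(1,2) ln_bounds(11,12) in \<open>simp_all add: power_divide\<close>)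
  have i196: ?thesis if "196 \<le> x" "x < 225"
    by (rule interval_error_bound[where a = 196 and a' = 196 and b = 225 and l = 7877 and u = 9650
        and r = "5278 / 1000" and v = "5417 / 1000" and q = "5238 / 100"])
      (use that verified_196[THEN verified_dsum] verified_225[THEN verified_dsum] ln_mult_pos[of 14 "14::real"] ln_composites(2) ln_bounds(1,2) ln_bounds(11,12) ln_mult_pos[of 15 "15::real"] ln_composites(3) ln_bounds(3,4) ln_bounds(7,8) in \<open>simp_all add: power_divide\<close>)
  have i225: ?thesis if "225 \<le> x" "x < 256"
    by (rule interval_error_bound[where a = 225 and a' = 225 and b = 256 and l = 9650 and u = 11571
        and r = "5416 / 1000" and v = "5546 / 1000" and q = "5809 / 100"])
      (use that verified_225[THEN verified_dsum] verified_256[THEN verified_dsum] ln_mult_pos[of 15 "15::real"] ln_composites(3) ln_bounds(3,4) ln_bounds(7,8) ln_mult_pos[of 16 "16::real"] ln_composites(4) ln_bounds(1,2) in \<open>simp_all add: power_divide\<close>)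
  have i256: ?thesis if "256 \<le> x" "x < 289"
    by (rule interval_error_bound[where a = 256 and a' = 256 and b = 289 and l = 11571 and u = 13836
        and r = "5545 / 1000" and v = "5667 / 1000" and q = "6400 / 100"])
      (use that verified_256[THEN verified_dsum] verified_289[THEN verified_dsum] ln_mult_pos[of 16 "16::real"] ln_composites(4) ln_bounds(1,2) ln_mult_pos[of 17 "17::real"] ln_large_primes(5,6) in \<open>simp_all add: power_divide\<close>)
  have i289: ?thesis if "289 \<le> x" "x < 324"
    by (rule interval_error_bound[where a = 289 and a' = 289 and b = 324 and l = 13836 and u = 15981
        and r = "5666 / 1000" and v = "5781 / 1000" and q = "7009 / 100"])
      (use that verified_289[THEN verified_dsum] verified_324[THEN verified_dsum] ln_mult_pos[of 17 "17::real"] ln_large_primes(5,6) ln_mult_pos[of 18 "18::real"] ln_composites(5) ln_bounds(1,2) ln_bounds(3,4) in \<open>simp_all add: power_divide\<close>)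
  have i324: ?thesis if "324 \<le> x" "x < 361"
    by (rule interval_error_bound[where a = 324 and a' = 324 and b = 361 and l = 15981 and u = 18922
        and r = "5780 / 1000" and v = "5889 / 1000" and q = "7636 / 100"])
      (use that verified_324[THEN verified_dsum] verified_361[THEN verified_dsum] ln_mult_pos[of 18 "18::real"] ln_composites(5) ln_bounds(1,2) ln_bounds(3,4) ln_mult_pos[of 19 "19::real"] ln_large_primes(7,8) in \<open>simp_all add: power_divide\<close>)
  show ?thesis using assms i2 i4 i7 i9 i12 i16 i25 i36 i49 i64 i81 i100 i121 i144 i169 i196 i225 i256 i289 i324 by (meson not_le)
qed

theorem theorem2:
  shows "(\<forall>x::real. x \<ge> 2 \<longrightarrow>
            \<bar>divisor_square_sum x
               - (D1 * x * ln x ^ 3 + D2 * x * ln x ^ 2 + D3 * x * ln x + D4 * x)\<bar>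
            \<le> 9.73 * x powr (3 / 4) * ln x + 0.73 * x powr (1 / 2)) \<and>
         D1 = 1 / pi ^ 2 \<and>
         (0.744 < D2 \<and> D2 \<le> 0.745) \<and>
         (0.823 < D3 \<and> D3 \<le> 0.824) \<and>
         (0.460 < D4 \<and> D4 \<le> 0.461) \<and>
         (\<forall>x::real. x \<ge> 433 \<longrightarrow> divisor_square_sum x \<le> 1 / 4 * x * ln x ^ 3) \<and>
         (\<forall>x::real. x \<ge> 7 \<longrightarrow> divisor_square_sum x \<le> x * ln x ^ 3)"
proof (intro conjI allI impI)
  fix x :: real
  assume x: "x \<ge> 2"
  have m: "D1 * x * ln x ^ 3 + D2 * x * ln x ^ 2 + D3 * x * ln x + D4 * x = x * main (ln x)"
    by (simp add: main_eq algebra_simps)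
  have "\<bar>divisor_square_sum x - x * main (ln x)\<bar>
      \<le> 973 / 100 * (x powr (3 / 4) * ln x) + 73 / 100 * x powr (1 / 2)"
  proof (cases "x < 361")
    case True
    have "0 \<le> 73 / 100 * x powr (1 / 2)" by simp
    then show ?thesis using divisor_square_sum_error_small[OF x True] by linarith
  next
    case False
    then show ?thesis using ln_large_primes by (intro divisor_square_sum_error_large) auto
  qed
  then show "\<bar>divisor_square_sum x
      - (D1 * x * ln x ^ 3 + D2 * x * ln x ^ 2 + D3 * x * ln x + D4 * x)\<bar>
      \<le> 9.73 * x powr (3 / 4) * ln x + 0.73 * x powr (1 / 2)"
    unfolding m by simp
next
  have quarter: "4 * divisor_square_sum x \<le> x * ln x ^ 3" if "433 \<le> x" for x :: real
  proof (cases "x < 1296")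
    case True
    then show ?thesis using verified_1296 that by (auto simp: verified_def)
  next
    case False
    then show ?thesis by (intro divisor_square_sum_upper_large) auto
  qed
  show "divisor_square_sum x \<le> 1 / 4 * x * ln x ^ 3" if "433 \<le> x" for x :: real
    using quarter[OF that] by simp
  show "divisor_square_sum x \<le> x * ln x ^ 3" if "7 \<le> x" for x :: real
  proof (cases "x < 433")
    case True
    then show ?thesis using verified_433 that by (auto simp: verified_def)
  next
    case False
    \<comment> \<open>A nonnegative sum is at most four times itself, so the sharper bound from 433
      on implies this one.\<close>
    have "0 \<le> divisor_square_sum x" by (simp add: divisor_square_sum_def sum_nonneg)
    then show ?thesis using quarter[of x] False by linarith
  qed
qed (use D_bounds D1_eq in \<open>simp_all add: power2_eq_square\<close>)

end
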